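(* Consider LinUCB run for $T$ rounds on the unit ball $\mathcal B^d$ with exploration parameter $\beta$ (chosen as described in the context, at failure level $\delta=1/T$), under the sub-Gaussian noise assumption described in the context. Let $\lambda_{t,1}\ge\cdots\ge\lambda_{t,d}$ be the eigenvalues of $\boldsymbol\Lambda_t$, $\boldsymbol v_{t,1}$ a unit leading eigenvector, and $\overline\lambda_t=\frac1{d-1}\sum_{i=2}^d\lambda_{t,i}$. There exists a time $t_1=\Theta(\beta^2d)$, which is the end of the initial exploration phase in the sense that $\lambda_{t,d}\asymp t/d$ for all $1\le t\le t_1$ and $\lambda_{t_1,1}-\lambda_{t_1,2}\gtrsim t_1$ with probability greater than $1-1/T$, such that with probability greater than $1-1/T$ the following hold for all $t_1\le t\le T$. (a) ($O(\sqrt t)$ growth of the non-leading eigenvalues) $$\lambda_{t,d}\asymp\overline\lambda_t\asymp\beta\sqrt{\frac td}.$$ (b) (Concentration of the leading eigenvector) $$\|\boldsymbol v_{t,1}-\boldsymbol\theta^\star\|_2\lesssim\frac{\beta}{\sqrt{\lambda_{t,d}}}.$$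
   Context: Setting. Let $d\ge 2$, let $T$ be the horizon, and let $\boldsymbol\theta^\star\in\mathbb R^d$ with $\|\boldsymbol\theta^\star\|_2=1$. In each round $t=1,\dots,T$ the learner picks an action $\boldsymbol a_t$ in the unit ball $\mathcal B^d=\{\boldsymbol x\in\mathbb R^d:\|\boldsymbol x\|_2\le 1\}$ (every vector of the ball is available in every round) and observes $r_t=\langle\boldsymbol a_t,\boldsymbol\theta^\star\rangle+\epsilon_t$. With $\mathcal F_t=\sigma(\boldsymbol a_1,r_1,\dots,\boldsymbol a_t,r_t)$, the noise satisfies $\mathbb E[\epsilon_t\mid\mathcal F_{t-1}]=0$, $\mathrm{Var}[\epsilon_t\mid\mathcal F_{t-1}]=\sigma^2$, and $\mathbb E[\exp(\lambda\epsilon_t)\mid\mathcal F_{t-1}]\le\exp(\sigma^2\lambda^2/2)$ for all $\lambda\in\mathbb R$ and $t\ge1$, where $\sigma>0$. LinUCB with deterministic exploration parameter $\beta=\beta(T,d)>0$: $\boldsymbol\Lambda_0=\boldsymbol I_d$, $\boldsymbol\Lambda_t=\boldsymbol I_d+\sum_{s=1}^t\boldsymbol a_s\boldsymbol a_s^\top$, ridge estimator $\overline{\boldsymbol\theta}_t=\boldsymbol\Lambda_t^{-1}\sum_{s=1}^t\boldsymbol a_s r_s$, projected estimator $\widehat{\boldsymbol\theta}_t=\overline{\boldsymbol\theta}_t/\|\overline{\boldsymbol\theta}_t\|_2$ (an arbitrary unit vector if $\overline{\boldsymbol\theta}_t=0$, e.g. at $t=0$), UCB score $\mathrm{UCB}_t(\boldsymbol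 a)=\langle\boldsymbol a,\widehat{\boldsymbol\theta}_{t-1}\rangle+\beta\sqrt{\boldsymbol a^\top\boldsymbol\Lambda_{t-1}^{-1}\boldsymbol a}$, and $\boldsymbol a_t\in\arg\max_{\boldsymbol a\in\mathcal B^d}\mathrm{UCB}_t(\boldsymbol a)$. Choice of $\beta$ at failure level $\delta$: $\beta$ is chosen so that, with probability at least $1-\delta$, $\langle\boldsymbol a,\boldsymbol\theta^\star\rangle\le\mathrm{UCB}_t(\boldsymbol a)$ holds uniformly over all $t$ and all $\boldsymbol a\in\mathcal B^d$ (optimism). Notation: the sign of $\boldsymbol v_{t,1}$ is chosen so that $\langle\boldsymbol v_{t,1},\boldsymbol\theta^\star\rangle\ge0$. $f\lesssim g$ means $|f|\le c_1|g|$ for a constant $c_1>0$ not depending on $T$ (or $t$), $f\gtrsim g$ means $|f|\ge c_2|g|$ for a constant $c_2>0$ not depending on $T$ (or $t$), and $f\asymp g$ (equivalently $f=\Theta(g)$) means both. *)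

theory Defs
  imports "HOL-Probability.Probability"
begin

definition eigenspace :: "real^'n^'n \<Rightarrow> real \<Rightarrow> (real^'n) set" where
  "eigenspace A l = {v. A *v v = l *\<^sub>R v}"

(* Eigenvalues in decreasing order, repeated according to geometric multiplicity; for a symmetric
   matrix (the only case used) this is a list of CARD('n) reals. *)
definition eigenvalues_desc :: "real^'n^'n \<Rightarrow> real list" where
  "eigenvalues_desc A =
     rev (sorted_list_of_multiset
       (\<Sum>l | eigenspace A l \<noteq> {0}. replicate_mset (dim (eigenspace A l)) l))"

(* Indices start at 1: eigval A 1 is the largest and eigval A CARD('n) the smallest eigenvalue. *)
definition eigval :: "real^'n^'n \<Rightarrow> nat \<Rightarrow> real" where
  "eigval A i = eigenvalues_desc A ! (i - 1)"

definition eigval_rest_avg :: "real^'n^'n \<Rightarrow> real" where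
  "eigval_rest_avg A = (\<Sum>i=2..CARD('n). eigval A i) / (real CARD('n) - 1)"

definition leading_unit_eigenvector :: "real^'n^'n \<Rightarrow> real^'n \<Rightarrow> bool" where
  "leading_unit_eigenvector A v \<longleftrightarrow> norm v = 1 \<and> v \<in> eigenspace A (eigval A 1)"

(* Pathwise quantities: x s and y s are the action and the reward of round s = 1, 2, ..., and
   h t is the projected estimator formed after round t. *)

definition gram :: "(nat \<Rightarrow> real^'n) \<Rightarrow> nat \<Rightarrow> real^'n^'n" where
  "gram x t = mat 1 + (\<Sum>s=1..t. (columnvector (x s) :: real^1^'n) ** rowvector (x s))"

definition ridge :: "(nat \<Rightarrow> real^'n) \<Rightarrow> (nat \<Rightarrow> real) \<Rightarrow> nat \<Rightarrow> real^'n" where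
  "ridge x y t = matrix_inv (gram x t) *v (\<Sum>s=1..t. y s *\<^sub>R x s)"

definition ucb ::
  "real \<Rightarrow> (nat \<Rightarrow> real^'n) \<Rightarrow> (nat \<Rightarrow> real^'n) \<Rightarrow> nat \<Rightarrow> real^'n \<Rightarrow> real" where
  "ucb \<beta> x h t b = b \<bullet> h (t - 1) + \<beta> * sqrt (b \<bullet> (matrix_inv (gram x (t - 1)) *v b))"

definition optimism ::
  "real \<Rightarrow> nat \<Rightarrow> real^'n \<Rightarrow> (nat \<Rightarrow> real^'n) \<Rightarrow> (nat \<Rightarrow> real^'n) \<Rightarrow> bool" where
  "optimism \<beta> T \<theta> x h \<longleftrightarrow> (\<forall>t\<in>{1..T}. \<forall>b\<in>cball 0 1. b \<bullet> \<theta> \<le> ucb \<beta> x h t b)"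

definition reward ::
  "real^'n \<Rightarrow> (nat \<Rightarrow> 'w \<Rightarrow> real^'n) \<Rightarrow> (nat \<Rightarrow> 'w \<Rightarrow> real) \<Rightarrow> nat \<Rightarrow> 'w \<Rightarrow> real" where
  "reward \<theta> a \<epsilon> t \<omega> = a t \<omega> \<bullet> \<theta> + \<epsilon> t \<omega>"

definition history ::
  "'w measure \<Rightarrow> (nat \<Rightarrow> 'w \<Rightarrow> real^'n) \<Rightarrow> (nat \<Rightarrow> 'w \<Rightarrow> real) \<Rightarrow> nat \<Rightarrow> 'w measure" where
  "history M a r t = sigma (space M)
     {(\<lambda>\<omega>. (a s \<omega>, r s \<omega>)) -` A \<inter> space M | s A. s \<in> {1..t} \<and> A \<in> sets borel}"

(* A run of T rounds of LinUCB with exploration parameter \<beta>. Integrability of all exponential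
   moments of the noise entails that of the noise and of its square, so each real_cond_exp below
   is a genuine conditional expectation. *)
locale linucb = prob_space M for M :: "'w measure" +
  fixes \<sigma> \<beta> :: real and T :: nat and \<theta> :: "real^'n"
    and a :: "nat \<Rightarrow> 'w \<Rightarrow> real^'n" and \<epsilon> :: "nat \<Rightarrow> 'w \<Rightarrow> real"
    and \<theta>h :: "nat \<Rightarrow> 'w \<Rightarrow> real^'n"
  assumes norm_theta: "norm \<theta> = 1"
    and noise_measurable: "\<And>t. t \<in> {1..T} \<Longrightarrow> \<epsilon> t \<in> borel_measurable M"
    and action_predictable: "\<And>t. t \<in> {1..T} \<Longrightarrow>
      a t \<in> borel_measurable (history M a (reward \<theta> a \<epsilon>) (t - 1))"
    and noise_integrable: "\<And>t l. t \<in> {1..T} \<Longrightarrow> integrable M (\<lambda>\<omega>. exp (l * \<epsilon> t \<omega>))"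
    and noise_mean: "\<And>t. t \<in> {1..T} \<Longrightarrow>
      AE \<omega> in M. real_cond_exp M (history M a (reward \<theta> a \<epsilon>) (t - 1)) (\<epsilon> t) \<omega> = 0"
    and noise_variance: "\<And>t. t \<in> {1..T} \<Longrightarrow>
      AE \<omega> in M. real_cond_exp M (history M a (reward \<theta> a \<epsilon>) (t - 1))
        (\<lambda>w. (\<epsilon> t w - real_cond_exp M (history M a (reward \<theta> a \<epsilon>) (t - 1)) (\<epsilon> t) w)\<^sup>2) \<omega> = \<sigma>\<^sup>2"
    and noise_subgaussian: "\<And>t l. t \<in> {1..T} \<Longrightarrow>
      AE \<omega> in M. real_cond_exp M (history M a (reward \<theta> a \<epsilon>) (t - 1))
        (\<lambda>w. exp (l * \<epsilon> t w)) \<omega> \<le> exp (\<sigma>\<^sup>2 * l\<^sup>2 / 2)"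
    and estimator_adapted: "\<And>t. t < T \<Longrightarrow>
      \<theta>h t \<in> borel_measurable (history M a (reward \<theta> a \<epsilon>) t)"
    and estimator_unit: "\<And>t \<omega>. t < T \<Longrightarrow> \<omega> \<in> space M \<Longrightarrow> norm (\<theta>h t \<omega>) = 1"
    and estimator_projection: "\<And>t \<omega>. t < T \<Longrightarrow> \<omega> \<in> space M \<Longrightarrow>
      ridge (\<lambda>s. a s \<omega>) (\<lambda>s. reward \<theta> a \<epsilon> s \<omega>) t \<noteq> 0 \<Longrightarrow>
      \<theta>h t \<omega> = ridge (\<lambda>s. a s \<omega>) (\<lambda>s. reward \<theta> a \<epsilon> s \<omega>) t
              /\<^sub>R norm (ridge (\<lambda>s. a s \<omega>) (\<lambda>s. reward \<theta> a \<epsilon> s \<omega>) t)"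
    and action_argmax: "\<And>t \<omega>. t \<in> {1..T} \<Longrightarrow> \<omega> \<in> space M \<Longrightarrow>
      is_arg_max (ucb \<beta> (\<lambda>s. a s \<omega>) (\<lambda>s. \<theta>h s \<omega>) t) (\<lambda>b. b \<in> cball 0 1) (a t \<omega>)"

(* Some measurable event of the required probability is contained in {\<omega>. P \<omega>}; this agrees with
   a bound on the probability of {\<omega>. P \<omega>} whenever that set is itself measurable. *)
definition holds_with_prob_ge :: "'w measure \<Rightarrow> real \<Rightarrow> ('w \<Rightarrow> bool) \<Rightarrow> bool" where
  "holds_with_prob_ge M p P \<longleftrightarrow> (\<exists>E\<in>sets M. measure M E \<ge> p \<and> (\<forall>\<omega>\<in>E. P \<omega>))"

definition holds_with_prob_gt :: "'w measure \<Rightarrow> real \<Rightarrow> ('w \<Rightarrow> bool) \<Rightarrow> bool" where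
  "holds_with_prob_gt M p P \<longleftrightarrow> (\<exists>E\<in>sets M. measure M E > p \<and> (\<forall>\<omega>\<in>E. P \<omega>))"

definition lesssim_by :: "real \<Rightarrow> real \<Rightarrow> real \<Rightarrow> bool" where
  "lesssim_by c f g \<longleftrightarrow> \<bar>f\<bar> \<le> c * \<bar>g\<bar>"

definition gtrsim_by :: "real \<Rightarrow> real \<Rightarrow> real \<Rightarrow> bool" where
  "gtrsim_by c f g \<longleftrightarrow> \<bar>f\<bar> \<ge> c * \<bar>g\<bar>"

definition asymp_by :: "real \<Rightarrow> real \<Rightarrow> real \<Rightarrow> real \<Rightarrow> bool" where
  "asymp_by c1 c2 f g \<longleftrightarrow> lesssim_by c1 f g \<and> gtrsim_by c2 f g"

(* The exploration parameter is a function of the horizon and the dimension (and of the known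
   noise level) alone, so one value of \<beta> has to be optimistic for every LinUCB run it can face:
   every \<theta>, noise law and choice among tied actions. The two type arguments supply the sample
   space and the dimension. *)
definition optimistic_parameter ::
  "'w itself \<Rightarrow> 'n::finite itself \<Rightarrow> real \<Rightarrow> nat \<Rightarrow> real \<Rightarrow> real \<Rightarrow> bool" where
  "optimistic_parameter W N \<sigma> T \<delta> \<beta> \<longleftrightarrow>
     (\<forall>(M :: 'w measure) (\<theta> :: real^'n) a \<epsilon> \<theta>h. linucb M \<sigma> \<beta> T \<theta> a \<epsilon> \<theta>h \<longrightarrow>
        holds_with_prob_ge M (1 - \<delta>) (\<lambda>\<omega>. optimism \<beta> T \<theta> (\<lambda>s. a s \<omega>) (\<lambda>s. \<theta>h s \<omega>)))"

(* The run stops after round T, so the claims about rounds up to t1 concern rounds up to T. *)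
definition exploration_phase_upto ::
  "real \<Rightarrow> real \<Rightarrow> nat \<Rightarrow> nat \<Rightarrow> (nat \<Rightarrow> real^'n) \<Rightarrow> bool" where
  "exploration_phase_upto c1 c2 T t1 x \<longleftrightarrow>
     (\<forall>t\<in>{1..min t1 T}. asymp_by c1 c2 (eigval (gram x t) CARD('n)) (real t / real CARD('n))) \<and>
     (t1 \<le> T \<longrightarrow> gtrsim_by c2 (eigval (gram x t1) 1 - eigval (gram x t1) 2) (real t1))"

end

theory Submission
  imports Defs "HOL-Real_Asymp.Real_Asymp"
begin

text \<open>
  Once the ridge estimator is known to be accurate, the argument is deterministic. Write \<open>\<Lambda>\<close> for the
  Gram matrix, \<open>\<lambda>\<close> for its least eigenvalue and \<open>w\<close> for the norm of the chosen action with respect to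
  the inverse of \<open>\<Lambda>\<close>. Comparing the action with a perturbation of the projected estimator along a least
  eigenvector shows that \<open>w\<close> is at least a multiple of \<open>min (1 / sqrt \<lambda>) (\<beta> / \<lambda>)\<close>. As long as \<open>\<lambda>\<close> is at
  most of order \<open>\<beta>\<^sup>2\<close>, the trace of the inverse therefore decreases fast enough for \<open>\<lambda>\<close> to grow linearly.
  Later on, the accuracy of the estimator bounds the regret of a round by a multiple of
  \<open>\<beta> w + \<beta>\<^sup>2 / \<lambda>\<close>, and the regret controls the sum of the non-leading eigenvalues. Over a dyadic
  window of rounds the squared widths sum to at most the logarithm of a ratio of determinants, which is
  controlled by the logarithms of the two bounds being proved; so the induction closes without
  the logarithmic loss of the usual regret analysis.

  Optimism has probability at least \<open>1 - 1 / T\<close>, whereas a strictly larger probability is claimed. So the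
  conclusion is derived on the event that every ridge estimator has error at most
  \<open>B sqrt (ln T) + 1\<close> in the norm given by \<open>\<Lambda>\<close>, with \<open>B\<close> large, and optimism only serves to show that \<open>\<beta>\<close>
  is at least a constant multiple of this radius: \<open>\<beta>\<close> has to be optimistic for every run, in particular
  for runs with Rademacher noise, which exist over every type of outcomes that carries a run at
  all. If \<open>T > 2\<^sup>k\<close> for a suitable \<open>k\<close> of order \<open>\<beta>\<^sup>2\<close>, then every pattern of the first \<open>k\<close> signs has
  probability above \<open>1 / T\<close>, and an adversarial pattern makes the noise imitate a different
  parameter and breaks optimism.
\<close>

section \<open>Eigenvalues of symmetric matrices\<close>

text \<open>The constants must be chosen before the horizon, \<open>\<beta>\<close> and the run,
  although the upper bound on the non-leading eigenvalues and the lower bound on the least one each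
  need the other. The circle is broken by the order of choice: the upper constant is written as
  \<open>A / l\<close> with \<open>A\<close> fixed first from the dimension and the regret constant;
  the lower bound then asks that a logarithm of \<open>A / l^2\<close> stay below a multiple of
  \<open>1 / l\<close>, which holds for small \<open>l\<close>. The confidence radius grows like
  sqrt (ln T), so it may enter these constants only through its ratio to \<open>\<beta>\<close>;
  this is why \<open>\<beta>\<close> has to be bounded below. The given run cannot provide this, as
  its own noise may be benign, so the quantification over all runs in
  \<open>optimistic_parameter\<close> is exploited. It ranges over one fixed type of outcomes, which
  might seem too small for independent signs; but noise of conditional mean zero and positive
  conditional variance over T rounds forces at least 2^T outcomes. The end \<open>t1\<close> of
  exploration is deterministic, a multiple of \<open>\<beta>^2\<close>; the factor d of the claim is
  absorbed by the constants.\<close>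

lemma symmetric_inner_swap:
  fixes A :: "real^'n^'n"
  assumes "transpose A = A"
  shows "x \<bullet> (A *v y) = (A *v x) \<bullet> y"
  by (metis assms dot_lmul_matrix transpose_matrix_vector)

text \<open>A maximiser of the Rayleigh quotient on the unit sphere of the orthogonal complement of
  \<open>E\<close> is an eigenvector. The complement is invariant under \<open>A\<close> because
  \<open>E\<close> consists of eigenvectors and \<open>A\<close> is symmetric, so the residual
  \<open>r\<close> is an admissible direction of variation.\<close>

lemma symmetric_eigenvector_orthogonal_exists:
  fixes A :: "real^'n^'n"
  assumes sym: "transpose A = A" and fin: "finite E" and card: "card E < CARD('n)"
    and eig: "\<And>b. b \<in> E \<Longrightarrow> \<exists>l. A *v b = l *\<^sub>R b"
  shows "\<exists>e l. norm e = 1 \<and> (\<forall>b\<in>E. b \<bullet> e = 0) \<and> A *v e = l *\<^sub>R e"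
proof -
  define S where "S = {x :: real^'n. \<forall>b\<in>E. b \<bullet> x = 0}"
  have subS: "x + s *\<^sub>R y \<in> S" if "x \<in> S" "y \<in> S" for x y s
    using that by (auto simp: S_def inner_add_right)
  have dimE: "dim E < DIM(real^'n)"
    using dim_le_card'[OF fin] card by simp
  obtain z where z: "z \<noteq> 0" "\<And>y. y \<in> span E \<Longrightarrow> orthogonal z y"
    using orthogonal_to_subspace_exists[OF dimE] by blast
  have zS: "z /\<^sub>R norm z \<in> S"
    using z(2)[OF span_base] by (auto simp: S_def orthogonal_def inner_commute)
  have "S = (\<Inter>b\<in>E. {x. b \<bullet> x = 0})" by (auto simp: S_def)
  then have "closed S" by (auto intro: closed_hyperplane)
  then have "compact (sphere 0 1 \<inter> S)" by (auto intro: compact_Int_closed)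
  moreover have "z /\<^sub>R norm z \<in> sphere 0 1 \<inter> S" using zS z(1) by simp
  moreover have "continuous_on (sphere 0 1 \<inter> S) (\<lambda>x. x \<bullet> (A *v x))"
    by (intro continuous_intros matrix_vector_mult_linear_continuous_on)
  ultimately obtain e where e: "e \<in> sphere 0 1 \<inter> S"
    and emax: "\<And>y. y \<in> sphere 0 1 \<inter> S \<Longrightarrow> y \<bullet> (A *v y) \<le> e \<bullet> (A *v e)"
    using continuous_attains_sup[of "sphere 0 1 \<inter> S" "\<lambda>x. x \<bullet> (A *v x)"] by blast
  define l where "l = e \<bullet> (A *v e)"
  have ne: "norm e = 1" and eS: "e \<in> S" using e by auto
  have qle: "y \<bullet> (A *v y) \<le> l * (y \<bullet> y)" if "y \<in> S" for y
  proof (cases "y = 0")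
    case False
    have "y /\<^sub>R norm y \<in> sphere 0 1 \<inter> S" using that False by (auto simp: S_def)
    from emax[OF this] have "(y \<bullet> (A *v y)) / (norm y)\<^sup>2 \<le> l"
      by (simp add: l_def matrix_vector_mult_scaleR power2_eq_square field_simps)
    then show ?thesis using False by (simp add: field_simps power2_norm_eq_inner)
  qed simp
  define r where "r = A *v e - l *\<^sub>R e"
  have rS: "r \<in> S"
  proof -
    have "b \<bullet> (A *v e) = 0" if b: "b \<in> E" for b
    proof -
      obtain m where "A *v b = m *\<^sub>R b" using eig[OF b] by blast
      then have "b \<bullet> (A *v e) = m * (b \<bullet> e)" using symmetric_inner_swap[OF sym, of b e] by simp
      then show ?thesis using eS b by (simp add: S_def)
    qed
    then show ?thesis using eS by (auto simp: S_def r_def inner_diff_right)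
  qed
  have quad: "2 * s * (r \<bullet> r) + s\<^sup>2 * (r \<bullet> (A *v r) - l * (r \<bullet> r)) \<le> 0" for s
  proof -
    have re: "r \<bullet> e = 0"
      using ne by (simp add: r_def inner_diff_left inner_diff_right l_def inner_commute norm_eq_1)
    have rr: "r \<bullet> (A *v e) = r \<bullet> r"
      using re by (simp add: r_def inner_diff_right)
    have "(e + s *\<^sub>R r) \<bullet> (A *v (e + s *\<^sub>R r)) \<le> l * ((e + s *\<^sub>R r) \<bullet> (e + s *\<^sub>R r))"
      by (rule qle[OF subS[OF eS rS]])
    moreover have "(e + s *\<^sub>R r) \<bullet> (A *v (e + s *\<^sub>R r))
       = l + 2 * s * (r \<bullet> r) + s\<^sup>2 * (r \<bullet> (A *v r))"
      using rr symmetric_inner_swap[OF sym, of e r]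
      by (simp add: matrix_vector_right_distrib matrix_vector_mult_scaleR inner_add_left inner_add_right
        l_def inner_commute power2_eq_square algebra_simps)
    moreover have "(e + s *\<^sub>R r) \<bullet> (e + s *\<^sub>R r) = 1 + s\<^sup>2 * (r \<bullet> r)"
      using re ne by (simp add: inner_add_left inner_add_right inner_commute power2_eq_square norm_eq_1)
    ultimately have "l + 2 * s * (r \<bullet> r) + s\<^sup>2 * (r \<bullet> (A *v r)) \<le> l * (1 + s\<^sup>2 * (r \<bullet> r))" by simp
    then show ?thesis by (simp add: algebra_simps)
  qed
  have "r \<bullet> r = 0"
  proof (rule ccontr)
    assume "r \<bullet> r \<noteq> 0"
    then have p: "r \<bullet> r > 0" by (simp add: inner_gt_zero_iff)
    \<comment> \<open>At \<open>s = (r \<bullet> r) / c\<close> the second-order term is at most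
      half of the first-order term \<open>2 * s * (r \<bullet> r)\<close>, so \<open>quad\<close>
      fails unless \<open>r = 0\<close>.\<close>
    define c where "c = \<bar>r \<bullet> (A *v r) - l * (r \<bullet> r)\<bar> + 1"
    define s where "s = (r \<bullet> r) / c"
    have c: "c > 0" "r \<bullet> (A *v r) - l * (r \<bullet> r) \<ge> - c" by (auto simp: c_def)
    have s: "s > 0" using p c by (simp add: s_def)
    have "s\<^sup>2 * (r \<bullet> (A *v r) - l * (r \<bullet> r)) \<ge> s\<^sup>2 * (- c)"
      using c(2) by (intro mult_left_mono) auto
    with quad[of s] have "2 * s * (r \<bullet> r) - s\<^sup>2 * c \<le> 0" by simp
    moreover have "s\<^sup>2 * c = s * (r \<bullet> r)" using c by (simp add: s_def power2_eq_square)
    ultimately have "s * (r \<bullet> r) \<le> 0" by (simp add: algebra_simps)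
    then show False using s p by (simp add: mult_le_0_iff)
  qed
  then have "A *v e = l *\<^sub>R e" by (simp add: r_def)
  then show ?thesis using ne eS by (auto simp: S_def)
qed

text \<open>Indexing by the coordinate type \<open>'n\<close> makes an orthonormal family complete
  by counting, and lets \<open>l\<close> record eigenvalues with multiplicity without fixing an
  order.\<close>

definition eigenbasis :: "real^'n^'n \<Rightarrow> ('n \<Rightarrow> real^'n) \<Rightarrow> ('n \<Rightarrow> real) \<Rightarrow> bool" where
  "eigenbasis A e l \<longleftrightarrow>
     (\<forall>i j. e i \<bullet> e j = (if i = j then 1 else 0)) \<and> (\<forall>i. A *v e i = l i *\<^sub>R e i)"

theorem symmetric_eigenbasis_exists:
  fixes A :: "real^'n^'n"
  assumes sym: "transpose A = A"
  shows "\<exists>e l. eigenbasis A e l"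
proof -
  have "\<exists>E. finite E \<and> card E = k \<and> (\<forall>b\<in>E. norm b = 1 \<and> (\<exists>l. A *v b = l *\<^sub>R b)) \<and>
      (\<forall>b\<in>E. \<forall>c\<in>E. b \<noteq> c \<longrightarrow> b \<bullet> c = 0)" if "k \<le> CARD('n)" for k
    using that
  proof (induction k)
    case 0
    show ?case by (rule exI[of _ "{}"]) auto
  next
    case (Suc k)
    then obtain E where E: "finite E" "card E = k"
      "\<And>b. b \<in> E \<Longrightarrow> norm b = 1 \<and> (\<exists>l. A *v b = l *\<^sub>R b)"
      "\<And>b c. b \<in> E \<Longrightarrow> c \<in> E \<Longrightarrow> b \<noteq> c \<Longrightarrow> b \<bullet> c = 0"
      using Suc_leD by metis
    obtain e l where e: "norm e = 1" "\<forall>b\<in>E. b \<bullet> e = 0" "A *v e = l *\<^sub>R e"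
      using symmetric_eigenvector_orthogonal_exists[OF sym E(1)] E Suc.prems
      by (metis Suc_le_lessD)
    have "e \<notin> E" using e by (metis inner_eq_zero_iff norm_zero zero_neq_one)
    then show ?case using E e
      by (intro exI[of _ "insert e E"]) (auto simp: inner_commute)
  qed
  from this[of "CARD('n)"] obtain E where E: "finite E" "card E = CARD('n)"
      "\<And>b. b \<in> E \<Longrightarrow> norm b = 1 \<and> (\<exists>l. A *v b = l *\<^sub>R b)"
      "\<And>b c. b \<in> E \<Longrightarrow> c \<in> E \<Longrightarrow> b \<noteq> c \<Longrightarrow> b \<bullet> c = 0"
    by auto
  obtain e :: "'n \<Rightarrow> real^'n" where e: "bij_betw e UNIV E"
    using finite_same_card_bij[OF finite_class.finite_UNIV E(1)] E(2) by metis
  have eE: "e i \<in> E" for i using e by (auto simp: bij_betw_def)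
  obtain l where "\<And>i. A *v e i = l i *\<^sub>R e i" using E(3)[OF eE] by metis
  moreover have "e i \<bullet> e j = (if i = j then 1 else 0)" for i j
    using E(3)[OF eE[of i]] E(4)[OF eE[of i] eE[of j]] e
    by (auto simp: norm_eq_1 bij_betw_def inj_def)
  ultimately show ?thesis unfolding eigenbasis_def by blast
qed

lemma eigenbasis_inner:
  "eigenbasis A e l \<Longrightarrow> e i \<bullet> e j = (if i = j then 1 else 0)"
  by (simp add: eigenbasis_def)

lemma eigenbasis_eigen: "eigenbasis A e l \<Longrightarrow> A *v e i = l i *\<^sub>R e i"
  by (simp add: eigenbasis_def)

lemma eigenbasis_norm: "eigenbasis A e l \<Longrightarrow> norm (e i) = 1"
  by (simp add: norm_eq_1 eigenbasis_inner)

lemma eigenbasis_inj: "eigenbasis A e l \<Longrightarrow> inj e"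
  by (rule injI) (metis eigenbasis_inner zero_neq_one)

lemma eigenbasis_independent:
  assumes "eigenbasis A e l"
  shows "independent (e ` I)"
proof (rule pairwise_orthogonal_independent)
  show "pairwise orthogonal (e ` I)"
    using assms by (auto simp: pairwise_def orthogonal_def eigenbasis_inner)
  show "0 \<notin> e ` I" using eigenbasis_norm[OF assms] by (metis imageE norm_zero zero_neq_one)
qed

lemma eigenbasis_expand:
  fixes A :: "real^'n^'n"
  assumes "eigenbasis A e l"
  shows "x = (\<Sum>i\<in>UNIV. (x \<bullet> e i) *\<^sub>R e i)"
proof -
  define y where "y = x - (\<Sum>i\<in>UNIV. (x \<bullet> e i) *\<^sub>R e i)"
  have y: "y \<bullet> e j = 0" for j
    by (simp add: y_def inner_diff_left inner_sum_left eigenbasis_inner[OF assms] if_distrib cong: if_cong)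
  have "card (range e) = CARD('n)" using eigenbasis_inj[OF assms] by (simp add: card_image)
  then have "dim (range e) = DIM(real^'n)"
    using dim_eq_card_independent[OF eigenbasis_independent[OF assms, of UNIV]] by simp
  then have "span (range e) = UNIV" using dim_eq_full by blast
  then have "y \<in> span (range e)" by simp
  then have "orthogonal y y"
    by (rule orthogonal_to_span) (use y in \<open>auto simp: orthogonal_def\<close>)
  then show ?thesis by (simp add: y_def orthogonal_def)
qed

lemma eigenbasis_inner_expand:
  fixes A :: "real^'n^'n"
  assumes "eigenbasis A e l"
  shows "x \<bullet> y = (\<Sum>i\<in>UNIV. (x \<bullet> e i) * (y \<bullet> e i))"
  by (subst eigenbasis_expand[OF assms, of y]) (simp add: inner_sum_right mult.commute)

lemma eigenbasis_mult:
  fixes A :: "real^'n^'n"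
  assumes "eigenbasis A e l"
  shows "A *v x = (\<Sum>i\<in>UNIV. (l i * (x \<bullet> e i)) *\<^sub>R e i)"
  by (subst eigenbasis_expand[OF assms, of x])
    (simp add: linear_sum[OF matrix_vector_mul_linear] matrix_vector_mult_scaleR
      eigenbasis_eigen[OF assms] mult.commute)

lemma eigenbasis_quadratic_form:
  fixes A :: "real^'n^'n"
  assumes "eigenbasis A e l"
  shows "x \<bullet> (A *v x) = (\<Sum>i\<in>UNIV. l i * (x \<bullet> e i)\<^sup>2)"
  by (subst eigenbasis_mult[OF assms]) (simp add: inner_sum_right power2_eq_square mult.assoc)

lemma trace_eq_sum_inner_axis:
  fixes A :: "real^'n^'n"
  shows "trace A = (\<Sum>i\<in>UNIV. axis i 1 \<bullet> (A *v axis i 1))"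
  by (simp add: trace_def inner_axis' matrix_vector_mult_basis column_def)

lemma eigenbasis_trace:
  fixes A :: "real^'n^'n"
  assumes "eigenbasis A e l"
  shows "trace A = (\<Sum>i\<in>UNIV. l i)"
proof -
  have n: "(\<Sum>j\<in>UNIV. (axis j 1 \<bullet> e i)\<^sup>2) = 1" for i
  proof -
    have "e i \<bullet> e i = (\<Sum>j\<in>UNIV. (axis j 1 \<bullet> e i)\<^sup>2)"
      by (simp add: inner_vec_def[of "e i"] inner_axis' power2_eq_square)
    then show ?thesis using eigenbasis_inner[OF assms, of i i] by simp
  qed
  have "trace A = (\<Sum>j\<in>UNIV. \<Sum>i\<in>UNIV. l i * (axis j 1 \<bullet> e i)\<^sup>2)"
    unfolding trace_eq_sum_inner_axis eigenbasis_quadratic_form[OF assms] ..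
  also have "\<dots> = (\<Sum>i\<in>UNIV. l i * (\<Sum>j\<in>UNIV. (axis j 1 \<bullet> e i)\<^sup>2))"
    unfolding sum_distrib_left by (rule sum.swap)
  finally show ?thesis by (simp add: n)
qed

lemma eigenbasis_det:
  fixes A :: "real^'n^'n"
  assumes "eigenbasis A e l"
  shows "det A = (\<Prod>i\<in>UNIV. l i)"
proof -
  define Q :: "real^'n^'n" where "Q = (\<chi> i j. e j $ i)"
  define D :: "real^'n^'n" where "D = (\<chi> i j. if i = j then l i else 0)"
  have ev: "(A *v e j) $ i = l j * e j $ i" for i j by (simp add: eigenbasis_eigen[OF assms])
  have "A ** Q = Q ** D"
    using ev by (simp add: vec_eq_iff matrix_matrix_mult_def Q_def D_def matrix_vector_mult_def
        if_distrib mult.commute cong: if_cong)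
  then have "det A * det Q = det Q * det D" by (metis det_mul)
  moreover have "det D = (\<Prod>i\<in>UNIV. l i)"
    by (subst det_diagonal) (simp_all add: D_def)
  moreover have "det Q \<noteq> 0"
  proof -
    have "transpose Q ** Q = mat 1"
      using eigenbasis_inner[OF assms]
      by (simp add: vec_eq_iff matrix_matrix_mult_def Q_def mat_def transpose_def inner_vec_def)
    then have "det Q * det Q = 1" by (metis det_I det_mul det_transpose)
    then show ?thesis by auto
  qed
  ultimately show ?thesis by simp
qed

lemma eigenbasis_eigenspace:
  fixes A :: "real^'n^'n"
  assumes "eigenbasis A e l"
  shows "eigenspace A c = span (e ` {i. l i = c})"
proof
  show "span (e ` {i. l i = c}) \<subseteq> eigenspace A c"
  proof (rule span_minimal)
    show "subspace (eigenspace A c)"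
      by (auto simp: eigenspace_def subspace_def matrix_vector_right_distrib
          matrix_vector_mult_scaleR scaleR_add_right)
  qed (use eigenbasis_eigen[OF assms] in \<open>auto simp: eigenspace_def\<close>)
  show "eigenspace A c \<subseteq> span (e ` {i. l i = c})"
  proof
    fix x assume "x \<in> eigenspace A c"
    then have x: "A *v x = c *\<^sub>R x" by (simp add: eigenspace_def)
    have "l i * (x \<bullet> e i) = c * (x \<bullet> e i)" for i
    proof -
      have "(A *v x) \<bullet> e i = l i * (x \<bullet> e i)"
        by (subst eigenbasis_mult[OF assms])
          (simp add: inner_sum_left eigenbasis_inner[OF assms] if_distrib cong: if_cong)
      then show ?thesis using x by (simp only: inner_scaleR_left)
    qed
    then have z: "x \<bullet> e i = 0" if "l i \<noteq> c" for i using that by (metis mult_cancel_right)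
    have "x = (\<Sum>i\<in>{i. l i = c}. (x \<bullet> e i) *\<^sub>R e i)"
      by (subst eigenbasis_expand[OF assms, of x], rule sum.mono_neutral_right) (use z in auto)
    also have "\<dots> \<in> span (e ` {i. l i = c})"
      by (intro span_sum span_scale span_base) auto
    finally show "x \<in> span (e ` {i. l i = c})" .
  qed
qed

lemma eigenbasis_dim_eigenspace:
  fixes A :: "real^'n^'n"
  assumes "eigenbasis A e l"
  shows "dim (eigenspace A c) = card {i. l i = c}"
  unfolding eigenbasis_eigenspace[OF assms] dim_span
    dim_eq_card_independent[OF eigenbasis_independent[OF assms]]
  by (rule card_image) (meson eigenbasis_inj[OF assms] inj_on_subset subset_UNIV)

text \<open>The list behind \<open>eigval\<close> is built from geometric multiplicities; an
  orthonormal eigenbasis shows each of them to be the number of indices with that eigenvalue. Trace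
  and determinant formulas and Rayleigh bounds in terms of \<open>eigval\<close> all rest on
  this.\<close>

lemma eigenbasis_eigenvalues_desc:
  fixes A :: "real^'n^'n"
  assumes "eigenbasis A e l"
  shows "mset (eigenvalues_desc A) = image_mset l (mset_set UNIV)"
proof -
  have iff: "eigenspace A c \<noteq> {0} \<longleftrightarrow> c \<in> range l" for c
  proof -
    have "eigenspace A c \<noteq> {0} \<longleftrightarrow> dim (eigenspace A c) \<noteq> 0"
      unfolding eigenbasis_eigenspace[OF assms] dim_eq_0 using span_zero by blast
    also have "\<dots> \<longleftrightarrow> c \<in> range l"
      unfolding eigenbasis_dim_eigenspace[OF assms] by (auto simp: card_eq_0_iff)
    finally show ?thesis .
  qed
  have "mset (eigenvalues_desc A) = (\<Sum>c\<in>range l. replicate_mset (card {i. l i = c}) c)"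
    unfolding eigenvalues_desc_def iff eigenbasis_dim_eigenspace[OF assms] by simp
  also have "\<dots> = image_mset l (mset_set UNIV)"
  proof (rule multiset_eqI)
    fix c
    have "count (\<Sum>c\<in>range l. replicate_mset (card {i. l i = c}) c) c
      = (\<Sum>d\<in>range l. if d = c then card {i. l i = d} else 0)"
      unfolding count_sum by (rule sum.cong) auto
    also have "\<dots> = card {i. l i = c}" by (auto simp: sum.delta card_eq_0_iff)
    also have "\<dots> = count (image_mset l (mset_set UNIV)) c"
      by (simp add: count_image_mset' eq_commute)
    finally show "count (\<Sum>c\<in>range l. replicate_mset (card {i. l i = c}) c) c
      = count (image_mset l (mset_set UNIV)) c" .
  qed
  finally show ?thesis .
qed

lemma eigenbasis_length_eigenvalues:
  fixes A :: "real^'n^'n"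
  assumes "eigenbasis A e l"
  shows "length (eigenvalues_desc A) = CARD('n)"
  by (metis assms card_UNIV_def eigenbasis_eigenvalues_desc size_image_mset size_mset size_mset_set)

lemma eigenbasis_set_eigenvalues:
  fixes A :: "real^'n^'n"
  assumes "eigenbasis A e l"
  shows "set (eigenvalues_desc A) = range l"
  by (metis assms eigenbasis_eigenvalues_desc finite_class.finite_UNIV finite_set_mset_mset_set
      set_image_mset set_mset_mset)

lemma eigenvalues_desc_sorted: "sorted (rev (eigenvalues_desc A))"
  by (simp add: eigenvalues_desc_def)

lemma eigenvalues_desc_nth_antimono:
  assumes "i \<le> j" "j < length (eigenvalues_desc A)"
  shows "eigenvalues_desc A ! j \<le> eigenvalues_desc A ! i"
  using sorted_rev_nth_mono[OF eigenvalues_desc_sorted assms] .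

lemma eigval_antimono:
  fixes A :: "real^'n^'n"
  assumes "transpose A = A" "1 \<le> i" "i \<le> j" "j \<le> CARD('n)"
  shows "eigval A j \<le> eigval A i"
proof -
  obtain e l where "eigenbasis A e l" using symmetric_eigenbasis_exists[OF assms(1)] by blast
  then show ?thesis unfolding eigval_def
    using eigenbasis_length_eigenvalues[of A e l] assms
    by (intro eigenvalues_desc_nth_antimono) auto
qed

lemma eigenbasis_eigval_bounds:
  fixes A :: "real^'n^'n"
  assumes eb: "eigenbasis A e l"
  shows "l i \<le> eigval A 1" "eigval A CARD('n) \<le> l i"
proof -
  have "l i \<in> set (eigenvalues_desc A)" using eigenbasis_set_eigenvalues[OF eb] by simp
  then obtain k where k: "k < CARD('n)" "l i = eigenvalues_desc A ! k"
    using eigenbasis_length_eigenvalues[OF eb] by (metis in_set_conv_nth)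
  show "l i \<le> eigval A 1" "eigval A CARD('n) \<le> l i"
    unfolding eigval_def k(2)
    using k(1) eigenbasis_length_eigenvalues[OF eb]
    by (auto intro!: eigenvalues_desc_nth_antimono)
qed

lemma eigenbasis_eigval_range:
  fixes A :: "real^'n^'n"
  assumes eb: "eigenbasis A e l" and "1 \<le> k" "k \<le> CARD('n)"
  shows "\<exists>i. eigval A k = l i"
proof -
  have "eigval A k \<in> set (eigenvalues_desc A)" unfolding eigval_def
    using assms eigenbasis_length_eigenvalues[OF eb] by (intro nth_mem) auto
  then show ?thesis using eigenbasis_set_eigenvalues[OF eb] by auto
qed

lemma eigenbasis_image_mset_eigval:
  fixes A :: "real^'n^'n"
  assumes eb: "eigenbasis A e l"
  shows "image_mset (eigval A) (mset_set {1..CARD('n)}) = image_mset l (mset_set UNIV)"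
proof -
  have "image_mset (eigval A) (mset_set {1..CARD('n)})
      = mset (map (\<lambda>i. eigenvalues_desc A ! (i - 1)) [1..<Suc (CARD('n))])"
    unfolding eigval_def by (simp add: atLeastLessThanSuc_atLeastAtMost del: upt_Suc)
  also have "map (\<lambda>i. eigenvalues_desc A ! (i - 1)) [1..<Suc (CARD('n))] = eigenvalues_desc A"
    by (rule nth_equalityI) (simp_all add: eigenbasis_length_eigenvalues[OF eb] del: upt_Suc)
  finally show ?thesis using eigenbasis_eigenvalues_desc[OF eb] by simp
qed

lemma trace_eq_sum_eigval:
  fixes A :: "real^'n^'n"
  assumes "transpose A = A"
  shows "trace A = (\<Sum>i=1..CARD('n). eigval A i)"
proof -
  obtain e l where "eigenbasis A e l" using symmetric_eigenbasis_exists[OF assms] by blast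
  then show ?thesis
    using eigenbasis_image_mset_eigval[of A e l]
    by (simp add: eigenbasis_trace sum_unfold_sum_mset)
qed

lemma det_eq_prod_eigval:
  fixes A :: "real^'n^'n"
  assumes "transpose A = A"
  shows "det A = (\<Prod>i=1..CARD('n). eigval A i)"
proof -
  obtain e l where "eigenbasis A e l" using symmetric_eigenbasis_exists[OF assms] by blast
  then show ?thesis
    using eigenbasis_image_mset_eigval[of A e l]
    by (simp add: eigenbasis_det prod_unfold_prod_mset)
qed

lemma eigval_max:
  fixes A :: "real^'n^'n"
  assumes "transpose A = A"
  shows "x \<bullet> (A *v x) \<le> eigval A 1 * (x \<bullet> x)"
proof -
  obtain e l where eb: "eigenbasis A e l" using symmetric_eigenbasis_exists[OF assms] by blast
  show ?thesis
    unfolding eigenbasis_quadratic_form[OF eb] eigenbasis_inner_expand[OF eb, of x x] sum_distrib_left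
    using eigenbasis_eigval_bounds(1)[OF eb]
    by (intro sum_mono) (auto simp: power2_eq_square[symmetric] intro: mult_right_mono)
qed

lemma eigval_min:
  fixes A :: "real^'n^'n"
  assumes "transpose A = A"
  shows "eigval A CARD('n) * (x \<bullet> x) \<le> x \<bullet> (A *v x)"
proof -
  obtain e l where eb: "eigenbasis A e l" using symmetric_eigenbasis_exists[OF assms] by blast
  show ?thesis
    unfolding eigenbasis_quadratic_form[OF eb] eigenbasis_inner_expand[OF eb, of x x] sum_distrib_left
    using eigenbasis_eigval_bounds(2)[OF eb]
    by (intro sum_mono) (auto simp: power2_eq_square[symmetric] intro: mult_right_mono)
qed

lemma eigval_eigenvector:
  fixes A :: "real^'n^'n"
  assumes "transpose A = A" "1 \<le> k" "k \<le> CARD('n)"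
  shows "\<exists>v. norm v = 1 \<and> A *v v = eigval A k *\<^sub>R v"
proof -
  obtain e l where eb: "eigenbasis A e l" using symmetric_eigenbasis_exists[OF assms(1)] by blast
  obtain i where "eigval A k = l i" using eigenbasis_eigval_range[OF eb assms(2,3)] by blast
  then show ?thesis using eigenbasis_norm[OF eb] eigenbasis_eigen[OF eb] by metis
qed

section \<open>Positive definite matrices and rank-one updates\<close>

definition posdef :: "real^'n^'n \<Rightarrow> bool" where
  "posdef A \<longleftrightarrow> transpose A = A \<and> (\<forall>x. x \<noteq> 0 \<longrightarrow> 0 < x \<bullet> (A *v x))"

lemma posdef_symmetric: "posdef A \<Longrightarrow> transpose A = A"
  by (simp add: posdef_def)

lemma posdef_nonneg: "posdef A \<Longrightarrow> 0 \<le> x \<bullet> (A *v x)"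
  unfolding posdef_def by (cases "x = 0") (auto intro: less_imp_le)

lemma posdef_eigval_pos:
  fixes A :: "real^'n^'n"
  assumes "posdef A" "1 \<le> k" "k \<le> CARD('n)"
  shows "0 < eigval A k"
proof -
  obtain v where v: "norm v = 1" "A *v v = eigval A k *\<^sub>R v"
    using eigval_eigenvector[OF posdef_symmetric[OF assms(1)] assms(2,3)] by blast
  then have "v \<bullet> (A *v v) = eigval A k" by (simp add: norm_eq_1)
  moreover have "v \<noteq> 0" using v(1) by auto
  ultimately show ?thesis using assms(1) unfolding posdef_def by metis
qed

lemma posdef_det_pos:
  fixes A :: "real^'n^'n"
  assumes "posdef A"
  shows "0 < det A"
  unfolding det_eq_prod_eigval[OF posdef_symmetric[OF assms]]
  using posdef_eigval_pos[OF assms] by (intro prod_pos) auto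

lemma posdef_invertible: "posdef A \<Longrightarrow> invertible A"
  using posdef_det_pos[of A] by (simp add: invertible_det_nz)

lemma matrix_inv_cancel:
  fixes A :: "real^'n^'n"
  assumes "invertible A"
  shows "A *v (matrix_inv A *v x) = x" "matrix_inv A *v (A *v x) = x"
proof -
  have "A ** matrix_inv A = mat 1 \<and> matrix_inv A ** A = mat 1"
    using assms unfolding invertible_def matrix_inv_def by (rule someI_ex)
  then show "A *v (matrix_inv A *v x) = x" "matrix_inv A *v (A *v x) = x"
    by (simp_all add: matrix_vector_mul_assoc)
qed

lemmas posdef_inv_cancel = matrix_inv_cancel[OF posdef_invertible]

lemma posdef_inv_swap:
  assumes "posdef A"
  shows "x \<bullet> (matrix_inv A *v y) = (matrix_inv A *v x) \<bullet> y"
  using symmetric_inner_swap[OF posdef_symmetric[OF assms], of "matrix_inv A *v x" "matrix_inv A *v y"]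
  by (simp add: posdef_inv_cancel[OF assms])

section \<open>Dual norms of a positive definite matrix\<close>

definition anorm :: "real^'n^'n \<Rightarrow> real^'n \<Rightarrow> real" where
  "anorm A x = sqrt (x \<bullet> (A *v x))"

text \<open>For a Gram matrix this is the exploration bonus of \<open>ucb\<close> before
  multiplication by \<open>\<beta>\<close>, and the norm dual to \<open>anorm A\<close>, in which
  estimation errors are measured.\<close>

definition inorm :: "real^'n^'n \<Rightarrow> real^'n \<Rightarrow> real" where
  "inorm A x = sqrt (x \<bullet> (matrix_inv A *v x))"

lemma posdef_inv_nonneg:
  assumes "posdef A"
  shows "0 \<le> x \<bullet> (matrix_inv A *v x)"
  using posdef_nonneg[OF assms, of "matrix_inv A *v x"]
  by (simp add: posdef_inv_cancel[OF assms] inner_commute)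

lemma anorm_nonneg: "posdef A \<Longrightarrow> 0 \<le> anorm A x"
  and inorm_nonneg: "posdef A \<Longrightarrow> 0 \<le> inorm A x"
  and anorm_square: "posdef A \<Longrightarrow> (anorm A x)\<^sup>2 = x \<bullet> (A *v x)"
  and inorm_square: "posdef A \<Longrightarrow> (inorm A x)\<^sup>2 = x \<bullet> (matrix_inv A *v x)"
  by (simp_all add: anorm_def inorm_def posdef_nonneg posdef_inv_nonneg)

lemma inorm_mult: "posdef A \<Longrightarrow> inorm A (A *v x) = anorm A x"
  by (simp add: inorm_def anorm_def posdef_inv_cancel inner_commute)

lemma anorm_inv: "posdef A \<Longrightarrow> anorm A (matrix_inv A *v x) = inorm A x"
  by (simp add: inorm_def anorm_def posdef_inv_cancel inner_commute)

lemma anorm_Cauchy_Schwarz: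
  assumes pd: "posdef A"
  shows "x \<bullet> (A *v y) \<le> anorm A x * anorm A y"
proof (cases "y = 0")
  case False
  define p where "p = y \<bullet> (A *v y)"
  define s where "s = (x \<bullet> (A *v y)) / p"
  have p: "p > 0" using False pd by (simp add: p_def posdef_def)
  have "0 \<le> (x - s *\<^sub>R y) \<bullet> (A *v (x - s *\<^sub>R y))" by (rule posdef_nonneg[OF pd])
  also have "\<dots> = x \<bullet> (A *v x) - 2 * s * (x \<bullet> (A *v y)) + s\<^sup>2 * p"
    using symmetric_inner_swap[OF posdef_symmetric[OF pd], of x y]
    by (simp add: matrix_vector_mult_diff_distrib matrix_vector_mult_scaleR inner_diff_left
        inner_diff_right p_def power2_eq_square inner_commute algebra_simps)
  also have "\<dots> = x \<bullet> (A *v x) - (x \<bullet> (A *v y))\<^sup>2 / p"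
    using p by (simp add: s_def power2_eq_square field_simps)
  finally have "(x \<bullet> (A *v y))\<^sup>2 \<le> (x \<bullet> (A *v x)) * p"
    using p by (simp add: field_simps)
  then have "\<bar>x \<bullet> (A *v y)\<bar> \<le> sqrt ((x \<bullet> (A *v x)) * p)"
    using real_le_rsqrt real_sqrt_le_mono by fastforce
  then show ?thesis by (simp add: anorm_def p_def real_sqrt_mult)
qed (simp add: anorm_def)

lemma inner_le_anorm_inorm:
  assumes pd: "posdef A"
  shows "x \<bullet> y \<le> anorm A x * inorm A y"
  using anorm_Cauchy_Schwarz[OF pd, of x "matrix_inv A *v y"]
  by (simp add: posdef_inv_cancel[OF pd] anorm_inv[OF pd])

lemma abs_inner_le_anorm_inorm:
  assumes pd: "posdef A"
  shows "\<bar>x \<bullet> y\<bar> \<le> anorm A x * inorm A y"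
proof -
  have "anorm A (- x) = anorm A x"
    using matrix_vector_mult_scaleR[of A "-1" x] by (simp add: anorm_def)
  then show ?thesis
    using inner_le_anorm_inorm[OF pd, of x y] inner_le_anorm_inorm[OF pd, of "- x" y] by auto
qed

lemma anorm_triangle:
  assumes pd: "posdef A"
  shows "anorm A (x + y) \<le> anorm A x + anorm A y"
proof (cases "anorm A (x + y) = 0")
  case True
  then show ?thesis using anorm_nonneg[OF pd] by (simp add: add_nonneg_nonneg)
next
  case False
  then have p: "anorm A (x + y) > 0" using anorm_nonneg[OF pd, of "x + y"] by simp
  have "anorm A (x + y) * anorm A (x + y) = x \<bullet> (A *v (x + y)) + y \<bullet> (A *v (x + y))"
    using anorm_square[OF pd, of "x + y"] by (simp add: power2_eq_square inner_add_left)
  also have "\<dots> \<le> (anorm A x + anorm A y) * anorm A (x + y)"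
    using anorm_Cauchy_Schwarz[OF pd, of x "x + y"] anorm_Cauchy_Schwarz[OF pd, of y "x + y"]
    by (simp add: distrib_right)
  finally show ?thesis using p by (simp add: mult_le_cancel_right)
qed

lemma inorm_triangle:
  assumes pd: "posdef A"
  shows "inorm A (x + y) \<le> inorm A x + inorm A y"
  using anorm_triangle[OF pd, of "matrix_inv A *v x" "matrix_inv A *v y"]
  by (simp add: anorm_inv[OF pd] matrix_vector_right_distrib[symmetric])

lemma anorm_scaleR: "anorm A (c *\<^sub>R x) = \<bar>c\<bar> * anorm A x"
proof -
  have "(c *\<^sub>R x) \<bullet> (A *v (c *\<^sub>R x)) = c\<^sup>2 * (x \<bullet> (A *v x))"
    by (simp add: matrix_vector_mult_scaleR power2_eq_square)
  then show ?thesis unfolding anorm_def by (simp add: real_sqrt_mult)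
qed

lemma inorm_scaleR: "inorm A (c *\<^sub>R x) = \<bar>c\<bar> * inorm A x"
  using anorm_scaleR[of "matrix_inv A" c x] by (simp add: inorm_def anorm_def)

lemma anorm_ge:
  fixes A :: "real^'n^'n"
  assumes pd: "posdef A"
  shows "sqrt (eigval A CARD('n)) * norm x \<le> anorm A x"
proof -
  have "sqrt (eigval A CARD('n) * (x \<bullet> x)) \<le> anorm A x"
    unfolding anorm_def using eigval_min[OF posdef_symmetric[OF pd]] by (rule real_sqrt_le_mono)
  then show ?thesis by (simp add: real_sqrt_mult norm_eq_sqrt_inner)
qed

lemma inorm_le:
  fixes A :: "real^'n^'n"
  assumes pd: "posdef A"
  shows "inorm A x \<le> norm x / sqrt (eigval A CARD('n))"
proof (cases "inorm A x = 0")
  case True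
  then show ?thesis using posdef_eigval_pos[OF pd, of "CARD('n)"] by (simp add: Suc_leI)
next
  case False
  then have p: "inorm A x > 0" using inorm_nonneg[OF pd, of x] by simp
  let ?y = "matrix_inv A *v x"
  have l: "0 < eigval A CARD('n)" by (rule posdef_eigval_pos[OF pd]) (auto simp: Suc_leI)
  have "inorm A x * inorm A x = x \<bullet> ?y"
    using inorm_square[OF pd] by (simp add: power2_eq_square)
  also have "\<dots> \<le> norm x * norm ?y" by (rule norm_cauchy_schwarz)
  also have "norm ?y \<le> inorm A x / sqrt (eigval A CARD('n))"
    using anorm_ge[OF pd, of ?y] l by (simp add: anorm_inv[OF pd] field_simps)
  finally have "inorm A x * inorm A x \<le> (norm x / sqrt (eigval A CARD('n))) * inorm A x"
    by (simp add: mult_left_mono)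
  then show ?thesis by (rule mult_right_le_imp_le) (rule p)
qed

text \<open>Duality tested at the eigenvector alone: a component along a least eigenvector keeps the
  width of any vector large.\<close>

lemma inorm_ge_eigvec:
  assumes pd: "posdef A" and v: "norm v = 1" "A *v v = c *\<^sub>R v" "c > 0"
  shows "\<bar>x \<bullet> v\<bar> / sqrt c \<le> inorm A x"
proof -
  have "anorm A v = sqrt c" using v by (simp add: anorm_def norm_eq_1)
  then have "\<bar>v \<bullet> x\<bar> \<le> sqrt c * inorm A x" using abs_inner_le_anorm_inorm[OF pd, of v x] by simp
  then show ?thesis using v(3) by (simp add: field_simps inner_commute)
qed

section \<open>Determinants split into the leading eigenvalue and the rest\<close>

definition tail_sum :: "real^'n^'n \<Rightarrow> real" where
  "tail_sum A = (\<Sum>i=2..CARD('n). eigval A i)"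

lemma sum_head_tail:
  assumes "1 \<le> (n::nat)"
  shows "(\<Sum>i=1..n. f i) = f 1 + (\<Sum>i=2..n. (f i :: real))"
  using assms by (simp add: sum.atLeast_Suc_atMost numeral_2_eq_2)

lemma tail_sum_eq:
  fixes A :: "real^'n^'n"
  assumes "transpose A = A"
  shows "tail_sum A = trace A - eigval A 1"
  unfolding trace_eq_sum_eigval[OF assms] tail_sum_def
  by (subst sum_head_tail) (auto simp: Suc_leI)

lemma eigval_le_tail_sum:
  fixes A :: "real^'n^'n"
  assumes pd: "posdef A" and k: "2 \<le> k" "k \<le> CARD('n)"
  shows "eigval A k \<le> tail_sum A"
  unfolding tail_sum_def
  using k posdef_eigval_pos[OF pd] by (intro member_le_sum) (auto intro: less_imp_le)

lemma eigval_min_le_avg: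
  fixes A :: "real^'n^'n"
  assumes pd: "posdef A"
  shows "eigval A CARD('n) * (real CARD('n) - 1) \<le> tail_sum A"
proof -
  have "(\<Sum>i=2..CARD('n). eigval A CARD('n)) \<le> tail_sum A"
    unfolding tail_sum_def
    by (intro sum_mono eigval_antimono[OF posdef_symmetric[OF pd]]) auto
  moreover have "real (Suc CARD('n) - 2) = real CARD('n) - 1"
    using zero_less_card_finite[where ?'a='n] by (simp add: of_nat_diff Suc_leI)
  ultimately show ?thesis by (simp add: mult.commute)
qed

text \<open>The leading eigenvalue is kept apart because it grows linearly while the others grow
  like a square root; equal factors would lose this difference in the determinant ratio of a
  window.\<close>

lemma det_le_head_tail:
  fixes A :: "real^'n^'n"
  assumes pd: "posdef A"
  shows "det A \<le> eigval A 1 * tail_sum A ^ (CARD('n) - 1)"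
proof -
  have "det A = eigval A 1 * (\<Prod>i=2..CARD('n). eigval A i)"
    unfolding det_eq_prod_eigval[OF posdef_symmetric[OF pd]]
    by (subst prod.atLeast_Suc_atMost) (auto simp: Suc_leI numeral_2_eq_2)
  also have "(\<Prod>i=2..CARD('n). eigval A i) \<le> (\<Prod>i=2..CARD('n). tail_sum A)"
    using posdef_eigval_pos[OF pd] eigval_le_tail_sum[OF pd] by (intro prod_mono) (auto intro: less_imp_le)
  also have "\<dots> = tail_sum A ^ (CARD('n) - 1)" by simp
  finally show ?thesis using posdef_eigval_pos[OF pd, of 1] by (simp add: Suc_leI)
qed

lemma det_ge_head_tail:
  fixes A :: "real^'n^'n"
  assumes pd: "posdef A"
  shows "eigval A 1 * eigval A CARD('n) ^ (CARD('n) - 1) \<le> det A"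
proof -
  have m: "0 < eigval A CARD('n)" by (rule posdef_eigval_pos[OF pd]) (auto simp: Suc_leI)
  have "eigval A CARD('n) ^ (CARD('n) - 1) = (\<Prod>i=2..CARD('n). eigval A CARD('n))" by simp
  also have "\<dots> \<le> (\<Prod>i=2..CARD('n). eigval A i)"
    using m eigval_antimono[OF posdef_symmetric[OF pd]] by (intro prod_mono) (auto intro: less_imp_le)
  finally have "eigval A 1 * eigval A CARD('n) ^ (CARD('n) - 1)
      \<le> eigval A 1 * (\<Prod>i=2..CARD('n). eigval A i)"
    using posdef_eigval_pos[OF pd, of 1] by (simp add: Suc_leI)
  also have "\<dots> = det A"
    unfolding det_eq_prod_eigval[OF posdef_symmetric[OF pd]]
    by (subst (2) prod.atLeast_Suc_atMost) (auto simp: Suc_leI numeral_2_eq_2)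
  finally show ?thesis .
qed

text \<open>\<open>M\<close> acts as the identity plus a rank-one square, so all eigenvalues are at
  least 1, and the Rayleigh quotient at \<open>z\<close> pushes the largest up to
  \<open>1 + z \<bullet> z\<close>.\<close>

lemma det_ge_if_dominates:
  fixes M :: "real^'n^'n"
  assumes sym: "transpose M = M" and q: "\<And>x. x \<bullet> (M *v x) = x \<bullet> x + (z \<bullet> x)\<^sup>2"
  shows "1 + z \<bullet> z \<le> det M"
proof -
  have pd: "posdef M"
    unfolding posdef_def using sym by (auto simp: q inner_gt_zero_iff add_pos_nonneg)
  have ge1: "1 \<le> eigval M k" if k: "1 \<le> k" "k \<le> CARD('n)" for k
  proof -
    obtain v where v: "norm v = 1" "M *v v = eigval M k *\<^sub>R v"
      using eigval_eigenvector[OF sym k] by blast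
    have "v \<bullet> (M *v v) \<ge> v \<bullet> v" unfolding q by simp
    then show ?thesis using v by (simp add: norm_eq_1)
  qed
  have "1 + z \<bullet> z \<le> eigval M 1"
  proof (cases "z = 0")
    case True
    then show ?thesis using ge1[of 1] by (simp add: Suc_leI)
  next
    case False
    then have p: "z \<bullet> z > 0" by (simp add: inner_gt_zero_iff)
    have "(1 + z \<bullet> z) * (z \<bullet> z) \<le> eigval M 1 * (z \<bullet> z)"
      using eigval_max[OF sym, of z] unfolding q by (simp add: power2_eq_square algebra_simps)
    then show ?thesis by (rule mult_right_le_imp_le) (rule p)
  qed
  also have "\<dots> \<le> eigval M 1 * (\<Prod>i=2..CARD('n). eigval M i)"
    using prod_ge_1[of "{2..CARD('n)}" "eigval M"] ge1 posdef_eigval_pos[OF pd, of 1]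
    by (simp add: Suc_leI)
  also have "\<dots> = det M"
    unfolding det_eq_prod_eigval[OF sym]
    by (subst (2) prod.atLeast_Suc_atMost) (auto simp: Suc_leI numeral_2_eq_2)
  finally show ?thesis .
qed

lemma posdef_whitening:
  fixes A :: "real^'n^'n"
  assumes pd: "posdef A"
  shows "\<exists>F. det F \<noteq> 0 \<and> transpose F ** A ** F = mat 1"
proof -
  obtain e l where eb: "eigenbasis A e l"
    using symmetric_eigenbasis_exists[OF posdef_symmetric[OF pd]] by blast
  have l: "l i > 0" for i
  proof -
    have "e i \<noteq> 0" using eigenbasis_norm[OF eb, of i] by auto
    then have "0 < e i \<bullet> (A *v e i)" using pd unfolding posdef_def by blast
    then show ?thesis by (simp add: eigenbasis_eigen[OF eb] eigenbasis_inner[OF eb])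
  qed
  define F :: "real^'n^'n" where "F = (\<chi> i j. e j $ i / sqrt (l j))"
  have c: "column j F = (1 / sqrt (l j)) *\<^sub>R e j" for j
    by (simp add: column_def F_def vec_eq_iff)
  have entry: "(transpose F ** A ** F) $ i $ j = column i F \<bullet> (A *v column j F)" for i j
  proof -
    have "(transpose F ** A ** F) $ i $ j = (\<Sum>k\<in>UNIV. F $ k $ i * (\<Sum>m\<in>UNIV. A $ k $ m * F $ m $ j))"
      unfolding matrix_mul_assoc[symmetric] by (simp add: matrix_matrix_mult_def transpose_def)
    then show ?thesis by (simp add: inner_vec_def column_def matrix_vector_mult_def)
  qed
  have one: "transpose F ** A ** F = mat 1"
  proof -
    have "column i F \<bullet> (A *v column j F) = (if i = j then 1 else 0)" for i j
      using l[of i] l[of j]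
      by (simp add: c matrix_vector_mult_scaleR eigenbasis_eigen[OF eb] eigenbasis_inner[OF eb])
    then show ?thesis by (simp add: vec_eq_iff entry mat_def)
  qed
  then have "det F * det A * det F = 1" by (metis det_I det_mul det_transpose)
  then have "det F \<noteq> 0" by auto
  then show ?thesis using one by blast
qed

text \<open>After whitening \<open>A\<close>, the update becomes \<open>mat 1 + z z\<^sup>T\<close> with \<open>z \<bullet> z = a \<bullet> (A\<inverse> a)\<close>.\<close>

lemma det_rank_one_update:
  fixes A B :: "real^'n^'n"
  assumes pd: "posdef A" and B: "\<And>x. B *v x = A *v x + (a \<bullet> x) *\<^sub>R a"
    and symB: "transpose B = B"
  shows "(1 + (inorm A a)\<^sup>2) * det A \<le> det B"
proof -
  obtain F where F: "det F \<noteq> 0" "transpose F ** A ** F = mat 1"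
    using posdef_whitening[OF pd] by blast
  define z where "z = transpose F *v a"
  let ?M = "transpose F ** B ** F"
  have inner_F: "x \<bullet> (transpose F *v y) = (F *v x) \<bullet> y" for x y
    by (metis dot_lmul_matrix inner_commute transpose_matrix_vector)
  have FA: "transpose F *v (A *v (F *v x)) = x" for x
    using F(2) by (metis matrix_vector_mul_assoc matrix_vector_mul_lid)
  have "1 + z \<bullet> z \<le> det ?M"
  proof (rule det_ge_if_dominates)
    show "transpose ?M = ?M"
      by (simp add: matrix_transpose_mul symB matrix_mul_assoc)
    fix x
    have "x \<bullet> (?M *v x) = x \<bullet> (transpose F *v (B *v (F *v x)))"
      by (simp add: matrix_vector_mul_assoc matrix_mul_assoc)
    also have "\<dots> = x \<bullet> x + (z \<bullet> x)\<^sup>2"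
    proof -
      have "x \<bullet> (transpose F *v (B *v (F *v x))) = (F *v x) \<bullet> (A *v (F *v x)) + (a \<bullet> (F *v x)) * ((F *v x) \<bullet> a)"
        unfolding inner_F B by (simp add: inner_add_right)
      moreover have "(F *v x) \<bullet> (A *v (F *v x)) = x \<bullet> x" unfolding inner_F[symmetric] FA ..
      moreover have "(F *v x) \<bullet> a = z \<bullet> x" unfolding z_def using inner_F by (metis inner_commute)
      ultimately show ?thesis by (simp add: power2_eq_square inner_commute)
    qed
    finally show "x \<bullet> (?M *v x) = x \<bullet> x + (z \<bullet> x)\<^sup>2" .
  qed
  moreover have "z \<bullet> z = (inorm A a)\<^sup>2"
  proof -
    have "transpose F *v (A *v (F *v z)) = transpose F *v a" unfolding FA z_def ..
    moreover have "inj ((*v) (transpose F))"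
      using F(1) by (intro inj_matrix_vector_mult) (simp add: invertible_det_nz)
    ultimately have "A *v (F *v z) = a" by (simp add: inj_eq del: transpose_matrix_vector)
    then have "F *v z = matrix_inv A *v a" by (metis posdef_inv_cancel(2)[OF pd])
    then show ?thesis using inner_F[of z a]
      unfolding inorm_square[OF pd] z_def[symmetric] by (simp add: inner_commute)
  qed
  moreover have "det ?M = det F ^ 2 * det B" by (simp add: det_mul power2_eq_square)
  moreover have "det F ^ 2 * det A = 1"
  proof -
    have "det (transpose F ** A ** F) = 1" unfolding F(2) by simp
    then show ?thesis by (simp add: det_mul power2_eq_square ac_simps)
  qed
  moreover have "det F ^ 2 * ((1 + (inorm A a)\<^sup>2) * det A) = (1 + (inorm A a)\<^sup>2) * (det F ^ 2 * det A)"
    by (rule mult.left_commute)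
  ultimately have "det F ^ 2 * ((1 + (inorm A a)\<^sup>2) * det A) \<le> det F ^ 2 * det B"
    by (metis mult.right_neutral)
  then show ?thesis using F(1) by simp
qed

text \<open>The Sherman-Morrison formula, verified by applying \<open>B\<close> to the right-hand
  side.\<close>

lemma inv_rank_one_update:
  fixes A B :: "real^'n^'n"
  assumes pd: "posdef A" and pdB: "posdef B" and B: "\<And>x. B *v x = A *v x + (a \<bullet> x) *\<^sub>R a"
  defines "u \<equiv> matrix_inv A *v a"
  shows "matrix_inv B *v x = matrix_inv A *v x - ((u \<bullet> x) / (1 + (inorm A a)\<^sup>2)) *\<^sub>R u"
proof -
  define q where "q = (inorm A a)\<^sup>2"
  have q: "a \<bullet> u = q" by (simp add: q_def u_def inorm_square[OF pd])
  have q0: "q \<ge> 0" by (simp add: q_def)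
  have Au: "A *v u = a" by (simp add: u_def posdef_inv_cancel[OF pd])
  have ax: "a \<bullet> (matrix_inv A *v x) = u \<bullet> x"
    by (simp add: u_def posdef_inv_swap[OF pd])
  define y where "y = matrix_inv A *v x - ((u \<bullet> x) / (1 + q)) *\<^sub>R u"
  have "B *v y = x - ((u \<bullet> x) / (1 + q)) *\<^sub>R a + (u \<bullet> x - (u \<bullet> x) / (1 + q) * q) *\<^sub>R a"
    unfolding B y_def
    by (simp add: matrix_vector_mult_diff_distrib matrix_vector_mult_scaleR Au
        posdef_inv_cancel[OF pd] inner_diff_right q ax)
  also have "(u \<bullet> x) - (u \<bullet> x) / (1 + q) * q = (u \<bullet> x) / (1 + q)"
    using q0 by (simp add: field_simps)
  finally have "B *v y = x" by simp
  then have "matrix_inv B *v x = y" by (metis posdef_inv_cancel(2)[OF pdB])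
  then show ?thesis by (simp add: y_def q_def)
qed

text \<open>The trace of the inverse serves as a potential: it is within a factor
  \<open>CARD('n)\<close> of the reciprocal of the least eigenvalue
  (\<open>trace_inv_bounds\<close>), and unlike that eigenvalue it changes by an explicit amount in
  each round.\<close>

lemma trace_inv_rank_one_update:
  fixes A B :: "real^'n^'n"
  assumes pd: "posdef A" and pdB: "posdef B" and B: "\<And>x. B *v x = A *v x + (a \<bullet> x) *\<^sub>R a"
  shows "trace (matrix_inv B) = trace (matrix_inv A)
    - (norm (matrix_inv A *v a))\<^sup>2 / (1 + (inorm A a)\<^sup>2)"
proof -
  let ?u = "matrix_inv A *v a"
  have "trace (matrix_inv B) = (\<Sum>i\<in>UNIV. axis i 1 \<bullet> (matrix_inv A *v axis i 1)
      - (?u $ i)\<^sup>2 / (1 + (inorm A a)\<^sup>2))"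
    unfolding trace_eq_sum_inner_axis inv_rank_one_update[OF pd pdB B]
    by (rule sum.cong) (auto simp: inner_diff_right inner_axis inner_axis' power2_eq_square)
  also have "\<dots> = trace (matrix_inv A) - (\<Sum>i\<in>UNIV. (?u $ i)\<^sup>2) / (1 + (inorm A a)\<^sup>2)"
    by (simp add: sum_subtractf sum_divide_distrib trace_eq_sum_inner_axis)
  also have "(\<Sum>i\<in>UNIV. (?u $ i)\<^sup>2) = (norm ?u)\<^sup>2"
    unfolding power2_norm_eq_inner inner_vec_def by (simp add: power2_eq_square)
  finally show ?thesis .
qed

lemma trace_inv_bounds:
  fixes A :: "real^'n^'n"
  assumes pd: "posdef A"
  shows "1 / eigval A CARD('n) \<le> trace (matrix_inv A)"
    and "trace (matrix_inv A) \<le> real CARD('n) / eigval A CARD('n)"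
proof -
  obtain e l where eb: "eigenbasis A e l"
    using symmetric_eigenbasis_exists[OF posdef_symmetric[OF pd]] by blast
  have m: "0 < eigval A CARD('n)" by (rule posdef_eigval_pos[OF pd]) (auto simp: Suc_leI)
  have l: "eigval A CARD('n) \<le> l i" "l i > 0" for i
    using eigenbasis_eigval_bounds(2)[OF eb, of i] m by auto
  have "matrix_inv A *v e i = (1 / l i) *\<^sub>R e i" for i
  proof -
    have "A *v ((1 / l i) *\<^sub>R e i) = e i"
      using l(2)[of i] by (simp add: matrix_vector_mult_scaleR eigenbasis_eigen[OF eb])
    then show ?thesis by (metis posdef_inv_cancel(2)[OF pd])
  qed
  then have "eigenbasis (matrix_inv A) e (\<lambda>i. 1 / l i)"
    using eb by (simp add: eigenbasis_def)
  from eigenbasis_trace[OF this] have tr: "trace (matrix_inv A) = (\<Sum>i\<in>UNIV. 1 / l i)" .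
  obtain i where i: "eigval A CARD('n) = l i"
    using eigenbasis_eigval_range[OF eb, of "CARD('n)"] by (auto simp: Suc_leI)
  show "1 / eigval A CARD('n) \<le> trace (matrix_inv A)"
    unfolding tr i using l(2) by (intro member_le_sum) (auto intro: less_imp_le)
  have "(\<Sum>i\<in>UNIV. 1 / l i) \<le> (\<Sum>i\<in>(UNIV::'n set). 1 / eigval A CARD('n))"
    using l m by (intro sum_mono frac_le) auto
  then show "trace (matrix_inv A) \<le> real CARD('n) / eigval A CARD('n)" unfolding tr by simp
qed

section \<open>Gram matrices of an action sequence\<close>

lemma gram_mult:
  fixes y :: "real^'n"
  shows "gram x t *v y = y + (\<Sum>s=1..t. (x s \<bullet> y) *\<^sub>R x s)"
proof -
  have "((columnvector a :: real^1^'n) ** rowvector a) *v y = (a \<bullet> y) *\<^sub>R a" for a y :: "real^'n"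
    by (simp add: vec_eq_iff matrix_matrix_mult_def matrix_vector_mult_def columnvector_def
        rowvector_def inner_vec_def sum_distrib_left ac_simps)
  moreover have "(\<Sum>s\<in>S. M s) *v y = (\<Sum>s\<in>S. M s *v y)" if "finite S" for S and M :: "nat \<Rightarrow> real^'n^'n"
    using that by induction (auto simp: matrix_vector_mult_add_rdistrib)
  ultimately show ?thesis by (simp add: gram_def matrix_vector_mult_add_rdistrib)
qed

lemma gram_Suc: "gram x (Suc t) *v y = gram x t *v y + (x (Suc t) \<bullet> y) *\<^sub>R x (Suc t)"
  by (simp add: gram_mult)

lemma gram_cong: "(\<And>s. s \<in> {1..t} \<Longrightarrow> x s = y s) \<Longrightarrow> gram x t = gram y t"
  by (simp add: gram_def)

lemma gram_quadratic_form: "y \<bullet> (gram x t *v y) = y \<bullet> y + (\<Sum>s=1..t. (x s \<bullet> y)\<^sup>2)"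
  by (simp add: gram_mult inner_add_right inner_sum_right power2_eq_square inner_commute)

lemma gram_symmetric: "transpose (gram x t) = gram x t"
  by (simp add: gram_def transpose_def vec_eq_iff mat_def matrix_matrix_mult_def columnvector_def
      rowvector_def ac_simps)

lemma gram_posdef: "posdef (gram x t)"
  unfolding posdef_def
  by (auto simp: gram_symmetric gram_quadratic_form inner_gt_zero_iff intro!: add_pos_nonneg sum_nonneg)

lemma gram_trace:
  fixes x :: "nat \<Rightarrow> real^'n"
  shows "trace (gram x t) = real CARD('n) + (\<Sum>s=1..t. (norm (x s))\<^sup>2)"
proof -
  have n: "(\<Sum>i\<in>UNIV. (x s $ i)\<^sup>2) = (norm (x s))\<^sup>2" for s
    unfolding power2_norm_eq_inner inner_vec_def by (simp add: power2_eq_square)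
  have "trace (gram x t) = (\<Sum>i\<in>(UNIV::'n set). 1 + (\<Sum>s=1..t. (x s $ i)\<^sup>2))"
    unfolding trace_eq_sum_inner_axis gram_quadratic_form
    by (simp add: inner_axis inner_axis_axis)
  also have "\<dots> = real CARD('n) + (\<Sum>i\<in>(UNIV::'n set). \<Sum>s=1..t. (x s $ i)\<^sup>2)"
    by (simp add: sum.distrib)
  also have "(\<Sum>i\<in>(UNIV::'n set). \<Sum>s=1..t. (x s $ i)\<^sup>2) = (\<Sum>s=1..t. (norm (x s))\<^sup>2)"
    unfolding n[symmetric] by (rule sum.swap)
  finally show ?thesis .
qed

section \<open>Dynamics of the action sequence\<close>

abbreviation lmin :: "(nat \<Rightarrow> real^'n) \<Rightarrow> nat \<Rightarrow> real" where
  "lmin x t \<equiv> eigval (gram x t) CARD('n)"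

abbreviation width :: "(nat \<Rightarrow> real^'n) \<Rightarrow> nat \<Rightarrow> real" where
  "width x t \<equiv> inorm (gram x (t - 1)) (x t)"

lemma lmin_eigvec: "\<exists>v. norm v = 1 \<and> gram x t *v v = lmin x t *\<^sub>R v"
  by (rule eigval_eigenvector[OF gram_symmetric]) (auto simp: Suc_leI)

lemma lmin_mono:
  assumes "s \<le> t"
  shows "lmin x s \<le> lmin x t"
proof -
  obtain v where v: "norm v = 1" "gram x t *v v = lmin x t *\<^sub>R v" using lmin_eigvec by blast
  have "lmin x s \<le> v \<bullet> (gram x s *v v)"
    using eigval_min[OF gram_symmetric, of x s v] v(1) by (simp add: norm_eq_1)
  also have "\<dots> \<le> v \<bullet> (gram x t *v v)"
    unfolding gram_quadratic_form using assms by (intro add_left_mono sum_mono2) auto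
  also have "\<dots> = lmin x t" using v by (simp add: norm_eq_1)
  finally show ?thesis .
qed

lemma lmin_ge_1: "1 \<le> lmin x t"
proof -
  obtain v where v: "norm v = 1" "gram x t *v v = lmin x t *\<^sub>R v" using lmin_eigvec by blast
  have "v \<bullet> v \<le> v \<bullet> (gram x t *v v)" unfolding gram_quadratic_form by (simp add: sum_nonneg)
  then show ?thesis using v by (simp add: norm_eq_1)
qed

lemma lmin_pos: "0 < lmin x t"
  using lmin_ge_1[of x t] by linarith

text \<open>The elliptical potential argument: every round multiplies the determinant by at least
  one plus the squared width, and the logarithms telescope.\<close>

lemma det_gram_window:
  assumes "s \<le> t"
  shows "(\<Sum>i=Suc s..t. ln (1 + (width x i)\<^sup>2)) \<le> ln (det (gram x t)) - ln (det (gram x s))"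
  using assms
proof (induction t rule: dec_induct)
  case (step n)
  have p: "0 < det (gram x n)" by (rule posdef_det_pos[OF gram_posdef])
  have q: "0 < 1 + (width x (Suc n))\<^sup>2" by (simp add: add_pos_nonneg)
  have "(1 + (width x (Suc n))\<^sup>2) * det (gram x n) \<le> det (gram x (Suc n))"
    using det_rank_one_update[OF gram_posdef gram_Suc gram_symmetric, of x n] by simp
  then have "ln ((1 + (width x (Suc n))\<^sup>2) * det (gram x n)) \<le> ln (det (gram x (Suc n)))"
    using p q posdef_det_pos[OF gram_posdef, of x "Suc n"] by simp
  then have "ln (1 + (width x (Suc n))\<^sup>2) + ln (det (gram x n)) \<le> ln (det (gram x (Suc n)))"
    using p q by (simp add: ln_mult)
  then show ?case using step by simp
qed simp

lemma half_le_ln_1_plus: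
  assumes "0 \<le> q" "q \<le> (1::real)"
  shows "q / 2 \<le> ln (1 + q)"
proof -
  have "q / 2 \<le> q - q\<^sup>2 / 2 " using assms mult_left_mono[of q 1 q] by (simp add: power2_eq_square field_simps)
  also have "\<dots> \<le> q - q\<^sup>2 / (1 + 1)" by simp
  also have "\<dots> \<le> ln (1 + q)"
  proof -
    have "0 \<le> ln (1 + q) - q + q\<^sup>2 / 2"
    proof -
      define f where "f = (\<lambda>y::real. ln (1 + y) - y + y\<^sup>2 / 2)"
      have "f 0 \<le> f q"
      proof (rule DERIV_nonneg_imp_nondecreasing[OF assms(1)])
        fix y assume y: "0 \<le> y" "y \<le> q"
        have "DERIV f y :> 1 / (1 + y) - 1 + y"
          unfolding f_def using y by (auto intro!: derivative_eq_intros)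
        moreover have "0 \<le> 1 / (1 + y) - 1 + y" using y by (simp add: field_simps)
        ultimately show "\<exists>D. DERIV f y :> D \<and> D \<ge> 0" by blast
      qed
      then show ?thesis by (simp add: f_def)
    qed
    then show ?thesis by simp
  qed
  finally show ?thesis .
qed

text \<open>Kept apart from \<open>ucb_path\<close> because the confidence event is established for
  runs whose \<open>\<beta>\<close> is not yet known to be at least 1.\<close>

locale bounded_path =
  fixes x :: "nat \<Rightarrow> real^'n" and T :: nat
  assumes dim2: "2 \<le> CARD('n)"
    and norm_le: "\<And>t. t \<in> {1..T} \<Longrightarrow> norm (x t) \<le> 1"
begin

lemma width_le_1:
  assumes "t \<in> {1..T}"
  shows "width x t \<le> 1"
proof -
  have "width x t \<le> norm (x t) / sqrt (lmin x (t - 1))" by (rule inorm_le[OF gram_posdef])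
  also have "\<dots> \<le> 1 / 1"
    using norm_le[OF assms] lmin_ge_1[of x "t - 1"] by (intro frac_le) auto
  finally show ?thesis by simp
qed

lemma sum_width_square_le:
  assumes "s \<le> t" "t \<le> T"
  shows "(\<Sum>i=Suc s..t. (width x i)\<^sup>2) \<le> 2 * (ln (det (gram x t)) - ln (det (gram x s)))"
proof -
  have "(\<Sum>i=Suc s..t. (width x i)\<^sup>2 / 2) \<le> (\<Sum>i=Suc s..t. ln (1 + (width x i)\<^sup>2))"
    using assms width_le_1 inorm_nonneg[OF gram_posdef]
    by (intro sum_mono half_le_ln_1_plus) (auto intro!: power_le_one)
  also have "\<dots> \<le> ln (det (gram x t)) - ln (det (gram x s))"
    by (rule det_gram_window[OF assms(1)])
  finally show ?thesis by (simp add: sum_divide_distrib[symmetric])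
qed

lemma trace_gram_le:
  assumes "t \<le> T"
  shows "trace (gram x t) \<le> real CARD('n) + t"
proof -
  have "(\<Sum>s=1..t. (norm (x s))\<^sup>2) \<le> (\<Sum>s=1..t. 1)"
    using assms norm_le by (intro sum_mono power_le_one) auto
  then show ?thesis by (simp add: gram_trace)
qed

lemma eigval_top_le:
  assumes "t \<le> T"
  shows "eigval (gram x t) 1 \<le> real CARD('n) + t"
proof -
  have "0 \<le> tail_sum (gram x t)" unfolding tail_sum_def
    using posdef_eigval_pos[OF gram_posdef, of _ x t] by (intro sum_nonneg) (auto intro: less_imp_le)
  then show ?thesis using tail_sum_eq[OF gram_symmetric, of x t] trace_gram_le[OF assms] by simp
qed

lemma lmin_le:
  assumes "t \<le> T"
  shows "lmin x t \<le> 1 + t / real CARD('n)"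
proof -
  have "real CARD('n) * lmin x t = (\<Sum>i=1..CARD('n). lmin x t)" by simp
  also have "\<dots> \<le> (\<Sum>i=1..CARD('n). eigval (gram x t) i)"
    by (intro sum_mono eigval_antimono[OF gram_symmetric]) auto
  also have "\<dots> = trace (gram x t)" by (simp add: trace_eq_sum_eigval[OF gram_symmetric])
  finally have "real CARD('n) * lmin x t \<le> real CARD('n) + t" using trace_gram_le[OF assms] by simp
  then show ?thesis using dim2 by (simp add: field_simps)
qed

lemma ln_det_gram_le:
  assumes "t \<le> T"
  shows "ln (det (gram x t)) \<le> real CARD('n) * ln (real CARD('n) + t)"
proof -
  let ?D = "real CARD('n)"
  have "det (gram x t) \<le> (\<Prod>i=1..CARD('n). ?D + t)"
    unfolding det_eq_prod_eigval[OF gram_symmetric]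
  proof (intro prod_mono conjI)
    fix i assume i: "i \<in> {1..CARD('n)}"
    show "0 \<le> eigval (gram x t) i" using posdef_eigval_pos[OF gram_posdef] i by (auto intro: less_imp_le)
    show "eigval (gram x t) i \<le> ?D + t"
      using eigval_antimono[OF gram_symmetric, of 1 i x t] i eigval_top_le[OF assms] by auto
  qed
  then have "det (gram x t) \<le> (?D + t) ^ CARD('n)" by simp
  then have "ln (det (gram x t)) \<le> ln ((?D + t) ^ CARD('n))"
    using posdef_det_pos[OF gram_posdef, of x t] by simp
  then show ?thesis using dim2 by (simp add: ln_realpow)
qed

end

text \<open>The bound \<open>1 \<le> \<beta>\<close> does not come from \<open>linucb\<close>; for
  an optimistic parameter it is supplied by optimism in the first round
  (\<open>beta_ge_2\<close>).\<close>

locale ucb_path =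
  fixes \<beta> :: real and T :: nat and x h :: "nat \<Rightarrow> real^'n"
  assumes dim_ge_2: "2 \<le> CARD('n)"
    and beta_ge_1: "1 \<le> \<beta>"
    and unit: "\<And>t. t < T \<Longrightarrow> norm (h t) = 1"
    and argmax: "\<And>t. t \<in> {1..T} \<Longrightarrow> is_arg_max (ucb \<beta> x h t) (\<lambda>b. b \<in> cball 0 1) (x t)"
begin

lemma ucb_le:
  assumes "t \<in> {1..T}" "norm b \<le> 1"
  shows "b \<bullet> h (t - 1) + \<beta> * inorm (gram x (t - 1)) b \<le> x t \<bullet> h (t - 1) + \<beta> * width x t"
  using argmax[OF assms(1)] assms(2)
  by (force simp: is_arg_max_def ucb_def inorm_def not_less)

lemma norm_action_le: "t \<in> {1..T} \<Longrightarrow> norm (x t) \<le> 1"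
  using argmax by (simp add: is_arg_max_def)

sublocale bounded_path x T
  using dim_ge_2 norm_action_le by unfold_locales

text \<open>Both parts of the score are positively homogeneous, so the optimality of the action can
  be tested at vectors of any length.\<close>

lemma ucb_le_norm:
  assumes t: "t \<in> {1..T}"
  shows "y \<bullet> h (t - 1) + \<beta> * inorm (gram x (t - 1)) y
    \<le> norm y * (x t \<bullet> h (t - 1) + \<beta> * width x t)"
proof (cases "y = 0")
  case False
  then have p: "norm y > 0" by simp
  have "(y /\<^sub>R norm y) \<bullet> h (t - 1) + \<beta> * inorm (gram x (t - 1)) (y /\<^sub>R norm y)
      \<le> x t \<bullet> h (t - 1) + \<beta> * width x t"
    using p by (intro ucb_le[OF t]) simp
  moreover have "(y /\<^sub>R norm y) \<bullet> h (t - 1) + \<beta> * inorm (gram x (t - 1)) (y /\<^sub>R norm y)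
     = (y \<bullet> h (t - 1) + \<beta> * inorm (gram x (t - 1)) y) / norm y"
    by (simp add: inorm_scaleR divide_simps)
  ultimately show ?thesis using p by (simp add: field_simps)
qed (simp add: inorm_def)

text \<open>Homogeneity at the action itself bounds the optimal score by \<open>norm (x t)\<close>
  times that score, which is positive because the score of \<open>h (t - 1)\<close> is at least 1.
  Unit norms make the trace of the Gram matrix grow by exactly one per round.\<close>

lemma norm_action:
  assumes t: "t \<in> {1..T}"
  shows "norm (x t) = 1"
proof -
  let ?V = "x t \<bullet> h (t - 1) + \<beta> * width x t"
  have h: "norm (h (t - 1)) = 1" using t by (intro unit) auto
  have "1 \<le> h (t - 1) \<bullet> h (t - 1) + \<beta> * inorm (gram x (t - 1)) (h (t - 1))"
    using h beta_ge_1 inorm_nonneg[OF gram_posdef, of x "t - 1" "h (t - 1)"] by (simp add: norm_eq_1)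
  also have "\<dots> \<le> ?V" using h by (intro ucb_le[OF t]) simp
  finally have V: "0 < ?V" by simp
  have "?V \<le> norm (x t) * ?V" using ucb_le_norm[OF t, of "x t"] .
  then have "1 \<le> norm (x t)" using V by simp
  then show ?thesis using norm_action_le[OF t] by simp
qed

text \<open>Compare the chosen action with the direction of \<open>h + s v\<close>, where \<open>v\<close> is a least eigenvector
  oriented towards \<open>h\<close> and \<open>s = min 1 (\<beta> / sqrt \<lambda>)\<close>.\<close>

lemma width_ge:
  assumes t: "t \<in> {1..T}"
  shows "min (1 / sqrt (lmin x (t - 1))) (\<beta> / lmin x (t - 1)) / 5 \<le> width x t"
proof -
  define m where "m = lmin x (t - 1)"
  define hh where "hh = h (t - 1)"
  define G where "G = gram x (t - 1)"
  define w where "w = width x t"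
  have m: "1 \<le> m" unfolding m_def by (rule lmin_ge_1)
  have hh: "norm hh = 1" unfolding hh_def using t by (intro unit) auto
  obtain v0 where v0: "norm v0 = 1" "G *v v0 = m *\<^sub>R v0"
    unfolding m_def G_def using lmin_eigvec by blast
  define v where "v = (if v0 \<bullet> hh \<ge> 0 then v0 else - v0)"
  have "G *v (- v0) = m *\<^sub>R (- v0)"
    using v0(2) matrix_vector_mult_scaleR[of G "-1" v0] by simp
  then have v: "norm v = 1" "G *v v = m *\<^sub>R v" "v \<bullet> hh \<ge> 0" using v0 by (auto simp: v_def)
  define c where "c = v \<bullet> hh"
  have c: "0 \<le> c" "c \<le> 1"
    using v(3) norm_cauchy_schwarz[of v hh] v(1) hh by (auto simp: c_def)
  define s where "s = min 1 (\<beta> / sqrt m)"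
  have s: "0 < s" "s \<le> 1" "s \<le> \<beta> / sqrt m" using m beta_ge_1 by (auto simp: s_def)
  define y where "y = hh + s *\<^sub>R v"
  have yh: "y \<bullet> hh = 1 + s * c"
    using hh by (simp add: y_def c_def inner_add_left norm_eq_1)
  have sq: "(norm y)\<^sup>2 = 1 + 2 * s * c + s\<^sup>2"
    unfolding power2_norm_eq_inner y_def using hh v(1)
    by (simp add: inner_add_left inner_add_right norm_eq_1 c_def inner_commute power2_eq_square)
  \<comment> \<open>Normalising \<open>y\<close> costs only \<open>s^2 / 2\<close> beyond the reward
    gain \<open>s * c\<close>, whereas the bonus grows to first order in \<open>s\<close>.\<close>
  have "(norm y)\<^sup>2 \<le> (1 + s * c + s\<^sup>2 / 2)\<^sup>2"
  proof -
    have "(1 + s * c + s\<^sup>2 / 2)\<^sup>2 = 1 + 2 * s * c + s\<^sup>2 + (s * c + s\<^sup>2 / 2)\<^sup>2"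
      by (simp add: power2_eq_square field_simps)
    then show ?thesis unfolding sq by simp
  qed
  then have ny: "norm y \<le> 1 + s * c + s\<^sup>2 / 2"
    by (rule power2_le_imp_le) (use s c in simp)
  have w0: "0 \<le> w" unfolding w_def by (rule inorm_nonneg[OF gram_posdef])
  have "s / sqrt m \<le> \<bar>y \<bullet> v\<bar> / sqrt m"
  proof -
    have "y \<bullet> v = c + s" using v(1) by (simp add: y_def inner_add_left c_def norm_eq_1 inner_commute[of hh])
    then show ?thesis using c s m by (intro divide_right_mono) auto
  qed
  also have "\<dots> \<le> inorm G y"
    unfolding G_def using v m by (intro inorm_ge_eigvec[OF gram_posdef]) (auto simp: G_def)
  finally have iy: "s / sqrt m \<le> inorm G y" .
  have "x t \<bullet> hh \<le> 1" using norm_cauchy_schwarz[of "x t" hh] norm_action[OF t] hh by simp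
  then have "norm y * (x t \<bullet> hh + \<beta> * w) \<le> (1 + s * c + s\<^sup>2 / 2) * (1 + \<beta> * w)"
    using ny w0 beta_ge_1 s c by (intro order_trans[OF mult_left_mono mult_right_mono]) auto
  with ucb_le_norm[OF t, of y] have "1 + s * c + \<beta> * inorm G y \<le> (1 + s * c + s\<^sup>2 / 2) * (1 + \<beta> * w)"
    unfolding w_def[symmetric] unfolding hh_def[symmetric] G_def[symmetric] yh by linarith
  moreover have "\<beta> * (s / sqrt m) \<le> \<beta> * inorm G y" using iy beta_ge_1 by (intro mult_left_mono) auto
  moreover have "(1 + s * c + s\<^sup>2 / 2) * (\<beta> * w) \<le> (5 / 2) * (\<beta> * w)"
  proof -
    have "s * c \<le> 1" "s\<^sup>2 \<le> 1" using s c by (auto intro: mult_le_one power_le_one)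
    then show ?thesis using w0 beta_ge_1 by (intro mult_right_mono) auto
  qed
  moreover have "(1 + s * c + s\<^sup>2 / 2) * (1 + \<beta> * w)
      = 1 + s * c + s\<^sup>2 / 2 + (1 + s * c + s\<^sup>2 / 2) * (\<beta> * w)"
    by (simp add: algebra_simps)
  ultimately have "\<beta> * (s / sqrt m) \<le> s\<^sup>2 / 2 + (5 / 2) * (\<beta> * w)" by linarith
  \<comment> \<open>By the choice of \<open>s\<close>, half of \<open>\<beta> * (s / sqrt m)\<close>
    absorbs \<open>s^2 / 2\<close>; the final 5 is twice the factor 5/2.\<close>
  moreover have "s\<^sup>2 \<le> \<beta> * (s / sqrt m)"
    using mult_left_mono[OF s(3), of s] s by (simp add: power2_eq_square mult.commute)
  ultimately have "\<beta> * (s / sqrt m) \<le> \<beta> * (5 * w)" by simp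
  then have "s / sqrt m \<le> 5 * w" by (rule mult_left_le_imp_le) (use beta_ge_1 in simp)
  moreover have "s / sqrt m = min (1 / sqrt m) (\<beta> / m)"
  proof -
    have "\<beta> / m = (\<beta> / sqrt m) / sqrt m" using m by (simp add: real_sqrt_mult_self)
    then show ?thesis unfolding s_def using m by (simp add: min_divide_distrib_right)
  qed
  ultimately show ?thesis unfolding w_def m_def by simp
qed

text \<open>\<open>K\<close> sets how far the linear phase is followed: 1 for the exploration phase,
  4 for the start of the induction in \<open>excess_and_lmin_bounds\<close>, and a large value for
  the lower bound on \<open>\<beta>\<close>, where the least eigenvalue has to dominate
  \<open>\<beta>^2\<close>.\<close>

lemma lmin_initial_growth:
  assumes K: "1 \<le> K" and tT: "t \<le> T"
  shows "K * \<beta>\<^sup>2 \<le> lmin x t \<or> t / (1250 * K\<^sup>2 * (real CARD('n))\<^sup>2) \<le> lmin x t"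
proof (cases "K * \<beta>\<^sup>2 \<le> lmin x t")
  case False
  define D where "D = real CARD('n)"
  \<comment> \<open>The width is at least \<open>1 / (5 * sqrt (K * m))\<close>; squaring twice
    gives \<open>625 * K^2\<close>, the division by \<open>1 + w^2 \<le> 2\<close> doubles it, and
    \<open>D^2\<close> comes from \<open>\<Phi> s \<le> D / m\<close>.\<close>
  define \<kappa> where "\<kappa> = 1 / (1250 * K\<^sup>2 * D\<^sup>2)"
  define \<Phi> where "\<Phi> s = trace (matrix_inv (gram x s))" for s
  have D: "2 \<le> D" using dim2 by (simp add: D_def)
  have \<kappa>: "0 < \<kappa>" using K D by (simp add: \<kappa>_def)
  have \<Phi>pos: "0 < \<Phi> s" for s
    using trace_inv_bounds(1)[OF gram_posdef, of x s] lmin_pos[of x s]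
    unfolding \<Phi>_def by (meson less_le_trans zero_less_divide_1_iff)
  have "s \<le> t \<Longrightarrow> \<kappa> * s \<le> 1 / \<Phi> s" for s
  proof (induction s)
    case 0
    then show ?case using \<Phi>pos[of 0] by simp
  next
    case (Suc s)
    define m where "m = lmin x s"
    define w where "w = width x (Suc s)"
    define u where "u = matrix_inv (gram x s) *v x (Suc s)"
    have sT: "Suc s \<in> {1..T}" using Suc.prems tT by auto
    have m: "1 \<le> m" "m < K * \<beta>\<^sup>2"
      using lmin_ge_1[of x s] lmin_mono[of s t x] Suc.prems False by (auto simp: m_def)
    have w: "0 \<le> w" "w \<le> 1" unfolding w_def using inorm_nonneg[OF gram_posdef] width_le_1[OF sT] by auto
    have "1 / (sqrt K * sqrt m) \<le> min (1 / sqrt m) (\<beta> / m)"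
    proof -
      have "sqrt m \<le> sqrt (K * \<beta>\<^sup>2)" using m by simp
      then have "sqrt m \<le> sqrt K * \<beta>" using beta_ge_1 by (simp add: real_sqrt_mult)
      then have "1 / (sqrt K * sqrt m) \<le> \<beta> / m"
        using m K by (simp add: field_simps) (metis m(1) mult.commute mult_right_mono order_trans real_sqrt_ge_zero real_sqrt_mult_self abs_of_nonneg zero_le_one mult.assoc)
      moreover have "1 / (sqrt K * sqrt m) \<le> 1 / (1 * sqrt m)"
        using m K by (intro divide_left_mono mult_right_mono) auto
      ultimately show ?thesis by simp
    qed
    then have "1 / (sqrt K * sqrt m) / 5 \<le> min (1 / sqrt m) (\<beta> / m) / 5"
      by (rule divide_right_mono) simp
    also have "\<dots> \<le> w"
      using width_ge[OF sT] by (simp add: w_def m_def)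
    finally have "1 / (sqrt K * sqrt m) / 5 \<le> w" .
    then have "(1 / (sqrt K * sqrt m) / 5)\<^sup>2 \<le> w\<^sup>2"
      using K m by (intro power_mono) auto
    then have w2: "1 / (25 * K * m) \<le> w\<^sup>2" using K m by (simp add: power_divide power_mult_distrib)
    have wu: "w\<^sup>2 = x (Suc s) \<bullet> u" unfolding w_def u_def by (simp add: inorm_square[OF gram_posdef])
    also have "\<dots> \<le> norm (x (Suc s)) * norm u" by (rule norm_cauchy_schwarz)
    also have "\<dots> \<le> norm u" using norm_action[OF sT] by simp
    finally have "1 / (25 * K * m) \<le> norm u" using w2 by simp
    then have "(1 / (25 * K * m))\<^sup>2 \<le> (norm u)\<^sup>2" using K m by (intro power_mono) auto
    moreover have "\<Phi> s / D \<le> 1 / m"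
      using trace_inv_bounds(2)[OF gram_posdef, of x s] D by (simp add: \<Phi>_def D_def m_def field_simps)
    then have "(\<Phi> s / D)\<^sup>2 \<le> (1 / m)\<^sup>2" using \<Phi>pos[of s] D by (intro power_mono) auto
    then have "(\<Phi> s)\<^sup>2 / D\<^sup>2 / (625 * K\<^sup>2) \<le> (1 / m)\<^sup>2 / (625 * K\<^sup>2)"
      unfolding power_divide[of "\<Phi> s"] by (rule divide_right_mono) simp
    then have "2 * (\<kappa> * (\<Phi> s)\<^sup>2) \<le> (1 / (25 * K * m))\<^sup>2"
      by (simp add: \<kappa>_def power_divide power_mult_distrib mult_ac)
    ultimately have u: "2 * (\<kappa> * (\<Phi> s)\<^sup>2) \<le> (norm u)\<^sup>2" by simp
    have "\<Phi> (Suc s) = \<Phi> s - (norm u)\<^sup>2 / (1 + w\<^sup>2)"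
      unfolding \<Phi>_def u_def w_def
      using trace_inv_rank_one_update[OF gram_posdef gram_posdef gram_Suc, of x s] by simp
    moreover have "(norm u)\<^sup>2 / 2 \<le> (norm u)\<^sup>2 / (1 + w\<^sup>2)"
      using w by (intro divide_left_mono) (auto intro: power_le_one add_pos_nonneg)
    ultimately have \<Phi>': "\<Phi> (Suc s) \<le> \<Phi> s - \<kappa> * (\<Phi> s)\<^sup>2" using u by linarith
    \<comment> \<open>A quadratic rate of decay of the potential means linear growth of its
      reciprocal; in discrete time the cubic remainder has the right sign, so
      \<open>1 / \<Phi> s\<close> gains at least \<open>\<kappa>\<close> per round.\<close>
    then have "\<Phi> (Suc s) * (1 + \<kappa> * \<Phi> s) \<le> (\<Phi> s - \<kappa> * (\<Phi> s)\<^sup>2) * (1 + \<kappa> * \<Phi> s)"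
      using \<kappa> \<Phi>pos[of s] by (intro mult_right_mono) auto
    also have "\<dots> = \<Phi> s - \<kappa>\<^sup>2 * (\<Phi> s) ^ 3" by (simp add: power2_eq_square power3_eq_cube algebra_simps)
    also have "\<dots> \<le> \<Phi> s" using \<kappa> \<Phi>pos[of s] by simp
    finally have "1 / \<Phi> s + \<kappa> \<le> 1 / \<Phi> (Suc s)"
      using \<Phi>pos[of s] \<Phi>pos[of "Suc s"] by (simp add: field_simps)
    then show ?case using Suc by (simp add: algebra_simps)
  qed
  from this[OF order_refl] have "\<kappa> * t \<le> 1 / \<Phi> t" .
  also have "\<dots> \<le> lmin x t"
    using trace_inv_bounds(1)[OF gram_posdef, of x t] \<Phi>pos[of t] lmin_pos[of x t]
    by (simp add: \<Phi>_def field_simps)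
  finally show ?thesis by (simp add: \<kappa>_def D_def)
qed simp

end

section \<open>The induction over dyadic windows and its constants\<close>

lemma bootstrap_constants:
  fixes d R \<kappa> :: real
  assumes d: "2 \<le> d" and R: "0 < R" and \<kappa>: "0 < \<kappa>"
  shows "\<exists>A l. 1 \<le> A \<and> 2 * (d + 4) \<le> A \<and> 40 * R \<le> A \<and> 0 < l \<and> l \<le> 1 \<and> l \<le> \<kappa> \<and>
    (\<forall>y\<ge>A. 8 * R\<^sup>2 * (ln (2 * d) + (d - 1) * ln (2 * y\<^sup>2)) \<le> y\<^sup>2 / 100) \<and>
    2 * (ln (2 * d) + (d - 1) * ln (2 * A / l\<^sup>2)) \<le> 1 / (50 * l)"
proof -
  define a b where "a = ln (2 * d)" and "b = d - 1"
  have a: "a > 0" and b: "b > 0" using d by (auto simp: a_def b_def)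
  have "eventually (\<lambda>y. 8 * R\<^sup>2 * (a + b * ln (2 * y\<^sup>2)) \<le> y\<^sup>2 / 100) at_top"
    using a b R by real_asymp
  then obtain A0 where A0: "\<And>y. y \<ge> A0 \<Longrightarrow> 8 * R\<^sup>2 * (a + b * ln (2 * y\<^sup>2)) \<le> y\<^sup>2 / 100"
    by (auto simp: eventually_at_top_linorder)
  \<comment> \<open>In \<open>excess_and_lmin_bounds\<close> the base case asks for
    \<open>2 * (d + 4)\<close> and the contraction step for \<open>40 * R\<close>.\<close>
  define A where "A = max (max 1 A0) (max (2 * (d + 4)) (40 * R))"
  have A: "A > 0" by (simp add: A_def)
  \<comment> \<open>With \<open>l = 1 / z\<close> the condition compares a logarithm of
    \<open>z\<close> with a multiple of \<open>z\<close>; it is imposed after \<open>A\<close>,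
    which does not depend on \<open>l\<close>.\<close>
  have "eventually (\<lambda>z. 2 * (a + b * ln (2 * A * z\<^sup>2)) \<le> z / 50 \<and> 1 \<le> z \<and> 1 / \<kappa> \<le> z) at_top"
    using a b A by (intro eventually_conj eventually_ge_at_top; real_asymp)
  then obtain z where z: "2 * (a + b * ln (2 * A * z\<^sup>2)) \<le> z / 50" "1 \<le> z" "1 / \<kappa> \<le> z"
    by (auto simp: eventually_at_top_linorder)
  have "1 / z \<le> \<kappa>" using z \<kappa> by (simp add: field_simps)
  then show ?thesis
    using A0 z by (intro exI[of _ A] exI[of _ "1 / z"])
      (auto simp: A_def a_def b_def power_divide field_simps)
qed

locale low_regret_path = ucb_path \<beta> T x h for \<beta> T and x h :: "nat \<Rightarrow> real^'n" +
  fixes \<theta> :: "real^'n" and R :: real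
  assumes norm_theta: "norm \<theta> = 1"
    and R_pos: "0 < R"
    and regret: "\<And>t. t \<in> {1..T} \<Longrightarrow>
      1 - x t \<bullet> \<theta> \<le> R * (\<beta> * width x t + \<beta>\<^sup>2 / lmin x (t - 1))"
begin

text \<open>A majorant of \<open>tail_sum\<close> that is additive in the regrets: bounding the
  leading eigenvalue below by the quadratic form at \<open>\<theta>\<close> leaves
  \<open>CARD('n) - 1\<close> plus the sum of \<open>1 - c^2 \<le> 2 * (1 - c)\<close> over the
  cosines \<open>c = x s \<bullet> \<theta>\<close>.\<close>

definition excess :: "nat \<Rightarrow> real" where
  "excess t = real CARD('n) - 1 + 2 * (\<Sum>s=1..t. 1 - x s \<bullet> \<theta>)"

lemma inner_action_le: "t \<in> {1..T} \<Longrightarrow> x t \<bullet> \<theta> \<le> 1"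
  using norm_cauchy_schwarz[of "x t" \<theta>] norm_action[of t] norm_theta by simp

lemma trace_gram: "t \<le> T \<Longrightarrow> trace (gram x t) = real CARD('n) + t"
  using norm_action by (simp add: gram_trace)

lemma trace_minus_quadratic_form_le:
  assumes "t \<le> T"
  shows "trace (gram x t) - \<theta> \<bullet> (gram x t *v \<theta>) \<le> excess t"
proof -
  have "(\<Sum>s=1..t. 1 - (x s \<bullet> \<theta>)\<^sup>2) \<le> (\<Sum>s=1..t. 2 * (1 - x s \<bullet> \<theta>))"
  proof (rule sum_mono)
    fix s
    have "0 \<le> (1 - x s \<bullet> \<theta>)\<^sup>2" by simp
    then show "1 - (x s \<bullet> \<theta>)\<^sup>2 \<le> 2 * (1 - x s \<bullet> \<theta>)" by (simp add: power2_eq_square algebra_simps)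
  qed
  then show ?thesis
    using norm_theta unfolding gram_quadratic_form trace_gram[OF assms] excess_def
    by (simp add: sum_subtractf sum_distrib_left[symmetric] norm_eq_1)
qed

lemma tail_sum_le_excess:
  assumes "t \<le> T"
  shows "tail_sum (gram x t) \<le> excess t"
  using trace_minus_quadratic_form_le[OF assms] eigval_max[OF gram_symmetric, of \<theta> x t] norm_theta
  by (simp add: tail_sum_eq[OF gram_symmetric] norm_eq_1)

lemma lmin_le_excess:
  assumes "t \<le> T"
  shows "lmin x t \<le> excess t"
proof -
  have "lmin x t * 1 \<le> lmin x t * (real CARD('n) - 1)"
    using lmin_pos[of x t] dim2 by (intro mult_left_mono) auto
  then show ?thesis
    using eigval_min_le_avg[OF gram_posdef, of x t] tail_sum_le_excess[OF assms] by simp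
qed

text \<open>The leading eigenvalue is at least \<open>(D + s) / D\<close> at the start of the window
  and at most \<open>D + t \<le> 2 * (D + s)\<close> at its end, so its growth contributes only a
  constant. The other \<open>D - 1\<close> eigenvalues leave a logarithm, of a ratio that the
  induction keeps bounded.\<close>

lemma window_sum_le:
  assumes st: "s \<le> t" "t \<le> 2 * s + 1" and tT: "t \<le> T"
  defines "D \<equiv> real CARD('n)"
  shows "(\<Sum>i=Suc s..t. (width x i)\<^sup>2) \<le> 2 * (ln (2 * D) + (D - 1) * ln (excess t / lmin x s))"
proof -
  let ?Gt = "gram x t" and ?Gs = "gram x s"
  have D: "2 \<le> D" using dim2 by (simp add: D_def)
  have D1: "real CARD('n) = D" by (simp add: D_def)
  have ts: "0 < tail_sum ?Gt"
    using lmin_pos[of x t] eigval_le_tail_sum[OF gram_posdef, of "CARD('n)" x t] dim2 by simp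
  have ex: "0 < excess t" using ts tail_sum_le_excess[OF tT] by simp
  have top: "0 < eigval ?Gt 1" "0 < eigval ?Gs 1" by (auto intro!: posdef_eigval_pos[OF gram_posdef] simp: Suc_leI)
  have "det ?Gt \<le> (D + t) * excess t ^ (CARD('n) - 1)"
    using det_le_head_tail[OF gram_posdef, of x t] eigval_top_le[OF tT] tail_sum_le_excess[OF tT] ts top D
    by (elim order_trans) (auto intro!: mult_mono power_mono simp: D_def)
  then have "ln (det ?Gt) \<le> ln ((D + t) * excess t ^ (CARD('n) - 1))"
    using posdef_det_pos[OF gram_posdef, of x t] by simp
  also have "\<dots> = ln (D + t) + (D - 1) * ln (excess t)"
    using ex D by (simp add: ln_mult ln_realpow D1)
  finally have up: "ln (det ?Gt) \<le> ln (D + t) + (D - 1) * ln (excess t)" .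
  have "D + s \<le> D * eigval ?Gs 1"
  proof -
    have "D + s = (\<Sum>i=1..CARD('n). eigval ?Gs i)"
      using trace_gram[of s] st tT by (simp add: D_def trace_eq_sum_eigval[OF gram_symmetric])
    also have "\<dots> \<le> (\<Sum>i=1..CARD('n). eigval ?Gs 1)"
      by (intro sum_mono eigval_antimono[OF gram_symmetric]) auto
    finally show ?thesis by (simp add: D_def)
  qed
  then have "(D + s) / D \<le> eigval ?Gs 1" using D by (simp add: field_simps)
  then have "(D + s) / D * lmin x s ^ (CARD('n) - 1) \<le> eigval ?Gs 1 * lmin x s ^ (CARD('n) - 1)"
    using lmin_pos[of x s] by (intro mult_right_mono) auto
  also have "\<dots> \<le> det ?Gs" by (rule det_ge_head_tail[OF gram_posdef])
  finally have "(D + s) / D * lmin x s ^ (CARD('n) - 1) \<le> det ?Gs" .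
  then have "ln ((D + s) / D * lmin x s ^ (CARD('n) - 1)) \<le> ln (det ?Gs)"
    using D lmin_pos[of x s] posdef_det_pos[OF gram_posdef, of x s] by simp
  then have lo: "ln (D + s) - ln D + (D - 1) * ln (lmin x s) \<le> ln (det ?Gs)"
    using D lmin_pos[of x s] by (simp add: ln_mult ln_div ln_realpow D1)
  have "D + t \<le> 2 * (D + s)" using st D by simp
  then have "ln (D + t) \<le> ln (2 * (D + s))" using D by simp
  moreover have "ln (2 * (D + s)) = ln 2 + ln (D + s)" using D by (subst ln_mult) auto
  ultimately have "ln (D + t) \<le> ln 2 + ln (D + s)" by linarith
  moreover have "ln (excess t / lmin x s) = ln (excess t) - ln (lmin x s)"
    using ex lmin_pos[of x s] by (simp add: ln_div)
  moreover have "ln (2 * D) = ln 2 + ln D" using D by (simp add: ln_mult)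
  ultimately have "ln (det ?Gt) - ln (det ?Gs) \<le> ln (2 * D) + (D - 1) * ln (excess t / lmin x s)"
    using up lo by (simp only: right_diff_distrib)
  then show ?thesis using sum_width_square_le[OF st(1) tT] by simp
qed

text \<open>The least eigenvalue may be frozen at the start of the window because it only grows, and
  Cauchy-Schwarz passes from the sum of widths to the sum of their squares.\<close>

lemma excess_window:
  assumes st: "s \<le> t" "t \<le> T" and S: "(\<Sum>i=Suc s..t. (width x i)\<^sup>2) \<le> S"
  shows "excess t \<le> excess s + 2 * R * (\<beta> * sqrt (t * S) + \<beta>\<^sup>2 * t / lmin x s)"
proof -
  have split: "(\<Sum>i=1..t. 1 - x i \<bullet> \<theta>) = (\<Sum>i=1..s. 1 - x i \<bullet> \<theta>) + (\<Sum>i=Suc s..t. 1 - x i \<bullet> \<theta>)"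
    using sum.ub_add_nat[of 1 s "\<lambda>i. 1 - x i \<bullet> \<theta>" "t - s"] st(1) by simp
  have "(\<Sum>i=Suc s..t. 1 - x i \<bullet> \<theta>) \<le> (\<Sum>i=Suc s..t. R * (\<beta> * width x i + \<beta>\<^sup>2 / lmin x s))"
  proof (rule sum_mono)
    fix i assume i: "i \<in> {Suc s..t}"
    have "\<beta>\<^sup>2 / lmin x (i - 1) \<le> \<beta>\<^sup>2 / lmin x s"
      using i lmin_mono[of s "i - 1" x] lmin_pos[of x s] lmin_pos[of x "i - 1"]
      by (intro divide_left_mono mult_pos_pos) auto
    then have "R * (\<beta> * width x i + \<beta>\<^sup>2 / lmin x (i - 1)) \<le> R * (\<beta> * width x i + \<beta>\<^sup>2 / lmin x s)"
      using R_pos by simp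
    then show "1 - x i \<bullet> \<theta> \<le> R * (\<beta> * width x i + \<beta>\<^sup>2 / lmin x s)"
      using regret[of i] i st by (intro order_trans[OF regret]) auto
  qed
  also have "\<dots> = R * (\<beta> * (\<Sum>i=Suc s..t. width x i) + (t - s) * (\<beta>\<^sup>2 / lmin x s))"
    using st(1) by (simp add: sum.distrib sum_distrib_left algebra_simps of_nat_diff)
  also have "\<dots> \<le> R * (\<beta> * sqrt (t * S) + t * (\<beta>\<^sup>2 / lmin x s))"
  proof -
    have "(\<Sum>i=Suc s..t. width x i)\<^sup>2 \<le> (\<Sum>i=Suc s..t. (width x i)\<^sup>2) * (\<Sum>i=Suc s..t. 1\<^sup>2)"
      using Cauchy_Schwarz_ineq_sum[of "width x" "\<lambda>_. 1" "{Suc s..t}"] by simp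
    also have "\<dots> \<le> S * t"
    proof (rule mult_mono[OF S])
      show "0 \<le> S" by (rule order_trans[OF _ S]) (simp add: sum_nonneg)
    qed auto
    finally have "(\<Sum>i=Suc s..t. width x i) \<le> sqrt (t * S)"
      by (intro real_le_rsqrt) (simp add: mult.commute)
    moreover have "(t - s) * (\<beta>\<^sup>2 / lmin x s) \<le> t * (\<beta>\<^sup>2 / lmin x s)"
      using lmin_pos[of x s] by (intro mult_right_mono) auto
    ultimately show ?thesis using R_pos beta_ge_1 by (intro mult_left_mono add_mono) auto
  qed
  finally have "(\<Sum>i=Suc s..t. 1 - x i \<bullet> \<theta>) \<le> R * (\<beta> * sqrt (t * S) + \<beta>\<^sup>2 * t / lmin x s)"
    by (simp add: mult.commute)
  then have "2 * (\<Sum>i=Suc s..t. 1 - x i \<bullet> \<theta>) \<le> 2 * R * (\<beta> * sqrt (t * S) + \<beta>\<^sup>2 * t / lmin x s)"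
    by (simp only: mult.assoc)
  then show ?thesis unfolding excess_def split distrib_left[of 2] by linarith
qed

text \<open>A small least eigenvalue at time \<open>t\<close> would make every width in the window
  large by \<open>width_ge\<close>; the budget \<open>S\<close> for their squares excludes
  that.\<close>

lemma lmin_window:
  assumes st: "s < t" "t \<le> T" and S: "(\<Sum>i=Suc s..t. (width x i)\<^sup>2) \<le> S"
  shows "(real t - real s) * min (1 / lmin x t) (\<beta>\<^sup>2 / (lmin x t)\<^sup>2) \<le> 25 * S"
proof -
  have "(real t - real s) * (min (1 / lmin x t) (\<beta>\<^sup>2 / (lmin x t)\<^sup>2) / 25)
      = (\<Sum>i=Suc s..t. min (1 / lmin x t) (\<beta>\<^sup>2 / (lmin x t)\<^sup>2) / 25)"
    using st by (simp add: of_nat_diff)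
  also have "\<dots> \<le> (\<Sum>i=Suc s..t. (width x i)\<^sup>2)"
  proof (rule sum_mono)
    fix i assume i: "i \<in> {Suc s..t}"
    let ?m = "lmin x (i - 1)"
    have m: "?m \<le> lmin x t" "0 < ?m" using i lmin_mono[of "i - 1" t x] lmin_pos by auto
    have "0 \<le> min (1 / sqrt ?m) (\<beta> / ?m) / 5" using m beta_ge_1 by simp
    then have "(min (1 / sqrt ?m) (\<beta> / ?m) / 5)\<^sup>2 \<le> (width x i)\<^sup>2"
      using width_ge[of i] i st by (intro power_mono) auto
    moreover have "(min (1 / sqrt ?m) (\<beta> / ?m) / 5)\<^sup>2 = min (1 / ?m) (\<beta>\<^sup>2 / ?m\<^sup>2) / 25"
    proof -
      have "(min a b)\<^sup>2 = min (a\<^sup>2) (b\<^sup>2)" if "0 \<le> a" "0 \<le> b" for a b :: real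
        using that power_mono[of a b 2] power_mono[of b a 2] by (cases "a \<le> b") auto
      then show ?thesis using m beta_ge_1 by (simp add: power_divide)
    qed
    moreover have "min (1 / lmin x t) (\<beta>\<^sup>2 / (lmin x t)\<^sup>2) \<le> min (1 / ?m) (\<beta>\<^sup>2 / ?m\<^sup>2)"
      using m by (intro min.mono divide_left_mono power_mono) auto
    ultimately show "min (1 / lmin x t) (\<beta>\<^sup>2 / (lmin x t)\<^sup>2) / 25 \<le> (width x i)\<^sup>2" by linarith
  qed
  also have "\<dots> \<le> S" by (rule S)
  finally show ?thesis by simp
qed

text \<open>Strong induction with the window from \<open>t div 2\<close> to \<open>t\<close>: the logarithm of the determinant
  ratio over that window is controlled by the two bounds themselves, and only logarithmically.\<close>

lemma excess_and_lmin_bounds: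
  fixes A l :: real
  defines "D \<equiv> real CARD('n)"
  assumes A: "1 \<le> A" "2 * (D + 4) \<le> A" "40 * R \<le> A"
    and l: "0 < l" "l \<le> 1" "l \<le> 1 / (1250 * 4\<^sup>2 * D\<^sup>2)"
    and Ay: "\<And>y. A \<le> y \<Longrightarrow> 8 * R\<^sup>2 * (ln (2 * D) + (D - 1) * ln (2 * y\<^sup>2)) \<le> y\<^sup>2 / 100"
    and Al: "2 * (ln (2 * D) + (D - 1) * ln (2 * A / l\<^sup>2)) \<le> 1 / (50 * l)"
    and t: "\<beta>\<^sup>2 \<le> t" "t \<le> T"
  shows "excess t \<le> A / l * \<beta> * sqrt t \<and> l * \<beta> * sqrt t \<le> lmin x t"
  using t
proof (induction t rule: less_induct)
  case (less t)
  have D: "2 \<le> D" using dim2 by (simp add: D_def)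
  have b1: "1 \<le> \<beta>\<^sup>2" using beta_ge_1 by simp
  have t1: "1 \<le> real t" using less.prems b1 by linarith
  have bt: "\<beta> \<le> sqrt t" using less.prems beta_ge_1 by (intro real_le_rsqrt)
  have tt: "real t = sqrt t * sqrt t" by simp
  have Al1: "A \<le> A / l" using A l by (simp add: field_simps)
  show ?case
  \<comment> \<open>The factor 4 leaves room for integer halving: above it, \<open>t div 2\<close>
    is still at least \<open>\<beta>^2\<close>. Below it, trivial regret bounds and the linear phase
    suffice.\<close>
  proof (cases "real t \<le> 4 * \<beta>\<^sup>2")
    case True
    have st: "sqrt t \<le> 2 * \<beta>"
      using True beta_ge_1 by (intro real_le_lsqrt) (auto simp: power_mult_distrib)
    have "excess t \<le> D - 1 + 2 * (\<Sum>s=1..t. 2)"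
      unfolding excess_def D_def
    proof (intro add_left_mono mult_left_mono sum_mono)
      fix s assume "s \<in> {1..t}"
      then have "s \<in> {1..T}" using less.prems by auto
      then have "\<bar>x s \<bullet> \<theta>\<bar> \<le> 1" using Cauchy_Schwarz_ineq2[of "x s" \<theta>] norm_action norm_theta by simp
      then show "1 - x s \<bullet> \<theta> \<le> 2" by linarith
    qed simp
    also have "\<dots> = D - 1 + 4 * t" by simp
    also have "\<dots> \<le> (D + 4) * t"
    proof -
      have "D * 1 \<le> D * real t" using t1 D by (intro mult_left_mono) auto
      then show ?thesis by (simp add: algebra_simps)
    qed
    also have "\<dots> \<le> (D + 4) * (2 * \<beta> * sqrt t)"
      using D st mult_right_mono[OF st, of "sqrt t"] by (intro mult_left_mono) auto
    also have "\<dots> = 2 * (D + 4) * (\<beta> * sqrt t)" by simp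
    also have "\<dots> \<le> A / l * (\<beta> * sqrt t)"
      using A Al1 beta_ge_1 by (intro mult_right_mono) auto
    finally have 1: "excess t \<le> A / l * \<beta> * sqrt t" by simp
    have 2: "l * \<beta> * sqrt t \<le> lmin x t"
    proof -
      have "4 * \<beta>\<^sup>2 \<le> lmin x t \<or> t / (1250 * 4\<^sup>2 * (real CARD('n))\<^sup>2) \<le> lmin x t"
        using less.prems by (intro lmin_initial_growth) auto
      then show ?thesis
      proof
      assume h: "4 * \<beta>\<^sup>2 \<le> lmin x t"
      have "l * \<beta> * sqrt t \<le> 1 * \<beta> * (2 * \<beta>)"
        using l st beta_ge_1 by (intro mult_mono) auto
      then show ?thesis using h b1 by (simp add: power2_eq_square)
    next
      assume h: "t / (1250 * 4\<^sup>2 * (real CARD('n))\<^sup>2) \<le> lmin x t"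
      have "l * \<beta> * sqrt t \<le> l * sqrt t * sqrt t"
        using l bt by (intro mult_right_mono mult_left_mono) auto
      also have "\<dots> = l * t" by simp
      also have "\<dots> \<le> 1 / (1250 * 4\<^sup>2 * D\<^sup>2) * t" using l by (intro mult_right_mono) auto
      finally show ?thesis using h by (simp add: D_def)
    qed
    qed
    from 1 2 show ?thesis by simp
  next
    case False
    define s where "s = t div 2"
    have t4: "4 < real t" using False b1 by simp
    have s: "s < t" "s \<le> t" "t \<le> 2 * s + 1" "t \<le> 4 * s" "real (2 * s) \<le> real t"
      using t4 by (auto simp: s_def)
    have sb: "\<beta>\<^sup>2 \<le> s"
    proof -
      have "real t \<le> 2 * real s + 1" using s(3) by linarith
      then show ?thesis using False b1 by simp
    qed
    have IH: "excess s \<le> A / l * \<beta> * sqrt s" "l * \<beta> * sqrt s \<le> lmin x s"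
      using less.IH[OF s(1) sb] less.prems s by auto
    have p: "0 < \<beta> * sqrt t" using beta_ge_1 t1 by simp
    \<comment> \<open>The window sum \<open>S\<close> involves \<open>excess t\<close> itself, so
      the estimate is implicit; it is solved for the normalised excess \<open>y\<close>.\<close>
    define y where "y = excess t / (\<beta> * sqrt t)"
    have y: "excess t = y * (\<beta> * sqrt t)" 
    proof -
      have "\<beta> * sqrt t \<noteq> 0" using p by linarith
      then show ?thesis by (simp add: y_def)
    qed
    have lms: "l / 2 * (\<beta> * sqrt t) \<le> lmin x s"
    proof -
      have "sqrt t \<le> sqrt (4 * s)" using s(4) by (simp add: of_nat_mono)
      then have "sqrt t \<le> 2 * sqrt s" by (simp add: real_sqrt_mult)
      then have "l / 2 * \<beta> * sqrt t \<le> l / 2 * \<beta> * (2 * sqrt s)"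
        using l beta_ge_1 by (intro mult_left_mono) auto
      then show ?thesis using IH(2) by simp
    qed
    have lms0: "0 < l / 2 * (\<beta> * sqrt t)" using l p by simp
    have exp: "0 < excess t" using lmin_le_excess[OF less.prems(2)] lmin_pos[of x t] by simp
    define S where "S = 2 * (ln (2 * D) + (D - 1) * ln (excess t / lmin x s))"
    have win: "(\<Sum>i=Suc s..t. (width x i)\<^sup>2) \<le> S"
      unfolding S_def D_def using window_sum_le[OF s(2,3) less.prems(2)] .
    have ratio: "excess t / lmin x s \<le> 2 * y / l"
    proof -
      have "excess t / lmin x s \<le> excess t / (l / 2 * (\<beta> * sqrt t))"
        using lms lms0 exp lmin_pos[of x s] by (intro divide_left_mono) auto
      also have "\<dots> = 2 * y / l" using beta_ge_1 t1 l by (simp add: y field_simps)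
      finally show ?thesis .
    qed
    have S_le: "S \<le> 2 * (ln (2 * D) + (D - 1) * ln z)" if "2 * y / l \<le> z" for z
    proof -
      have "0 < excess t / lmin x s" using exp lmin_pos[of x s] by simp
      moreover have "excess t / lmin x s \<le> z" using ratio that by simp
      ultimately have "ln (excess t / lmin x s) \<le> ln z" by simp
      then show ?thesis unfolding S_def using D by (intro mult_left_mono add_left_mono) auto
    qed
    have S0: "0 \<le> S" by (rule order_trans[OF _ win]) (auto intro: sum_nonneg)
    \<comment> \<open>The factor 3/4 is an upper bound for sqrt (1/2), the gain from
      \<open>s \<le> t / 2\<close>; being below 1, it leaves a quarter of \<open>y\<close> to
      dominate the other two terms.\<close>
    have step: "y \<le> A / l * (3/4) + 2 * R * sqrt S + 4 * R / l"
    proof -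
      have "excess t \<le> excess s + 2 * R * (\<beta> * sqrt (t * S) + \<beta>\<^sup>2 * t / lmin x s)"
        by (rule excess_window[OF s(2) less.prems(2) win])
      moreover have "excess s \<le> A / l * (3/4) * (\<beta> * sqrt t)"
      proof -
        have "sqrt s \<le> 3/4 * sqrt t"
        proof (rule real_le_lsqrt)
          have "real s \<le> 9/16 * real t" using s(5) by simp
          then show "real s \<le> (3/4 * sqrt t)\<^sup>2" by (simp add: power_mult_distrib power_divide)
        qed auto
        then have "A / l * \<beta> * sqrt s \<le> A / l * \<beta> * (3/4 * sqrt t)"
          using A l beta_ge_1 by (intro mult_left_mono) auto
        then show ?thesis using IH(1) by (simp add: mult_ac)
      qed
      moreover have "\<beta>\<^sup>2 * t / lmin x s \<le> 2 / l * (\<beta> * sqrt t)"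
      proof -
        have "\<beta>\<^sup>2 * t / lmin x s \<le> \<beta>\<^sup>2 * t / (l / 2 * (\<beta> * sqrt t))"
          using lms lms0 lmin_pos[of x s] by (intro divide_left_mono) auto
        also have "\<dots> = (\<beta> * sqrt t) * (\<beta> * sqrt t) / (l / 2 * (\<beta> * sqrt t))"
          by (rule arg_cong2[where f = "(/)"]) (simp_all add: power2_eq_square)
        also have "\<dots> = 2 / l * (\<beta> * sqrt t)"
        proof -
          have "q * q / (l / 2 * q) = 2 / l * q" if "0 < q" for q :: real
            using that l by (simp add: field_simps)
          from this[OF p] show ?thesis .
        qed
        finally show ?thesis .
      qed
      moreover have "\<beta> * sqrt (t * S) = sqrt S * (\<beta> * sqrt t)" by (simp add: real_sqrt_mult)
      ultimately have "excess t \<le> A / l * (3/4) * (\<beta> * sqrt t)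
          + 2 * R * (sqrt S * (\<beta> * sqrt t) + 2 / l * (\<beta> * sqrt t))"
        using R_pos by (smt (verit, best) mult_left_mono)
      also have "\<dots> = (A / l * (3/4) + 2 * R * sqrt S + 4 * R / l) * (\<beta> * sqrt t)"
        by (simp add: algebra_simps)
      finally show ?thesis unfolding y using p by (simp only: mult_le_cancel_right_pos)
    qed
    \<comment> \<open>If \<open>y\<close> exceeded \<open>A / l\<close>, it would exceed
      \<open>1 / l\<close> too, so the logarithm in \<open>S\<close> would be one of
      \<open>2 * y^2\<close>, free of \<open>l\<close>. Each of the last two terms is then at most
      \<open>y / 10\<close>, and 3/4 + 2/10 < 1.\<close>
    have yle: "y \<le> A / l"
    proof (rule ccontr)
      assume "\<not> y \<le> A / l"
      then have ly: "A / l < y" by simp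
      have "1 / l \<le> A / l" using A l by (intro divide_right_mono) auto
      then have yA: "A \<le> y" "1 / l \<le> y" using Al1 ly by linarith+
      have "2 * y / l \<le> 2 * y\<^sup>2"
        using mult_left_mono[OF yA(2), of "2 * y"] yA A by (simp add: power2_eq_square)
      from S_le[OF this] have "4 * R\<^sup>2 * S \<le> 4 * R\<^sup>2 * (2 * (ln (2 * D) + (D - 1) * ln (2 * y\<^sup>2)))"
        by (intro mult_left_mono) auto
      also have "\<dots> = 8 * R\<^sup>2 * (ln (2 * D) + (D - 1) * ln (2 * y\<^sup>2))"
      proof -
        have "4 * a * (2 * b) = 8 * a * b" for a b :: real by simp
        then show ?thesis .
      qed
      also have "\<dots> \<le> y\<^sup>2 / 100" by (rule Ay[OF yA(1)])
      finally have "(2 * R * sqrt S)\<^sup>2 \<le> (y / 10)\<^sup>2"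
        using S0 by (simp add: power_mult_distrib power_divide)
      then have "2 * R * sqrt S \<le> y / 10" by (rule power2_le_imp_le) (use yA A in simp)
      moreover have "4 * R / l \<le> y / 10"
      proof -
        have "4 * R / l \<le> (A / 10) / l" using A l by (intro divide_right_mono) auto
        moreover have "(A / 10) / l = (A / l) / 10" by simp
        ultimately show ?thesis using ly by linarith
      qed
      moreover have "A / l * (3/4) \<le> y * (3/4)" using ly by (intro mult_right_mono) auto
      ultimately have "y \<le> y * (3/4) + y / 10 + y / 10" using step ly by linarith
      then show False using yA A by simp
    qed
    have 1: "excess t \<le> A / l * \<beta> * sqrt t"
      using mult_right_mono[OF yle less_imp_le[OF p]] unfolding y by (simp only: mult.assoc)
    have "2 * y / l \<le> 2 * A / l\<^sup>2"
      using yle l divide_right_mono[of y "A / l" l] by (simp add: power2_eq_square)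
    \<comment> \<open>Here \<open>l\<close> has to be small against \<open>A\<close>, since this
      bound on \<open>S\<close> is only logarithmic in \<open>1 / l\<close>. The 50 is twice the 25
      of \<open>lmin_window\<close>, which leaves exactly \<open>1 / l\<close> in
      \<open>key\<close>.\<close>
    from S_le[OF this] have S50: "S \<le> 1 / (50 * l)" using Al by simp
    have "real t / 2 \<le> real t - real s" using s(5) by simp
    moreover have "0 \<le> min (1 / lmin x t) (\<beta>\<^sup>2 / (lmin x t)\<^sup>2)" using lmin_pos[of x t] by simp
    ultimately have "real t / 2 * min (1 / lmin x t) (\<beta>\<^sup>2 / (lmin x t)\<^sup>2) \<le> 25 * S"
      by (intro order_trans[OF mult_right_mono lmin_window[OF s(1) less.prems(2) win]])
    also have "\<dots> \<le> 1 / (2 * l)" using S50 by simp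
    finally have key: "real t * min (1 / lmin x t) (\<beta>\<^sup>2 / (lmin x t)\<^sup>2) \<le> 1 / l" by simp
    have 2: "l * \<beta> * sqrt t \<le> lmin x t"
    proof (cases "1 / lmin x t \<le> \<beta>\<^sup>2 / (lmin x t)\<^sup>2")
      case True
      then have "real t * (1 / lmin x t) \<le> 1 / l" using key by (simp add: min_def)
      then have "l * t \<le> lmin x t" using l lmin_pos[of x t] by (simp add: field_simps)
      moreover have "l * \<beta> * sqrt t \<le> l * sqrt t * sqrt t"
        using l bt by (intro mult_right_mono mult_left_mono) auto
      moreover have "l * sqrt t * sqrt t = l * t" by simp
      ultimately show ?thesis by linarith
    next
      case False
      then have "real t * (\<beta>\<^sup>2 / (lmin x t)\<^sup>2) \<le> 1 / l" using key by (simp add: min_def)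
      then have "l * (\<beta>\<^sup>2 * t) \<le> (lmin x t)\<^sup>2" using l lmin_pos[of x t] by (simp add: field_simps)
      moreover have "l * l * (\<beta>\<^sup>2 * t) \<le> l * 1 * (\<beta>\<^sup>2 * t)"
        using l by (intro mult_right_mono mult_left_mono) auto
      ultimately have "(l * \<beta> * sqrt t)\<^sup>2 \<le> (lmin x t)\<^sup>2"
        by (simp add: power_mult_distrib power2_eq_square[of l])
      then show ?thesis by (rule power2_le_imp_le) (use lmin_pos[of x t] in simp)
    qed
    from 1 2 show ?thesis by simp
  qed
qed

end

text \<open>A Davis-Kahan type estimate with \<open>tail_sum\<close> in place of the second
  eigenvalue. With \<open>\<theta>\<close> split into \<open>c *\<^sub>R v\<close> and
  \<open>r\<close> orthogonal to \<open>v\<close>, the quadratic form at \<open>r\<close> is at most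
  \<open>tail_sum\<close> times \<open>r \<bullet> r\<close>, because an action has only
  \<open>(norm (x s))^2 - (x s \<bullet> v)^2\<close> left outside the direction
  \<open>v\<close>.\<close>

lemma leading_eigenvector_gap:
  fixes x :: "nat \<Rightarrow> real^'n"
  assumes dim2: "2 \<le> CARD('n)" and v: "norm v = 1" "gram x t *v v = eigval (gram x t) 1 *\<^sub>R v"
    and \<theta>: "norm \<theta> = 1"
  shows "(eigval (gram x t) 1 - tail_sum (gram x t)) * (1 - (v \<bullet> \<theta>)\<^sup>2)
    \<le> eigval (gram x t) 1 - \<theta> \<bullet> (gram x t *v \<theta>)"
proof -
  define \<mu> where "\<mu> = eigval (gram x t) 1"
  define c where "c = v \<bullet> \<theta>"
  define r where "r = \<theta> - c *\<^sub>R v"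
  have vv: "v \<bullet> v = 1" using v(1) by (simp add: norm_eq_1)
  have vr: "v \<bullet> r = 0" using vv by (simp add: r_def inner_diff_right c_def)
  have rr: "r \<bullet> r = 1 - c\<^sup>2"
    using \<theta> vv by (simp add: r_def inner_diff_right inner_diff_left c_def inner_commute norm_eq_1 power2_eq_square)
  have vGv: "v \<bullet> (gram x t *v v) = \<mu>" using v(2) vv by (simp add: \<mu>_def)
  have Gv: "gram x t *v v = \<mu> *\<^sub>R v" using v(2) by (simp add: \<mu>_def)
  have rGv: "r \<bullet> (gram x t *v v) = 0" using vr by (simp add: Gv inner_commute)
  have vGr: "v \<bullet> (gram x t *v r) = 0"
    using symmetric_inner_swap[OF gram_symmetric, of v x t r] vr by (simp add: Gv)
  have \<theta>: "\<theta> = r + c *\<^sub>R v" by (simp add: r_def)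
  have \<theta>G: "\<theta> \<bullet> (gram x t *v \<theta>) = r \<bullet> (gram x t *v r) + c\<^sup>2 * \<mu>"
    unfolding \<theta> by (simp add: matrix_vector_right_distrib matrix_vector_mult_scaleR inner_add_left
        inner_add_right vGr rGv vGv power2_eq_square)
  have bessel: "(y \<bullet> r)\<^sup>2 \<le> (r \<bullet> r) * ((norm y)\<^sup>2 - (y \<bullet> v)\<^sup>2)" for y
  proof -
    have "(y \<bullet> r)\<^sup>2 = ((y - (y \<bullet> v) *\<^sub>R v) \<bullet> r)\<^sup>2" using vr by (simp add: inner_diff_left)
    also have "\<dots> \<le> ((y - (y \<bullet> v) *\<^sub>R v) \<bullet> (y - (y \<bullet> v) *\<^sub>R v)) * (r \<bullet> r)"
      by (rule Cauchy_Schwarz_ineq)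
    also have "(y - (y \<bullet> v) *\<^sub>R v) \<bullet> (y - (y \<bullet> v) *\<^sub>R v) = (norm y)\<^sup>2 - (y \<bullet> v)\<^sup>2"
      unfolding power2_norm_eq_inner
      using vv by (simp add: inner_diff_left inner_diff_right inner_commute power2_eq_square)
    finally show ?thesis by (simp add: mult.commute)
  qed
  have "r \<bullet> (gram x t *v r) = r \<bullet> r + (\<Sum>s=1..t. (x s \<bullet> r)\<^sup>2)" by (rule gram_quadratic_form)
  also have "\<dots> \<le> r \<bullet> r + (\<Sum>s=1..t. (r \<bullet> r) * ((norm (x s))\<^sup>2 - (x s \<bullet> v)\<^sup>2))"
    by (intro add_left_mono sum_mono bessel)
  also have "\<dots> = (r \<bullet> r) * (1 + (\<Sum>s=1..t. (norm (x s))\<^sup>2) - (\<Sum>s=1..t. (x s \<bullet> v)\<^sup>2))"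
    by (simp add: sum_distrib_left[symmetric] sum_subtractf algebra_simps)
  also have "\<dots> \<le> (r \<bullet> r) * tail_sum (gram x t)"
  proof (rule mult_left_mono)
    have "\<mu> = 1 + (\<Sum>s=1..t. (x s \<bullet> v)\<^sup>2)"
      using gram_quadratic_form[of v x t] vGv vv by simp
    moreover have "tail_sum (gram x t) = real CARD('n) + (\<Sum>s=1..t. (norm (x s))\<^sup>2) - \<mu>"
      by (simp add: tail_sum_eq[OF gram_symmetric] gram_trace \<mu>_def)
    moreover have "2 \<le> real CARD('n)" using dim2 by simp
    ultimately show "1 + (\<Sum>s=1..t. (norm (x s))\<^sup>2) - (\<Sum>s=1..t. (x s \<bullet> v)\<^sup>2) \<le> tail_sum (gram x t)"
      by linarith
  qed simp
  finally have "\<theta> \<bullet> (gram x t *v \<theta>) \<le> (1 - c\<^sup>2) * tail_sum (gram x t) + c\<^sup>2 * \<mu>"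
    unfolding \<theta>G rr by simp
  then show ?thesis unfolding \<mu>_def[symmetric] c_def[symmetric] by (simp add: algebra_simps)
qed

lemma norm_diff_unit_le:
  fixes v \<theta> :: "'a::real_inner"
  assumes "norm v = 1" "norm \<theta> = 1" "0 \<le> v \<bullet> \<theta>"
  shows "(norm (v - \<theta>))\<^sup>2 \<le> 2 * (1 - (v \<bullet> \<theta>)\<^sup>2)"
proof -
  have c: "v \<bullet> \<theta> \<le> 1" using norm_cauchy_schwarz[of v \<theta>] assms by simp
  have "(norm (v - \<theta>))\<^sup>2 = 2 - 2 * (v \<bullet> \<theta>)"
    unfolding power2_norm_eq_inner using assms
    by (simp add: inner_diff_left inner_diff_right inner_commute norm_eq_1)
  moreover have "(v \<bullet> \<theta>)\<^sup>2 \<le> v \<bullet> \<theta>"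
    using mult_left_mono[OF c assms(3)] by (simp add: power2_eq_square)
  ultimately show ?thesis by simp
qed

context low_regret_path
begin

text \<open>The threshold \<open>16 * a^2 * \<beta>^2\<close> makes
  \<open>a * \<beta> * sqrt t\<close> at most \<open>t / 4\<close>, so that the non-leading
  eigenvalues stay well below the leading one. It becomes the end of the exploration phase.\<close>

lemma concentration:
  assumes t: "t \<le> T" and a: "1 \<le> a" and ta: "16 * a\<^sup>2 * \<beta>\<^sup>2 \<le> t"
    and ex: "excess t \<le> a * \<beta> * sqrt t"
  shows "t / 2 \<le> eigval (gram x t) 1 - eigval (gram x t) 2"
    and "norm v = 1 \<Longrightarrow> gram x t *v v = eigval (gram x t) 1 *\<^sub>R v \<Longrightarrow> 0 \<le> v \<bullet> \<theta> \<Longrightarrow>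
      norm (v - \<theta>) \<le> 2 * a * (\<beta> / sqrt (lmin x t))"
proof -
  let ?\<mu> = "eigval (gram x t) 1" and ?X = "tail_sum (gram x t)"
  have D: "2 \<le> real CARD('n)" using dim2 by simp
  have X: "?X \<le> excess t" by (rule tail_sum_le_excess[OF t])
  have \<mu>: "?\<mu> = real CARD('n) + t - ?X"
    using tail_sum_eq[OF gram_symmetric, of x t] trace_gram[OF t] by simp
  have t0: "0 < real t"
  proof -
    have "0 < 16 * a\<^sup>2 * \<beta>\<^sup>2" using a beta_ge_1 by simp
    then show ?thesis using ta by linarith
  qed
  have s0: "0 < sqrt t" using t0 by simp
  have "4 * a * \<beta> \<le> sqrt t"
    using ta by (intro real_le_rsqrt) (simp add: power_mult_distrib)
  then have ab: "a * \<beta> \<le> sqrt t / 4" by simp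
  have "excess t \<le> sqrt t / 4 * sqrt t"
    using mult_right_mono[OF ab, of "sqrt t"] ex by simp
  then have e4: "excess t \<le> t / 4" by simp
  have "eigval (gram x t) 2 \<le> ?X"
    using dim2 by (intro eigval_le_tail_sum[OF gram_posdef]) auto
  then show "t / 2 \<le> ?\<mu> - eigval (gram x t) 2" using \<mu> X e4 D by linarith
  assume v: "norm v = 1" "gram x t *v v = ?\<mu> *\<^sub>R v" "0 \<le> v \<bullet> \<theta>"
  define z where "z = 1 - (v \<bullet> \<theta>)\<^sup>2"
  have "v \<bullet> \<theta> \<le> 1" using norm_cauchy_schwarz[of v \<theta>] v(1) norm_theta by simp
  then have z: "0 \<le> z" using v(3) by (simp add: z_def power_le_one)
  have "t / 2 * z \<le> (?\<mu> - ?X) * z"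
    using \<mu> X e4 D z by (intro mult_right_mono) linarith+
  also have "\<dots> \<le> ?\<mu> - \<theta> \<bullet> (gram x t *v \<theta>)"
    unfolding z_def by (rule leading_eigenvector_gap[OF dim2 v(1,2) norm_theta])
  also have "\<dots> \<le> excess t"
  proof -
    have "0 < eigval (gram x t) 2" using dim2 by (intro posdef_eigval_pos[OF gram_posdef]) auto
    then have "0 \<le> ?X" using \<open>eigval (gram x t) 2 \<le> ?X\<close> by linarith
    then show ?thesis
      using trace_minus_quadratic_form_le[OF t] \<mu> trace_gram[OF t] by linarith
  qed
  also have "\<dots> \<le> a * \<beta> * sqrt t" by (rule ex)
  finally have "(z * sqrt t) * sqrt t \<le> (2 * a * \<beta>) * sqrt t" by (simp add: mult_ac)
  then have zt: "z * sqrt t \<le> 2 * a * \<beta>" using s0 by (simp only: mult_le_cancel_right_pos)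
  \<comment> \<open>Two bounds of opposite order in \<open>sqrt t\<close> are multiplied to
    eliminate \<open>t\<close>: \<open>z\<close> is at most of order
    \<open>\<beta> / sqrt t\<close>, the least eigenvalue at most of order
    \<open>\<beta> * sqrt t\<close>.\<close>
  have "lmin x t * z \<le> (a * \<beta> * sqrt t) * z"
    using lmin_le_excess[OF t] ex z by (intro mult_right_mono) auto
  also have "\<dots> = (a * \<beta>) * (z * sqrt t)" by simp
  also have "\<dots> \<le> (a * \<beta>) * (2 * a * \<beta>)" using zt a beta_ge_1 by (intro mult_left_mono) auto
  finally have "z \<le> 2 * a\<^sup>2 * \<beta>\<^sup>2 / lmin x t"
    using lmin_pos[of x t] by (simp add: field_simps power2_eq_square)
  then have "(norm (v - \<theta>))\<^sup>2 \<le> 4 * a\<^sup>2 * \<beta>\<^sup>2 / lmin x t"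
    using norm_diff_unit_le[OF v(1) norm_theta v(3)] by (simp add: z_def)
  also have "\<dots> = (2 * a * (\<beta> / sqrt (lmin x t)))\<^sup>2"
    using lmin_pos[of x t] by (simp add: power_mult_distrib power_divide)
  finally show "norm (v - \<theta>) \<le> 2 * a * (\<beta> / sqrt (lmin x t))"
    by (rule power2_le_imp_le) (use a beta_ge_1 lmin_pos[of x t] in simp)
qed

end

context ucb_path
begin

text \<open>If \<open>\<lambda>\<close> is at most \<open>4 \<rho>\<^sup>2\<close>, the second term alone exceeds the trivial bound 2; otherwise the
  estimator \<open>\<theta>'\<close> has norm at most 3/2, and the optimality of the action can be tested at \<open>\<theta>\<close>.\<close>

lemma regret_of_confidence:
  assumes t: "t \<in> {1..T}" and \<theta>: "norm \<theta> = 1"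
    and proj: "\<theta>' \<noteq> 0 \<Longrightarrow> h (t - 1) = \<theta>' /\<^sub>R norm \<theta>'"
    and conf: "anorm (gram x (t - 1)) (\<theta>' - \<theta>) \<le> C * \<beta>" and C: "0 < C"
  shows "1 - x t \<bullet> \<theta> \<le> (3 + 8 * C\<^sup>2) * (\<beta> * width x t + \<beta>\<^sup>2 / lmin x (t - 1))"
proof -
  define m where "m = lmin x (t - 1)"
  define w where "w = width x t"
  define g where "g = 1 - x t \<bullet> \<theta>"
  define \<rho> where "\<rho> = C * \<beta>"
  define e where "e = \<theta>' - \<theta>"
  have m: "1 \<le> m" unfolding m_def by (rule lmin_ge_1)
  have w: "0 \<le> w" unfolding w_def by (rule inorm_nonneg[OF gram_posdef])
  have \<rho>: "0 < \<rho>" using C beta_ge_1 by (simp add: \<rho>_def)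
  have nx: "norm (x t) = 1" by (rule norm_action[OF t])
  have bw: "0 \<le> \<beta> * w" using w beta_ge_1 by simp
  have bm: "0 \<le> \<beta>\<^sup>2 / m" using m by simp
  have key: "g \<le> 6 * (\<beta> * w) / 2 + 8 * (\<rho>\<^sup>2 / m)"
  proof (cases "m \<le> 4 * \<rho>\<^sup>2")
    case True
    have "\<bar>x t \<bullet> \<theta>\<bar> \<le> 1" using Cauchy_Schwarz_ineq2[of "x t" \<theta>] nx \<theta> by simp
    then have "g \<le> 2" by (simp add: g_def)
    also have "\<dots> \<le> 8 * (\<rho>\<^sup>2 / m)" using True m by (simp add: field_simps)
    finally show ?thesis using bw by simp
  next
    case False
    have ce: "anorm (gram x (t - 1)) e \<le> \<rho>" using conf by (simp add: e_def \<rho>_def)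
    have "sqrt m * norm e \<le> \<rho>"
      using anorm_ge[OF gram_posdef, of x "t - 1" e] ce unfolding m_def by linarith
    moreover have "2 * \<rho> \<le> sqrt m" using False by (intro real_le_rsqrt) (simp add: power_mult_distrib)
    ultimately have "2 * norm e * sqrt m \<le> 1 * sqrt m" by (simp add: mult.commute)
    then have ne: "norm e \<le> 1 / 2" using m by (simp only: mult_le_cancel_right_pos real_sqrt_gt_0_iff)
    define N where "N = norm \<theta>'"
    have e': "\<theta>' = \<theta> + e" by (simp add: e_def)
    have N: "1 / 2 \<le> N" "N \<le> 3 / 2"
      using norm_triangle_ineq[of \<theta> e] norm_diff_ineq[of \<theta> e] ne \<theta> by (auto simp: N_def e')
    then have "\<theta>' \<noteq> 0" by (auto simp: N_def)
    then have h: "h (t - 1) = \<theta>' /\<^sub>R N" using proj by (simp add: N_def)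
    have ith: "0 \<le> \<beta> * inorm (gram x (t - 1)) \<theta>"
      using beta_ge_1 inorm_nonneg[OF gram_posdef, of x "t - 1" \<theta>] by simp
    have "\<theta> \<bullet> h (t - 1) + \<beta> * inorm (gram x (t - 1)) \<theta> \<le> x t \<bullet> h (t - 1) + \<beta> * w"
      unfolding w_def using \<theta> by (intro ucb_le[OF t]) simp
    then have "(\<theta> \<bullet> \<theta>') / N \<le> (x t \<bullet> \<theta>') / N + \<beta> * w"
      using ith unfolding h by (simp add: divide_inverse mult.commute)
    then have "\<theta> \<bullet> \<theta>' \<le> x t \<bullet> \<theta>' + N * (\<beta> * w)" using N by (simp add: field_simps)
    also have "\<dots> \<le> x t \<bullet> \<theta>' + 3 / 2 * (\<beta> * w)" using N bw by (intro add_left_mono mult_right_mono) auto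
    finally have "1 + \<theta> \<bullet> e \<le> x t \<bullet> \<theta> + x t \<bullet> e + 3 / 2 * (\<beta> * w)"
      using \<theta> by (simp add: e' inner_add_right norm_eq_1)
    then have g1: "g \<le> e \<bullet> (x t - \<theta>) + 3 / 2 * (\<beta> * w)"
      by (simp add: g_def inner_diff_right inner_commute)
    have "e \<bullet> (x t - \<theta>) \<le> anorm (gram x (t - 1)) e * inorm (gram x (t - 1)) (x t - \<theta>)"
      by (rule inner_le_anorm_inorm[OF gram_posdef])
    also have "\<dots> \<le> \<rho> * (norm (x t - \<theta>) / sqrt m)"
      using ce \<rho> inorm_le[OF gram_posdef, of x "t - 1" "x t - \<theta>"]
        inorm_nonneg[OF gram_posdef, of x "t - 1" "x t - \<theta>"]
      unfolding m_def by (intro mult_mono) auto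
    \<comment> \<open>Both vectors are unit, so \<open>(norm (x t - \<theta>))^2\<close> is
      \<open>2 * g\<close>. After the arithmetic-geometric inequality half of \<open>g\<close> moves
      to the left, and the estimation error enters only squared, as
      \<open>\<rho>^2 / m\<close>.\<close>
    also have "\<dots> \<le> (norm (x t - \<theta>))\<^sup>2 / 4 + \<rho>\<^sup>2 / m"
    proof -
      have "0 \<le> (norm (x t - \<theta>) / 2 - \<rho> / sqrt m)\<^sup>2" by simp
      also have "\<dots> = (norm (x t - \<theta>))\<^sup>2 / 4 - \<rho> * (norm (x t - \<theta>) / sqrt m) + \<rho>\<^sup>2 / m"
        using m by (simp add: power2_diff power_divide)
      finally show ?thesis by simp
    qed
    also have "(norm (x t - \<theta>))\<^sup>2 = 2 * g"
      unfolding power2_norm_eq_inner g_def using nx \<theta>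
      by (simp add: inner_diff_left inner_diff_right inner_commute norm_eq_1)
    finally have "e \<bullet> (x t - \<theta>) \<le> g / 2 + \<rho>\<^sup>2 / m" by simp
    then have "g \<le> 6 * (\<beta> * w) / 2 + 2 * (\<rho>\<^sup>2 / m)" using g1 by simp
    moreover have "0 \<le> \<rho>\<^sup>2 / m" using m by simp
    ultimately show ?thesis by linarith
  qed
  have "8 * (\<rho>\<^sup>2 / m) = 8 * C\<^sup>2 * (\<beta>\<^sup>2 / m)" by (simp add: \<rho>_def power_mult_distrib)
  also have "\<dots> \<le> (3 + 8 * C\<^sup>2) * (\<beta>\<^sup>2 / m)" using bm by (intro mult_right_mono) auto
  finally have 1: "8 * (\<rho>\<^sup>2 / m) \<le> (3 + 8 * C\<^sup>2) * (\<beta>\<^sup>2 / m)" .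
  have "3 * (\<beta> * w) \<le> (3 + 8 * C\<^sup>2) * (\<beta> * w)" using bw by (intro mult_right_mono) auto
  then have "g \<le> (3 + 8 * C\<^sup>2) * (\<beta> * w) + (3 + 8 * C\<^sup>2) * (\<beta>\<^sup>2 / m)" using key 1 by linarith
  then show ?thesis unfolding g_def w_def m_def by (simp add: distrib_left)
qed

end

definition settled ::
  "real \<Rightarrow> real \<Rightarrow> real \<Rightarrow> (nat \<Rightarrow> real^'n) \<Rightarrow> real^'n \<Rightarrow> nat \<Rightarrow> bool" where
  "settled a l \<beta> x \<theta> t \<longleftrightarrow>
    l * \<beta> * sqrt t \<le> lmin x t \<and> tail_sum (gram x t) \<le> a * \<beta> * sqrt t \<and>
    t / 2 \<le> eigval (gram x t) 1 - eigval (gram x t) 2 \<and>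
    (\<forall>v. norm v = 1 \<and> gram x t *v v = eigval (gram x t) 1 *\<^sub>R v \<and> 0 \<le> v \<bullet> \<theta> \<longrightarrow>
      norm (v - \<theta>) \<le> 2 * a * (\<beta> / sqrt (lmin x t)))"

text \<open>The constants precede \<open>\<beta>\<close>, the horizon and the path: they depend on
  the dimension and on the ratio \<open>C\<close> of the confidence radius to \<open>\<beta>\<close>
  alone.\<close>

proposition confident_path_behaviour:
  fixes C :: real
  assumes dim2: "2 \<le> CARD('n::finite)" and C: "0 < C"
  shows "\<exists>a l. 1 \<le> a \<and> 0 < l \<and> (\<forall>\<beta> T (x :: nat \<Rightarrow> real^'n) h \<theta> \<theta>' t.
    ucb_path \<beta> T x h \<longrightarrow> norm \<theta> = 1 \<longrightarrow>
    (\<forall>s<T. \<theta>' s \<noteq> 0 \<longrightarrow> h s = \<theta>' s /\<^sub>R norm (\<theta>' s)) \<longrightarrow>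
    (\<forall>s<T. anorm (gram x s) (\<theta>' s - \<theta>) \<le> C * \<beta>) \<longrightarrow>
    16 * a\<^sup>2 * \<beta>\<^sup>2 \<le> real t \<longrightarrow> t \<le> T \<longrightarrow>
    settled a l \<beta> x \<theta> t)"
proof -
  define D where "D = real CARD('n)"
  define R where "R = 3 + 8 * C\<^sup>2"
  have R: "0 < R" using C by (simp add: R_def add_pos_nonneg)
  have D: "2 \<le> D" using dim2 by (simp add: D_def)
  obtain A l where A: "1 \<le> A" "2 * (D + 4) \<le> A" "40 * R \<le> A"
    and l: "0 < l" "l \<le> 1" "l \<le> 1 / (1250 * 4\<^sup>2 * D\<^sup>2)"
    and Ay: "\<And>y. A \<le> y \<Longrightarrow> 8 * R\<^sup>2 * (ln (2 * D) + (D - 1) * ln (2 * y\<^sup>2)) \<le> y\<^sup>2 / 100"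
    and Al: "2 * (ln (2 * D) + (D - 1) * ln (2 * A / l\<^sup>2)) \<le> 1 / (50 * l)"
    using bootstrap_constants[OF D R, of "1 / (1250 * 4\<^sup>2 * D\<^sup>2)"] D by auto
  define a where "a = A / l"
  have "1 * l \<le> A" using A l by linarith
  then have a: "1 \<le> a" using l by (simp add: a_def field_simps)
  show ?thesis
  proof (rule exI[of _ a], rule exI[of _ l], intro conjI[OF a] conjI[OF l(1)] allI impI)
    fix \<beta> T and x :: "nat \<Rightarrow> real^'n" and h \<theta> \<theta>' t
    assume up: "ucb_path \<beta> T x h" and \<theta>: "norm \<theta> = 1"
      and proj: "\<forall>s<T. \<theta>' s \<noteq> 0 \<longrightarrow> h s = \<theta>' s /\<^sub>R norm (\<theta>' s)"
      and conf: "\<forall>s<T. anorm (gram x s) (\<theta>' s - \<theta>) \<le> C * \<beta>"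
      and t: "16 * a\<^sup>2 * \<beta>\<^sup>2 \<le> real t" "t \<le> T"
    interpret ucb_path \<beta> T x h by (rule up)
    interpret low_regret_path \<beta> T x h \<theta> R
    proof unfold_locales
      fix s assume s: "s \<in> {1..T}"
      then have "s - 1 < T" by auto
      then show "1 - x s \<bullet> \<theta> \<le> R * (\<beta> * width x s + \<beta>\<^sup>2 / lmin x (s - 1))"
        unfolding R_def using proj conf
        by (intro regret_of_confidence[OF s \<theta>, of "\<theta>' (s - 1)"]) (auto simp: C)
    qed (fact \<theta> R)+
    have "1 \<le> a\<^sup>2" using a by simp
    then have "1 * \<beta>\<^sup>2 \<le> 16 * a\<^sup>2 * \<beta>\<^sup>2" by (intro mult_right_mono) auto
    then have t': "\<beta>\<^sup>2 \<le> real t" using t by linarith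
    have b: "excess t \<le> a * \<beta> * sqrt t" "l * \<beta> * sqrt t \<le> lmin x t"
      using excess_and_lmin_bounds[of A l t] A l Ay Al t' t(2) unfolding D_def a_def by auto
    show "settled a l \<beta> x \<theta> t"
      unfolding settled_def
      using b tail_sum_le_excess[OF t(2)] concentration[OF t(2) a t(1) b(1)] by auto
  qed
qed

section \<open>Self-normalized concentration\<close>

text \<open>\<open>real_cond_exp\<close> is a difference of two extended conditional expectations
  passed through \<open>enn2real\<close>, so a real bound transfers once the positive part is finite
  and the negative part vanishes almost everywhere. The extended version can be multiplied by
  weights not known to be integrable.\<close>

lemma (in finite_measure) nn_cond_exp_le_const:
  assumes sub: "subalgebra M F" and int: "integrable M g" and g: "\<And>x. 0 \<le> g x"
    and le: "AE x in M. real_cond_exp M F g x \<le> c"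
  shows "AE x in M. nn_cond_exp M F (\<lambda>x. ennreal (g x)) x \<le> ennreal c"
proof -
  interpret finite_measure_subalgebra M F by unfold_locales (rule sub)
  have [measurable]: "g \<in> borel_measurable M" using int by auto
  have "(\<integral>\<^sup>+x. nn_cond_exp M F (\<lambda>x. ennreal (g x)) x \<partial>M) = (\<integral>\<^sup>+x. ennreal (g x) \<partial>M)"
    using nn_cond_exp_intg[of "\<lambda>_. 1" "\<lambda>x. ennreal (g x)"] by simp
  also have "\<dots> \<noteq> \<infinity>" using int g by (simp add: nn_integral_eq_integral)
  finally have fin: "AE x in M. nn_cond_exp M F (\<lambda>x. ennreal (g x)) x \<noteq> \<infinity>"
    by (intro nn_integral_PInf_AE) auto
  have "(\<integral>\<^sup>+x. nn_cond_exp M F (\<lambda>x. ennreal (- g x)) x \<partial>M) = (\<integral>\<^sup>+x. ennreal (- g x) \<partial>M)"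
    using nn_cond_exp_intg[of "\<lambda>_. 1" "\<lambda>x. ennreal (- g x)"] by simp
  also have "\<dots> = 0" using g by (simp add: ennreal_neg)
  finally have "AE x in M. nn_cond_exp M F (\<lambda>x. ennreal (- g x)) x = 0"
    by (simp add: nn_integral_0_iff_AE)
  with fin le show ?thesis
  proof eventually_elim
    case (elim x)
    then have "enn2real (nn_cond_exp M F (\<lambda>x. ennreal (g x)) x) \<le> c" by (simp add: real_cond_exp_def)
    then have "ennreal (enn2real (nn_cond_exp M F (\<lambda>x. ennreal (g x)) x)) \<le> ennreal c"
      by (rule ennreal_leI)
    then show ?case using elim(1) by (simp add: less_top)
  qed
qed

lemma space_history [simp]: "space (history M a (reward \<theta> a \<epsilon>) t) = space M"
  by (simp add: history_def space_measure_of_conv)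

lemma sets_history:
  "sets (history M a (reward \<theta> a \<epsilon>) t) = sigma_sets (space M)
    {(\<lambda>\<omega>. (a s \<omega>, reward \<theta> a \<epsilon> s \<omega>)) -` A \<inter> space M | s A. s \<in> {1..t} \<and> A \<in> sets borel}"
  unfolding history_def by (rule sets_measure_of) auto

lemma pair_measurable_history:
  fixes \<theta> :: "real^'n"
  assumes "s \<in> {1..t}"
  shows "(\<lambda>\<omega>. (a s \<omega>, reward \<theta> a \<epsilon> s \<omega>)) \<in> borel_measurable (history M a (reward \<theta> a \<epsilon>) t)"
  using assms by (intro measurableI) (auto simp: sets_history intro!: sigma_sets.Basic)

lemma action_measurable_history:
  fixes \<theta> :: "real^'n"
  assumes "s \<in> {1..t}"
  shows "a s \<in> borel_measurable (history M a (reward \<theta> a \<epsilon>) t)"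
proof -
  have "fst \<in> borel_measurable (borel :: ((real^'n) \<times> real) measure)"
    by (intro borel_measurable_continuous_onI continuous_intros)
  from measurable_compose[OF pair_measurable_history[OF assms] this] show ?thesis by simp
qed

lemma reward_measurable_history:
  fixes \<theta> :: "real^'n"
  assumes "s \<in> {1..t}"
  shows "reward \<theta> a \<epsilon> s \<in> borel_measurable (history M a (reward \<theta> a \<epsilon>) t)"
proof -
  have "snd \<in> borel_measurable (borel :: ((real^'n) \<times> real) measure)"
    by (intro borel_measurable_continuous_onI continuous_intros)
  from measurable_compose[OF pair_measurable_history[OF assms] this] show ?thesis by simp
qed

lemma noise_measurable_history:
  assumes "s \<in> {1..t}"
  shows "\<epsilon> s \<in> borel_measurable (history M a (reward \<theta> a \<epsilon>) t)"
proof -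
  have "(\<lambda>\<omega>. reward \<theta> a \<epsilon> s \<omega> - a s \<omega> \<bullet> \<theta>) \<in> borel_measurable (history M a (reward \<theta> a \<epsilon>) t)"
    using action_measurable_history[OF assms, of a M \<theta> \<epsilon>] reward_measurable_history[OF assms, of \<theta> a \<epsilon> M]
    by measurable
  then show ?thesis by (simp add: reward_def)
qed

context linucb
begin

abbreviation hist :: "nat \<Rightarrow> 'w measure" where
  "hist t \<equiv> history M a (reward \<theta> a \<epsilon>) t"

lemmas action_measurable_hist = action_measurable_history[where a = a and M = M and \<theta> = \<theta> and \<epsilon> = \<epsilon>]

lemmas noise_measurable_hist = noise_measurable_history[where a = a and M = M and \<theta> = \<theta> and \<epsilon> = \<epsilon>]

text \<open>Predictability makes an action measurable for the earlier history, hence for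
  \<open>M\<close> only if that history is contained in \<open>M\<close>; the two facts are proved
  together, round by round.\<close>

lemma sets_hist_subset: "t \<le> T \<Longrightarrow> sets (hist t) \<subseteq> sets M"
proof (induction t rule: less_induct)
  case (less t)
  have "(\<lambda>\<omega>. (a s \<omega>, reward \<theta> a \<epsilon> s \<omega>)) -` A \<inter> space M \<in> sets M"
    if s: "s \<in> {1..t}" and A: "A \<in> sets borel" for s and A :: "((real^'n) \<times> real) set"
  proof -
    have "s - 1 < t" "s - 1 \<le> T" "s \<in> {1..T}" using s less.prems by auto
    then have "subalgebra M (hist (s - 1))"
      using less.IH[of "s - 1"] by (simp add: subalgebra_def)
    then have [measurable]: "a s \<in> borel_measurable M"
      using action_predictable[OF \<open>s \<in> {1..T}\<close>] by (rule measurable_from_subalg)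
    have [measurable]: "\<epsilon> s \<in> borel_measurable M"
      using \<open>s \<in> {1..T}\<close> by (rule noise_measurable)
    have "(\<lambda>\<omega>. (a s \<omega>, reward \<theta> a \<epsilon> s \<omega>)) \<in> borel_measurable M"
      unfolding reward_def by measurable
    then show ?thesis using A by (rule measurable_sets)
  qed
  then show ?case unfolding sets_history by (intro sets.sigma_sets_subset) auto
qed

lemma subalgebra_hist: "t \<le> T \<Longrightarrow> subalgebra M (hist t)"
  using sets_hist_subset by (simp add: subalgebra_def)

text \<open>Sub-Gaussianity is assumed for each fixed exponent, with an exceptional null set that
  may depend on it, while \<open>exp_process\<close> needs the random exponent
  \<open>x \<bullet> a t \<omega>\<close>. Hence three stages: a constant exponent, a simple one
  split into its level sets, and a measurable one as a limit, by Fatou's lemma.\<close>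

lemma noise_mgf_const:
  assumes t: "t \<in> {1..T}" and z[measurable]: "z \<in> borel_measurable (hist (t - 1))"
  shows "(\<integral>\<^sup>+\<omega>. z \<omega> * ennreal (exp (v * \<epsilon> t \<omega>)) \<partial>M)
    \<le> ennreal (exp (\<sigma>\<^sup>2 * v\<^sup>2 / 2)) * (\<integral>\<^sup>+\<omega>. z \<omega> \<partial>M)"
proof -
  have sub: "subalgebra M (hist (t - 1))" using t by (intro subalgebra_hist) auto
  interpret finite_measure_subalgebra M "hist (t - 1)" by unfold_locales (rule sub)
  have zM[measurable]: "z \<in> borel_measurable M" by (rule measurable_from_subalg[OF sub z])
  have [measurable]: "\<epsilon> t \<in> borel_measurable M" by (rule noise_measurable[OF t])
  have "(\<integral>\<^sup>+\<omega>. z \<omega> * ennreal (exp (v * \<epsilon> t \<omega>)) \<partial>M)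
      = (\<integral>\<^sup>+\<omega>. z \<omega> * nn_cond_exp M (hist (t - 1)) (\<lambda>\<omega>. ennreal (exp (v * \<epsilon> t \<omega>))) \<omega> \<partial>M)"
    by (rule nn_cond_exp_intg[symmetric], rule z) measurable
  also have "\<dots> \<le> (\<integral>\<^sup>+\<omega>. z \<omega> * ennreal (exp (\<sigma>\<^sup>2 * v\<^sup>2 / 2)) \<partial>M)"
  proof (rule nn_integral_mono_AE)
    have "AE \<omega> in M. nn_cond_exp M (hist (t - 1)) (\<lambda>\<omega>. ennreal (exp (v * \<epsilon> t \<omega>))) \<omega>
        \<le> ennreal (exp (\<sigma>\<^sup>2 * v\<^sup>2 / 2))"
      by (rule nn_cond_exp_le_const[OF sub noise_integrable[OF t] _ noise_subgaussian[OF t]]) simp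
    then show "AE \<omega> in M. z \<omega> * nn_cond_exp M (hist (t - 1)) (\<lambda>\<omega>. ennreal (exp (v * \<epsilon> t \<omega>))) \<omega>
        \<le> z \<omega> * ennreal (exp (\<sigma>\<^sup>2 * v\<^sup>2 / 2))"
      by eventually_elim (rule mult_left_mono, auto)
  qed
  also have "\<dots> = ennreal (exp (\<sigma>\<^sup>2 * v\<^sup>2 / 2)) * (\<integral>\<^sup>+\<omega>. z \<omega> \<partial>M)"
    by (subst nn_integral_multc) (auto simp: mult.commute)
  finally show ?thesis .
qed

lemma noise_mgf_simple:
  assumes t: "t \<in> {1..T}" and z[measurable]: "z \<in> borel_measurable (hist (t - 1))"
    and l: "simple_function (hist (t - 1)) l"
  shows "(\<integral>\<^sup>+\<omega>. z \<omega> * ennreal (exp (l \<omega> * \<epsilon> t \<omega> - \<sigma>\<^sup>2 * (l \<omega>)\<^sup>2 / 2)) \<partial>M) \<le> (\<integral>\<^sup>+\<omega>. z \<omega> \<partial>M)"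
proof -
  have sub: "subalgebra M (hist (t - 1))" using t by (intro subalgebra_hist) auto
  have zM[measurable]: "z \<in> borel_measurable M" by (rule measurable_from_subalg[OF sub z])
  have [measurable]: "\<epsilon> t \<in> borel_measurable M" by (rule noise_measurable[OF t])
  define V where "V = l ` space M"
  have fin: "finite V" using l unfolding V_def simple_function_def by simp
  define A where "A v = l -` {v} \<inter> space M" for v
  have Ah: "A v \<in> sets (hist (t - 1))" if "v \<in> V" for v
    using l that unfolding simple_function_def A_def V_def by auto
  then have AM: "A v \<in> sets M" if "v \<in> V" for v
    using sub that unfolding subalgebra_def by auto
  have split: "f \<omega> = (\<Sum>v\<in>V. f \<omega> * indicator (A v) \<omega>)" if "\<omega> \<in> space M" for f :: "'w \<Rightarrow> ennreal" and \<omega>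
  proof -
    have "(\<Sum>v\<in>V. f \<omega> * indicator (A v) \<omega>) = (\<Sum>v\<in>V. if v = l \<omega> then f \<omega> else 0)"
      using that by (intro sum.cong) (auto simp: A_def indicator_def)
    then show ?thesis using fin that by (simp add: V_def)
  qed
  have "(\<integral>\<^sup>+\<omega>. z \<omega> * ennreal (exp (l \<omega> * \<epsilon> t \<omega> - \<sigma>\<^sup>2 * (l \<omega>)\<^sup>2 / 2)) \<partial>M)
      = (\<integral>\<^sup>+\<omega>. (\<Sum>v\<in>V. (z \<omega> * ennreal (exp (- (\<sigma>\<^sup>2 * v\<^sup>2 / 2))) * indicator (A v) \<omega>)
          * ennreal (exp (v * \<epsilon> t \<omega>))) \<partial>M)"
  proof (rule nn_integral_cong)
    fix \<omega> assume \<omega>: "\<omega> \<in> space M"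
    show "z \<omega> * ennreal (exp (l \<omega> * \<epsilon> t \<omega> - \<sigma>\<^sup>2 * (l \<omega>)\<^sup>2 / 2)) = (\<Sum>v\<in>V. (z \<omega> * ennreal (exp (- (\<sigma>\<^sup>2 * v\<^sup>2 / 2))) * indicator (A v) \<omega>)
          * ennreal (exp (v * \<epsilon> t \<omega>)))"
    proof (subst split[OF \<omega>], rule sum.cong[OF refl])
      fix v
      show "z \<omega> * ennreal (exp (l \<omega> * \<epsilon> t \<omega> - \<sigma>\<^sup>2 * (l \<omega>)\<^sup>2 / 2)) * indicator (A v) \<omega>
          = (z \<omega> * ennreal (exp (- (\<sigma>\<^sup>2 * v\<^sup>2 / 2))) * indicator (A v) \<omega>) * ennreal (exp (v * \<epsilon> t \<omega>))"
      proof (cases "\<omega> \<in> A v")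
        case True
        then have l: "l \<omega> = v" by (simp add: A_def)
        have "exp (v * \<epsilon> t \<omega> - \<sigma>\<^sup>2 * v\<^sup>2 / 2) = exp (- (\<sigma>\<^sup>2 * v\<^sup>2 / 2)) * exp (v * \<epsilon> t \<omega>)"
          by (simp add: exp_add[symmetric])
        then have "ennreal (exp (v * \<epsilon> t \<omega> - \<sigma>\<^sup>2 * v\<^sup>2 / 2))
            = ennreal (exp (- (\<sigma>\<^sup>2 * v\<^sup>2 / 2))) * ennreal (exp (v * \<epsilon> t \<omega>))"
          by (simp only: ennreal_mult exp_ge_zero)
        with True show ?thesis by (simp only: l indicator_simps mult_1_right mult.assoc)
      qed simp
    qed
  qed
  also have "\<dots> = (\<Sum>v\<in>V. \<integral>\<^sup>+\<omega>. (z \<omega> * ennreal (exp (- (\<sigma>\<^sup>2 * v\<^sup>2 / 2))) * indicator (A v) \<omega>)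
          * ennreal (exp (v * \<epsilon> t \<omega>)) \<partial>M)"
    using AM by (intro nn_integral_sum) auto
  also have "\<dots> \<le> (\<Sum>v\<in>V. \<integral>\<^sup>+\<omega>. z \<omega> * indicator (A v) \<omega> \<partial>M)"
  proof (rule sum_mono)
    fix v assume v: "v \<in> V"
    have [measurable]: "A v \<in> sets (hist (t - 1))" "A v \<in> sets M" using Ah AM v by auto
    have "(\<integral>\<^sup>+\<omega>. (z \<omega> * ennreal (exp (- (\<sigma>\<^sup>2 * v\<^sup>2 / 2))) * indicator (A v) \<omega>) * ennreal (exp (v * \<epsilon> t \<omega>)) \<partial>M)
      \<le> ennreal (exp (\<sigma>\<^sup>2 * v\<^sup>2 / 2)) * (\<integral>\<^sup>+\<omega>. z \<omega> * ennreal (exp (- (\<sigma>\<^sup>2 * v\<^sup>2 / 2))) * indicator (A v) \<omega> \<partial>M)"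
      by (rule noise_mgf_const[OF t]) measurable
    also have "\<dots> = (\<integral>\<^sup>+\<omega>. ennreal (exp (\<sigma>\<^sup>2 * v\<^sup>2 / 2)) * (z \<omega> * ennreal (exp (- (\<sigma>\<^sup>2 * v\<^sup>2 / 2))) * indicator (A v) \<omega>) \<partial>M)"
      by (rule nn_integral_cmult[symmetric]) measurable
    also have "\<dots> = (\<integral>\<^sup>+\<omega>. z \<omega> * indicator (A v) \<omega> \<partial>M)"
    proof (rule nn_integral_cong)
      fix \<omega>
      have "ennreal (exp (\<sigma>\<^sup>2 * v\<^sup>2 / 2)) * ennreal (exp (- (\<sigma>\<^sup>2 * v\<^sup>2 / 2))) = 1"
        by (simp add: ennreal_mult[symmetric] exp_add[symmetric])
      then show "ennreal (exp (\<sigma>\<^sup>2 * v\<^sup>2 / 2)) * (z \<omega> * ennreal (exp (- (\<sigma>\<^sup>2 * v\<^sup>2 / 2))) * indicator (A v) \<omega>)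
          = z \<omega> * indicator (A v) \<omega>"
        by (simp only: mult.assoc mult.left_commute[of "z \<omega>"]) (simp only: mult.assoc[symmetric] mult_1_left)
    qed
    finally show "(\<integral>\<^sup>+\<omega>. (z \<omega> * ennreal (exp (- (\<sigma>\<^sup>2 * v\<^sup>2 / 2))) * indicator (A v) \<omega>) * ennreal (exp (v * \<epsilon> t \<omega>)) \<partial>M)
      \<le> (\<integral>\<^sup>+\<omega>. z \<omega> * indicator (A v) \<omega> \<partial>M)" .
  qed
  also have "\<dots> = (\<integral>\<^sup>+\<omega>. (\<Sum>v\<in>V. z \<omega> * indicator (A v) \<omega>) \<partial>M)"
    using AM by (intro nn_integral_sum[symmetric]) auto
  also have "\<dots> = (\<integral>\<^sup>+\<omega>. z \<omega> \<partial>M)" by (intro nn_integral_cong split[symmetric])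
  finally show ?thesis .
qed

lemma noise_mgf:
  assumes t: "t \<in> {1..T}" and z[measurable]: "z \<in> borel_measurable (hist (t - 1))" and z0: "\<And>\<omega>. 0 \<le> z \<omega>"
    and l: "l \<in> borel_measurable (hist (t - 1))"
  shows "(\<integral>\<^sup>+\<omega>. ennreal (z \<omega> * exp (l \<omega> * \<epsilon> t \<omega> - \<sigma>\<^sup>2 * (l \<omega>)\<^sup>2 / 2)) \<partial>M) \<le> (\<integral>\<^sup>+\<omega>. ennreal (z \<omega>) \<partial>M)"
proof -
  have sub: "subalgebra M (hist (t - 1))" using t by (intro subalgebra_hist) auto
  have zM[measurable]: "z \<in> borel_measurable M" by (rule measurable_from_subalg[OF sub z])
  have [measurable]: "\<epsilon> t \<in> borel_measurable M" by (rule noise_measurable[OF t])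
  obtain L where L: "\<And>i. simple_function (hist (t - 1)) (L i)"
    "\<And>\<omega>. \<omega> \<in> space M \<Longrightarrow> (\<lambda>i. L i \<omega>) \<longlonglongrightarrow> l \<omega>"
    using borel_measurable_implies_sequence_metric[OF l, of 0] by auto
  have LM[measurable]: "L i \<in> borel_measurable M" for i
    using L(1)[of i] by (intro measurable_from_subalg[OF sub]) (rule borel_measurable_simple_function)
  define u where "u i \<omega> = ennreal (z \<omega> * exp (L i \<omega> * \<epsilon> t \<omega> - \<sigma>\<^sup>2 * (L i \<omega>)\<^sup>2 / 2))" for i \<omega>
  have [measurable]: "u i \<in> borel_measurable M" for i unfolding u_def by measurable
  have "(\<integral>\<^sup>+\<omega>. ennreal (z \<omega> * exp (l \<omega> * \<epsilon> t \<omega> - \<sigma>\<^sup>2 * (l \<omega>)\<^sup>2 / 2)) \<partial>M)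
      = (\<integral>\<^sup>+\<omega>. liminf (\<lambda>i. u i \<omega>) \<partial>M)"
  proof (rule nn_integral_cong)
    fix \<omega> assume "\<omega> \<in> space M"
    then have "(\<lambda>i. u i \<omega>) \<longlonglongrightarrow> ennreal (z \<omega> * exp (l \<omega> * \<epsilon> t \<omega> - \<sigma>\<^sup>2 * (l \<omega>)\<^sup>2 / 2))"
      unfolding u_def by (intro tendsto_ennrealI tendsto_intros L(2)) auto
    then show "ennreal (z \<omega> * exp (l \<omega> * \<epsilon> t \<omega> - \<sigma>\<^sup>2 * (l \<omega>)\<^sup>2 / 2)) = liminf (\<lambda>i. u i \<omega>)"
      by (rule lim_imp_Liminf[OF sequentially_bot, symmetric])
  qed
  also have "\<dots> \<le> liminf (\<lambda>i. \<integral>\<^sup>+\<omega>. u i \<omega> \<partial>M)" by (rule nn_integral_liminf) measurable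
  also have "\<dots> \<le> liminf (\<lambda>i. \<integral>\<^sup>+\<omega>. ennreal (z \<omega>) \<partial>M)"
  proof (rule Liminf_mono, rule always_eventually, rule allI)
    fix i
    show "(\<integral>\<^sup>+\<omega>. u i \<omega> \<partial>M) \<le> (\<integral>\<^sup>+\<omega>. ennreal (z \<omega>) \<partial>M)"
      using noise_mgf_simple[OF t measurable_compose[OF z measurable_ennreal] L(1)[of i]] z0
      by (simp add: u_def ennreal_mult)
  qed
  also have "\<dots> = (\<integral>\<^sup>+\<omega>. ennreal (z \<omega>) \<partial>M)" by (simp add: Liminf_const)
  finally show ?thesis .
qed

text \<open>The exponential supermartingale of the noise sum for a fixed test vector
  \<open>x\<close>; a test vector along the inverse Gram matrix applied to that sum turns it into a
  bound on \<open>inorm\<close>.\<close>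

definition exp_process :: "real^'n \<Rightarrow> nat \<Rightarrow> 'w \<Rightarrow> real" where
  "exp_process x t \<omega> = exp (\<Sum>s=1..t. (x \<bullet> a s \<omega>) * \<epsilon> s \<omega> - \<sigma>\<^sup>2 * (x \<bullet> a s \<omega>)\<^sup>2 / 2)"

lemma exp_process_measurable_hist: "exp_process x t \<in> borel_measurable (hist t)"
proof -
  have "(\<lambda>\<omega>. (x \<bullet> a s \<omega>) * \<epsilon> s \<omega> - \<sigma>\<^sup>2 * (x \<bullet> a s \<omega>)\<^sup>2 / 2) \<in> borel_measurable (hist t)"
    if "s \<in> {1..t}" for s
    using action_measurable_hist[OF that] noise_measurable_hist[OF that] by measurable
  then have [measurable]: "(\<lambda>\<omega>. \<Sum>s=1..t. (x \<bullet> a s \<omega>) * \<epsilon> s \<omega> - \<sigma>\<^sup>2 * (x \<bullet> a s \<omega>)\<^sup>2 / 2)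
      \<in> borel_measurable (hist t)"
    by (rule borel_measurable_sum)
  show ?thesis unfolding exp_process_def by measurable
qed

lemma exp_process_integral_le: "t \<le> T \<Longrightarrow> (\<integral>\<^sup>+\<omega>. ennreal (exp_process x t \<omega>) \<partial>M) \<le> 1"
proof (induction t)
  case 0
  then show ?case by (simp add: exp_process_def emeasure_space_1)
next
  case (Suc t)
  have "Suc t \<in> {1..T}" using Suc.prems by simp
  from action_predictable[OF this] have [measurable]: "a (Suc t) \<in> borel_measurable (hist t)" by simp
  have "(\<integral>\<^sup>+\<omega>. ennreal (exp_process x (Suc t) \<omega>) \<partial>M)
    = (\<integral>\<^sup>+\<omega>. ennreal (exp_process x t \<omega> * exp ((x \<bullet> a (Suc t) \<omega>) * \<epsilon> (Suc t) \<omega>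
        - \<sigma>\<^sup>2 * (x \<bullet> a (Suc t) \<omega>)\<^sup>2 / 2)) \<partial>M)"
    by (simp add: exp_process_def exp_add[symmetric])
  also have "\<dots> \<le> (\<integral>\<^sup>+\<omega>. ennreal (exp_process x t \<omega>) \<partial>M)"
  proof (rule noise_mgf[OF \<open>Suc t \<in> {1..T}\<close>])
    show "exp_process x t \<in> borel_measurable (hist (Suc t - 1))"
      by (simp add: exp_process_measurable_hist)
    show "(\<lambda>\<omega>. x \<bullet> a (Suc t) \<omega>) \<in> borel_measurable (hist (Suc t - 1))" by simp
  qed (simp add: exp_process_def)
  also have "\<dots> \<le> 1" using Suc by simp
  finally show ?case .
qed

lemma exp_process_tail:
  assumes t: "t \<le> T"
  shows "{\<omega> \<in> space M. exp u \<le> exp_process x t \<omega>} \<in> sets M"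
    and "measure M {\<omega> \<in> space M. exp u \<le> exp_process x t \<omega>} \<le> exp (- u)"
proof -
  have [measurable]: "exp_process x t \<in> borel_measurable M"
    using exp_process_measurable_hist subalgebra_hist[OF t] by (auto intro: measurable_from_subalg)
  show A: "{\<omega> \<in> space M. exp u \<le> exp_process x t \<omega>} \<in> sets M" by measurable
  let ?A = "{\<omega> \<in> space M. exp u \<le> exp_process x t \<omega>}"
  have "ennreal (exp u) * emeasure M ?A = (\<integral>\<^sup>+\<omega>. ennreal (exp u) * indicator ?A \<omega> \<partial>M)"
    by (rule nn_integral_cmult_indicator[OF A, symmetric])
  also have "\<dots> \<le> (\<integral>\<^sup>+\<omega>. ennreal (exp_process x t \<omega>) \<partial>M)"
    by (intro nn_integral_mono) (auto simp: indicator_def intro: ennreal_leI)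
  also have "\<dots> \<le> 1" by (rule exp_process_integral_le[OF t])
  finally have "ennreal (exp u * measure M ?A) \<le> ennreal 1"
    by (simp add: emeasure_eq_measure ennreal_mult)
  then have "exp u * measure M ?A \<le> 1" by (subst (asm) ennreal_le_iff) auto
  then show "measure M ?A \<le> exp (- u)" by (simp add: exp_minus field_simps)
qed

end

section \<open>A finite set of test vectors for the self-normalized bound\<close>

definition grid :: "real \<Rightarrow> int \<Rightarrow> (real^'n) set" where
  "grid L R = (\<lambda>f. \<chi> i. real_of_int (f i) / L) ` (UNIV \<rightarrow>\<^sub>E {- R..R})"

lemma finite_grid: "finite (grid L R :: (real^'n) set)"
  unfolding grid_def by (intro finite_imageI finite_PiE) auto

lemma card_grid_le:
  assumes "0 \<le> R"
  shows "real (card (grid L R :: (real^'n) set)) \<le> (2 * real_of_int R + 1) ^ CARD('n)"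
proof -
  have "card (grid L R :: (real^'n) set) \<le> card ((UNIV :: 'n set) \<rightarrow>\<^sub>E {- R..R})"
    unfolding grid_def by (intro card_image_le finite_PiE) auto
  also have "\<dots> = nat (2 * R + 1) ^ CARD('n)" by (simp add: card_PiE)
  finally have "real (card (grid L R :: (real^'n) set)) \<le> real (nat (2 * R + 1) ^ CARD('n))"
    by (simp only: of_nat_le_iff)
  then show ?thesis using assms by simp
qed

text \<open>Each coordinate is rounded in the direction of the sign of \<open>S\<close>, so that \<open>x \<bullet> S\<close> does not decrease.\<close>

lemma grid_rounding:
  fixes y S :: "real^'n"
  assumes L: "0 < L" and R: "norm y * L \<le> R"
  shows "\<exists>x\<in>grid L \<lceil>R\<rceil>. y \<bullet> S \<le> x \<bullet> S \<and> norm (x - y) \<le> sqrt CARD('n) / L"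
proof -
  define f where "f i = (if 0 \<le> S $ i then \<lceil>L * y $ i\<rceil> else \<lfloor>L * y $ i\<rfloor>)" for i
  define x :: "real^'n" where "x = (\<chi> i. real_of_int (f i) / L)"
  have "f i \<in> {- \<lceil>R\<rceil>..\<lceil>R\<rceil>}" for i
  proof -
    have "\<bar>L * y $ i\<bar> \<le> R"
      using component_le_norm_cart[of y i] L R by (simp add: abs_mult) (metis mult.commute mult_left_mono less_imp_le order_trans)
    then have "- real_of_int \<lceil>R\<rceil> \<le> L * y $ i" "L * y $ i \<le> real_of_int \<lceil>R\<rceil>"
      using le_of_int_ceiling[of R] by linarith+
    then show ?thesis unfolding f_def by (auto simp: le_floor_iff ceiling_le_iff) linarith+
  qed
  then have "x \<in> grid L \<lceil>R\<rceil>" unfolding grid_def x_def by (intro imageI) auto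
  moreover have "y \<bullet> S \<le> x \<bullet> S"
  proof -
    have "y $ i * S $ i \<le> x $ i * S $ i" for i
    proof (cases "0 \<le> S $ i")
      case True
      then have "L * y $ i \<le> real_of_int (f i)" by (simp add: f_def)
      then have "y $ i \<le> x $ i" using L by (simp add: x_def field_simps)
      then show ?thesis using True by (rule mult_right_mono)
    next
      case False
      then have "real_of_int (f i) \<le> L * y $ i" by (simp add: f_def)
      then have "x $ i \<le> y $ i" using L by (simp add: x_def field_simps)
      then show ?thesis using False by (intro mult_right_mono_neg) auto
    qed
    then show ?thesis by (simp add: inner_vec_def sum_mono)
  qed
  moreover have "norm (x - y) \<le> sqrt CARD('n) / L"
  proof -
    have "\<bar>x $ i - y $ i\<bar> \<le> 1 / L" for i
    proof -
      have "\<bar>real_of_int (f i) - L * y $ i\<bar> \<le> 1" unfolding f_def by (auto split: if_splits; linarith)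
      moreover have "x $ i - y $ i = (real_of_int (f i) - L * y $ i) / L"
        using L by (simp add: x_def field_simps)
      ultimately show ?thesis using L by (simp only: abs_divide) (simp add: divide_right_mono)
    qed
    then have "(x $ i - y $ i)\<^sup>2 \<le> (1 / L)\<^sup>2" for i
      by (metis abs_ge_zero power2_abs power_mono)
    then have "(\<Sum>i\<in>UNIV. (x $ i - y $ i)\<^sup>2) \<le> (\<Sum>i\<in>(UNIV :: 'n set). (1 / L)\<^sup>2)" by (intro sum_mono)
    then have "(norm (x - y))\<^sup>2 \<le> (sqrt CARD('n) / L)\<^sup>2"
      by (simp add: power2_norm_eq_inner inner_vec_def power_divide power2_eq_square[symmetric])
    then show ?thesis by (rule power2_le_imp_le) (use L in simp)
  qed
  ultimately show ?thesis by blast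
qed

lemma anorm_le:
  assumes "posdef A"
  shows "anorm A x \<le> sqrt (eigval A 1) * norm x"
proof -
  have "anorm A x \<le> sqrt (eigval A 1 * (x \<bullet> x))"
    unfolding anorm_def using eigval_max[OF posdef_symmetric[OF assms]] by (rule real_sqrt_le_mono)
  then show ?thesis by (simp add: real_sqrt_mult norm_eq_sqrt_inner)
qed

text \<open>The ideal test vector is \<open>y\<close>, the multiple of
  \<open>matrix_inv G *v S\<close> with \<open>anorm G y = \<kappa>\<close>. \<open>L\<close> makes
  the mesh so fine that rounding costs at most \<open>1 / \<sigma>\<close> in this norm, whence the
  penalty \<open>\<sigma>^2 * \<kappa>^2 + 1\<close>; and \<open>norm y \<le> \<kappa>\<close>,
  because the Gram matrix dominates the identity, keeps the rounded vector within the grid.\<close>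

lemma (in bounded_path) inorm_witness:
  fixes S :: "real^'n"
  assumes t: "t \<le> T" and \<sigma>: "0 < \<sigma>" and \<kappa>: "0 \<le> \<kappa>" and S: "S \<noteq> 0"
  defines "L \<equiv> \<sigma> * sqrt (real CARD('n) * (real CARD('n) + T))"
  shows "\<exists>z\<in>grid L \<lceil>L * \<kappa>\<rceil>. \<kappa> * inorm (gram x t) S - \<sigma>\<^sup>2 * \<kappa>\<^sup>2 - 1
    \<le> z \<bullet> S - \<sigma>\<^sup>2 / 2 * (\<Sum>s=1..t. (z \<bullet> x s)\<^sup>2)"
proof -
  define G where "G = gram x t"
  have pd: "posdef G" unfolding G_def by (rule gram_posdef)
  define N where "N = inorm G S"
  define D where "D = real CARD('n)"
  have D: "2 \<le> D" using dim2 by (simp add: D_def)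
  have L: "0 < L" using \<sigma> D by (simp add: L_def D_def[symmetric])
  have N: "0 < N"
  proof -
    have "matrix_inv G *v S \<noteq> 0" using S posdef_inv_cancel(1)[OF pd, of S] by auto
    then have "0 < (matrix_inv G *v S) \<bullet> (G *v (matrix_inv G *v S))" using pd unfolding posdef_def by blast
    then show ?thesis by (simp add: N_def inorm_def posdef_inv_cancel[OF pd] inner_commute)
  qed
  define y where "y = (\<kappa> / N) *\<^sub>R (matrix_inv G *v S)"
  have any: "anorm G y = \<kappa>"
    using N \<kappa> by (simp add: y_def anorm_scaleR anorm_inv[OF pd] N_def[symmetric])
  have yS: "y \<bullet> S = \<kappa> * N"
  proof -
    have "(matrix_inv G *v S) \<bullet> S = N * N"
      using inorm_square[OF pd, of S] by (simp add: N_def power2_eq_square inner_commute)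
    then show ?thesis using N by (simp add: y_def)
  qed
  have "1 * norm y \<le> sqrt (lmin x t) * norm y"
    using lmin_ge_1[of x t] by (intro mult_right_mono) auto
  also have "\<dots> \<le> \<kappa>" using anorm_ge[OF pd, of y] any by (simp add: G_def)
  finally have "norm y * L \<le> L * \<kappa>" using L by (simp add: mult.commute)
  from grid_rounding[OF L this, of S] obtain z where z: "z \<in> grid L \<lceil>L * \<kappa>\<rceil>"
    "y \<bullet> S \<le> z \<bullet> S" "norm (z - y) \<le> sqrt D / L" by (auto simp: D_def)
  have "anorm G (z - y) \<le> sqrt (eigval G 1) * norm (z - y)" by (rule anorm_le[OF pd])
  also have "\<dots> \<le> sqrt (D + T) * (sqrt D / L)"
    using eigval_top_le[OF t] t z(3) by (intro mult_mono) (auto simp: G_def D_def)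
  also have "\<dots> = 1 / \<sigma>"
  proof -
    have "L = \<sigma> * (sqrt D * sqrt (D + T))" unfolding L_def D_def by (simp only: real_sqrt_mult)
    moreover have "p * (q / (\<sigma> * (q * p))) = 1 / \<sigma>" if "0 < p" "0 < q" for p q
      using that \<sigma> by (simp add: field_simps)
    ultimately show ?thesis using D by simp
  qed
  finally have "anorm G z \<le> \<kappa> + 1 / \<sigma>"
    using anorm_triangle[OF pd, of y "z - y"] any by simp
  then have "(anorm G z)\<^sup>2 \<le> (\<kappa> + 1 / \<sigma>)\<^sup>2"
    using anorm_nonneg[OF pd] by (intro power_mono) auto
  also have "\<dots> \<le> 2 * \<kappa>\<^sup>2 + 2 / \<sigma>\<^sup>2"
  proof -
    have "0 \<le> (\<kappa> - 1 / \<sigma>)\<^sup>2" by simp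
    then show ?thesis by (simp add: power2_sum power2_diff power_divide)
  qed
  finally have az: "(anorm G z)\<^sup>2 \<le> 2 * \<kappa>\<^sup>2 + 2 / \<sigma>\<^sup>2" .
  have "(\<Sum>s=1..t. (z \<bullet> x s)\<^sup>2) \<le> (anorm G z)\<^sup>2"
    unfolding anorm_square[OF pd] unfolding G_def gram_quadratic_form by (simp add: inner_commute)
  then have "\<sigma>\<^sup>2 / 2 * (\<Sum>s=1..t. (z \<bullet> x s)\<^sup>2) \<le> \<sigma>\<^sup>2 / 2 * (2 * \<kappa>\<^sup>2 + 2 / \<sigma>\<^sup>2)"
    using az by (intro mult_left_mono) auto
  also have "\<dots> = \<sigma>\<^sup>2 * \<kappa>\<^sup>2 + 1" using \<sigma> by (simp add: field_simps)
  finally show ?thesis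
    using z yS by (intro bexI[of _ z]) (auto simp: N_def G_def)
qed

lemma gram_minus_id: "(\<Sum>s=1..t. (x s \<bullet> y) *\<^sub>R x s) = gram x t *v y - y"
  by (simp add: gram_mult)

text \<open>The regulariser biases the estimator by the image of \<open>- \<theta>\<close>, the
  source of the additive 1 in the confidence radius.\<close>

lemma ridge_error:
  "ridge x (\<lambda>s. x s \<bullet> \<theta> + e s) t - \<theta> = matrix_inv (gram x t) *v ((\<Sum>s=1..t. e s *\<^sub>R x s) - \<theta>)"
proof -
  have "(\<Sum>s=1..t. (x s \<bullet> \<theta> + e s) *\<^sub>R x s) = gram x t *v \<theta> + ((\<Sum>s=1..t. e s *\<^sub>R x s) - \<theta>)"
    using gram_minus_id[of x \<theta> t] by (simp add: scaleR_add_left sum.distrib algebra_simps)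
  then show ?thesis
    unfolding ridge_def by (simp add: matrix_vector_right_distrib posdef_inv_cancel[OF gram_posdef])
qed

lemma ridge_error_anorm_le:
  "anorm (gram x t) (ridge x (\<lambda>s. x s \<bullet> \<theta> + e s) t - \<theta>)
    \<le> inorm (gram x t) (\<Sum>s=1..t. e s *\<^sub>R x s) + norm \<theta>"
proof -
  have "inorm (gram x t) (- \<theta>) \<le> norm (- \<theta>) / sqrt (lmin x t)" by (rule inorm_le[OF gram_posdef])
  also have "\<dots> \<le> norm \<theta> / 1" using lmin_ge_1[of x t] by (intro frac_le) auto
  finally show ?thesis
    unfolding ridge_error anorm_inv[OF gram_posdef]
    using inorm_triangle[OF gram_posdef, of x t "\<Sum>s=1..t. e s *\<^sub>R x s" "- \<theta>"] by simp
qed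

context linucb
begin

lemma exp_process_eq:
  "exp_process x t \<omega> = exp (x \<bullet> (\<Sum>s=1..t. \<epsilon> s \<omega> *\<^sub>R a s \<omega>) - \<sigma>\<^sup>2 / 2 * (\<Sum>s=1..t. (x \<bullet> a s \<omega>)\<^sup>2))"
  unfolding exp_process_def
  by (simp add: sum_subtractf inner_sum_right sum_distrib_left mult.commute)

lemma action_norm_le: "t \<in> {1..T} \<Longrightarrow> \<omega> \<in> space M \<Longrightarrow> norm (a t \<omega>) \<le> 1"
  using action_argmax[of t \<omega>] by (simp add: is_arg_max_def)

text \<open>Union bound over the rounds and a grid of test vectors \<open>x\<close> of polynomial size in \<open>T\<close>.\<close>

lemma confidence_event:
  assumes dim2: "2 \<le> CARD('n)" and \<sigma>: "0 < \<sigma>" and T: "2 \<le> T"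
    and q: "exp 1 * (4 * \<sigma> * real CARD('n) + 3) ^ CARD('n) < 2 ^ q"
  shows "\<exists>E\<in>sets M. 1 - 1 / real T < measure M E \<and> (\<forall>\<omega>\<in>E. \<forall>t<T.
    anorm (gram (\<lambda>s. a s \<omega>) t) (ridge (\<lambda>s. a s \<omega>) (\<lambda>s. reward \<theta> a \<epsilon> s \<omega>) t - \<theta>)
      \<le> (\<sigma>\<^sup>2 + CARD('n) + 2 + q) * sqrt (ln T) + 1)"
proof -
  define d where "d = CARD('n)"
  define \<kappa> where "\<kappa> = sqrt (ln T)"
  define L where "L = \<sigma> * sqrt (real d * (real d + T))"
  \<comment> \<open>Of the power of \<open>T\<close> in \<open>exp (- u)\<close>, \<open>d\<close>
    pays for the grid, one for the number of rounds and one for the final \<open>1 / T\<close>; the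
    constants are beaten by \<open>2 ^ q \<le> T ^ q\<close>. The \<open>- 1\<close> cancels the
    loss of 1 in \<open>inorm_witness\<close>.\<close>
  define u where "u = real (d + 2 + q) * ln T - 1"
  have d: "2 \<le> real d" using dim2 by (simp add: d_def)
  have lnT: "0 < ln (real T)" using T by simp
  have \<kappa>: "0 < \<kappa>" "\<kappa>\<^sup>2 = ln T" using lnT by (auto simp: \<kappa>_def)
  have L: "0 < L" using \<sigma> d by (simp add: L_def add_pos_nonneg)
  define \<Gamma> where "\<Gamma> = (grid L \<lceil>L * \<kappa>\<rceil> :: (real^'n) set)"
  define bad where "bad t x = {\<omega> \<in> space M. exp u \<le> exp_process x t \<omega>}" for t and x :: "real^'n"
  define B where "B = (\<Union>(t, x)\<in>{..<T} \<times> \<Gamma>. bad t x)"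
  have fin: "finite ({..<T} \<times> \<Gamma>)" by (simp add: \<Gamma>_def finite_grid)
  have Bm: "bad t x \<in> sets M" if "t < T" for t x
    unfolding bad_def using that by (intro exp_process_tail(1)) auto
  then have BM: "B \<in> sets M" unfolding B_def by (intro sets.finite_UN[OF fin]) auto
  have "measure M B \<le> (\<Sum>(t, x)\<in>{..<T} \<times> \<Gamma>. measure M (bad t x))"
    unfolding B_def using fin Bm
    by (intro order_trans[OF measure_UNION_le]) (auto simp: case_prod_unfold)
  also have "\<dots> \<le> (\<Sum>(t, x)\<in>{..<T} \<times> \<Gamma>. exp (- u))"
    unfolding bad_def by (intro sum_mono) (auto intro!: exp_process_tail(2))
  also have "\<dots> = real T * real (card \<Gamma>) * exp (- u)"
    by (simp add: case_prod_unfold card_cartesian_product)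
  also have "\<dots> < 1 / T"
  proof -
    have LkT: "L * \<kappa> \<le> 2 * \<sigma> * d * T - 0"
    proof -
      have "real d * 1 \<le> real d * T" "1 * real T \<le> real d * T"
        using d T by (intro mult_left_mono mult_right_mono; simp)+
      then have "real d + T \<le> 4 * (d * T)" by simp
      then have "real d * (real d + T) \<le> real d * (4 * (d * T))" by (intro mult_left_mono) auto
      then have "sqrt (real d * (real d + T)) \<le> sqrt (real d * (4 * (d * T)))" by simp
      also have "\<dots> = 2 * real d * sqrt T" by (simp add: real_sqrt_mult)
      finally have "L \<le> \<sigma> * (2 * real d * sqrt T)" unfolding L_def using \<sigma> by (intro mult_left_mono) auto
      moreover have "\<kappa> \<le> sqrt T"
      proof -
        have "ln (real T) \<le> T" using ln_le_minus_one[of "real T"] T by simp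
        then show ?thesis by (simp add: \<kappa>_def)
      qed
      ultimately have "L * \<kappa> \<le> \<sigma> * (2 * real d * sqrt T) * sqrt T"
        using L \<kappa> \<sigma> by (intro mult_mono) auto
      also have "\<dots> = 2 * \<sigma> * d * (sqrt T * sqrt T)" by (simp only: mult_ac)
      finally show ?thesis by simp
    qed
    have R0: "0 \<le> \<lceil>L * \<kappa>\<rceil>" using L \<kappa> by (simp add: ceiling_le_iff less_eq_real_def) (smt (verit) mult_pos_pos)
    have "2 * real_of_int \<lceil>L * \<kappa>\<rceil> + 1 \<le> 2 * (L * \<kappa>) + 3" using of_int_ceiling_le_add_one[of "L * \<kappa>"] by linarith
    also have "\<dots> \<le> (4 * \<sigma> * d + 3) * T" using LkT T by (simp add: algebra_simps)
    finally have "(2 * real_of_int \<lceil>L * \<kappa>\<rceil> + 1) ^ d \<le> ((4 * \<sigma> * d + 3) * T) ^ d"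
      using R0 by (intro power_mono) auto
    then have "real (card \<Gamma>) \<le> ((4 * \<sigma> * d + 3) * T) ^ d"
      using card_grid_le[OF R0, where ?'n = 'n, of L] unfolding \<Gamma>_def d_def by linarith
    then have c: "real (card \<Gamma>) \<le> (4 * \<sigma> * d + 3) ^ d * real T ^ d" by (simp add: power_mult_distrib)
    have e: "exp (- u) = exp 1 / real T ^ (d + 2 + q)"
    proof -
      have "exp (- u) = exp 1 / exp (real (d + 2 + q) * ln T)" by (simp add: u_def exp_diff)
      also have "exp (real (d + 2 + q) * ln T) = real T ^ (d + 2 + q)"
        using T by (simp only: exp_of_nat_mult) simp
      finally show ?thesis .
    qed
    have "real T * real (card \<Gamma>) * exp (- u) \<le> T * ((4 * \<sigma> * d + 3) ^ d * real T ^ d) * (exp 1 / real T ^ (d + 2 + q))"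
      unfolding e by (intro mult_right_mono mult_left_mono c) auto
    also have "\<dots> = exp 1 * (4 * \<sigma> * d + 3) ^ d / (T * real T ^ q)"
    proof -
      have "p * (c * r) * (b / (r * (p * p) * s)) = b * c / (p * s)"
        if "0 < p" "0 < r" "0 < s" for p c r b s :: real
        using that by (simp add: field_simps)
      moreover have "real T ^ (d + 2 + q) = real T ^ d * (real T * real T) * real T ^ q"
        by (simp only: power_add power2_eq_square)
      ultimately show ?thesis using T by simp
    qed
    also have "\<dots> < 2 ^ q / (T * real T ^ q)"
      using q T by (intro divide_strict_right_mono) (auto simp: d_def)
    also have "\<dots> \<le> real T ^ q / (T * real T ^ q)"
      using T by (intro divide_right_mono power_mono) auto
    also have "\<dots> = 1 / T" using T by simp
    finally show ?thesis .
  qed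
  finally have PB: "measure M B < 1 / T" .
  have "measure M (space M - B) = 1 - measure M B" using BM by (rule prob_compl)
  then have "1 - 1 / real T < measure M (space M - B)" using PB by simp
  moreover have "\<forall>\<omega>\<in>space M - B. \<forall>t<T.
    anorm (gram (\<lambda>s. a s \<omega>) t) (ridge (\<lambda>s. a s \<omega>) (\<lambda>s. reward \<theta> a \<epsilon> s \<omega>) t - \<theta>)
      \<le> (\<sigma>\<^sup>2 + CARD('n) + 2 + q) * sqrt (ln T) + 1"
  proof (intro ballI allI impI)
    fix \<omega> t assume \<omega>: "\<omega> \<in> space M - B" and t: "t < T"
    define x where "x = (\<lambda>s. a s \<omega>)"
    define S where "S = (\<Sum>s=1..t. \<epsilon> s \<omega> *\<^sub>R x s)"
    interpret bounded_path x T
      using dim2 action_norm_le \<omega> by unfold_locales (auto simp: x_def)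
    have "inorm (gram x t) S \<le> (\<sigma>\<^sup>2 + d + 2 + q) * \<kappa>"
    proof (cases "S = 0")
      case True
      then show ?thesis using \<kappa> by (simp add: inorm_def)
    next
      case False
      obtain z where z: "z \<in> \<Gamma>" "\<kappa> * inorm (gram x t) S - \<sigma>\<^sup>2 * \<kappa>\<^sup>2 - 1
          \<le> z \<bullet> S - \<sigma>\<^sup>2 / 2 * (\<Sum>s=1..t. (z \<bullet> x s)\<^sup>2)"
        using inorm_witness[OF less_imp_le[OF t] \<sigma> less_imp_le[OF \<kappa>(1)] False]
        unfolding \<Gamma>_def L_def d_def by blast
      have "\<omega> \<notin> bad t z" using \<omega> t z(1) by (auto simp: B_def)
      then have "exp_process z t \<omega> < exp u" using \<omega> by (simp add: bad_def not_le)
      then have "z \<bullet> S - \<sigma>\<^sup>2 / 2 * (\<Sum>s=1..t. (z \<bullet> x s)\<^sup>2) < u"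
        unfolding exp_process_eq S_def x_def by (simp only: exp_less_cancel_iff)
      then have "\<kappa> * inorm (gram x t) S < \<sigma>\<^sup>2 * \<kappa>\<^sup>2 + real (d + 2 + q) * \<kappa>\<^sup>2"
        using z(2) unfolding u_def \<kappa>(2)[symmetric] by linarith
      also have "\<dots> = \<kappa> * ((\<sigma>\<^sup>2 + d + 2 + q) * \<kappa>)" by (simp add: power2_eq_square algebra_simps)
      finally show ?thesis using \<kappa>(1) by (simp only: mult_less_cancel_left_pos)
    qed
    moreover have "ridge (\<lambda>s. a s \<omega>) (\<lambda>s. reward \<theta> a \<epsilon> s \<omega>) t = ridge x (\<lambda>s. x s \<bullet> \<theta> + \<epsilon> s \<omega>) t"
      by (simp add: x_def reward_def)
    ultimately show "anorm (gram (\<lambda>s. a s \<omega>) t) (ridge (\<lambda>s. a s \<omega>) (\<lambda>s. reward \<theta> a \<epsilon> s \<omega>) t - \<theta>)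
      \<le> (\<sigma>\<^sup>2 + CARD('n) + 2 + q) * sqrt (ln T) + 1"
      using ridge_error_anorm_le[of x t \<theta> "\<lambda>s. \<epsilon> s \<omega>"] norm_theta
      by (simp add: x_def[symmetric] S_def \<kappa>_def d_def)
  qed
  ultimately show ?thesis using BM by blast
qed

end

section \<open>Runs with Rademacher noise\<close>

text \<open>Sub-Gaussianity of a fair sign, obtained from the inequality behind Hoeffding's lemma at
  weight one half.\<close>

lemma cosh_le_exp_half_square: "cosh x \<le> exp (x\<^sup>2 / 2)" for x :: real
proof -
  have main: "cosh x \<le> exp (x\<^sup>2 / 2)" if x: "0 \<le> x" for x :: real
  proof -
    have "- (2 * x) * (1 / 2) + ln (1 + 1 / 2 * (exp (2 * x) - 1)) \<le> (2 * x)\<^sup>2 / 8"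
      using Hoeffdings_lemma_aux[of "2 * x" "1 / 2"] x by simp
    then have "ln ((1 + exp (2 * x)) / 2) \<le> x + x\<^sup>2 / 2" by (simp add: field_simps power2_eq_square)
    then have "exp (ln ((1 + exp (2 * x)) / 2)) \<le> exp (x + x\<^sup>2 / 2)" by simp
    then have "(1 + exp (2 * x)) / 2 \<le> exp x * exp (x\<^sup>2 / 2)"
      by (simp add: exp_add add_pos_pos)
    moreover have "(1 + exp (2 * x)) / 2 = exp x * cosh x"
    proof -
      have "exp (2 * x) = exp x * exp x" using exp_add[of x x] by (simp only: mult_2)
      moreover have "exp x * exp (- x) = 1" by (simp add: exp_minus)
      ultimately show ?thesis by (simp add: cosh_field_def distrib_left)
    qed
    ultimately show ?thesis by simp
  qed
  show ?thesis using main[of x] main[of "- x"] by (cases "0 \<le> x") auto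
qed

text \<open>The default \<open>- \<theta>\<close>, taken in particular at time 0, is the initial estimator for which optimism
  forces \<open>\<beta> \<ge> 2\<close>.\<close>

definition est :: "real^'n \<Rightarrow> (nat \<Rightarrow> real^'n) \<Rightarrow> (nat \<Rightarrow> real) \<Rightarrow> nat \<Rightarrow> real^'n" where
  "est \<theta> x e t = (let r = ridge x (\<lambda>s. x s \<bullet> \<theta> + e s) t in if r = 0 then - \<theta> else r /\<^sub>R norm r)"

text \<open>The state is the whole sequence of earlier actions, because each action depends on all
  of them. Ties are broken by a fixed choice, so that an action is a function of the earlier
  noise.\<close>

primrec traj :: "real \<Rightarrow> real^'n \<Rightarrow> (nat \<Rightarrow> real) \<Rightarrow> nat \<Rightarrow> nat \<Rightarrow> real^'n" where
  "traj \<beta> \<theta> e 0 = (\<lambda>_. 0)"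
| "traj \<beta> \<theta> e (Suc n) = (traj \<beta> \<theta> e n)(Suc n :=
    (SOME b. is_arg_max (ucb \<beta> (traj \<beta> \<theta> e n) (est \<theta> (traj \<beta> \<theta> e n) e) (Suc n)) (\<lambda>b. b \<in> cball 0 1) b))"

definition acts :: "real \<Rightarrow> real^'n \<Rightarrow> (nat \<Rightarrow> real) \<Rightarrow> nat \<Rightarrow> real^'n" where
  "acts \<beta> \<theta> e t = traj \<beta> \<theta> e t t"

lemma norm_est: "norm \<theta> = 1 \<Longrightarrow> norm (est \<theta> x e t) = 1"
  by (simp add: est_def Let_def)

lemma est_0: "est \<theta> x e 0 = - \<theta>"
  by (simp add: est_def ridge_def)

lemma ridge_cong:
  assumes "\<And>s. s \<in> {1..t} \<Longrightarrow> x s = x' s" "\<And>s. s \<in> {1..t} \<Longrightarrow> y s = y' s"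
  shows "ridge x y t = ridge x' y' t"
proof -
  have "gram x t = gram x' t" using assms(1) by (rule gram_cong)
  moreover have "(\<Sum>s=1..t. y s *\<^sub>R x s) = (\<Sum>s=1..t. y' s *\<^sub>R x' s)"
    using assms by (intro sum.cong) auto
  ultimately show ?thesis by (simp only: ridge_def)
qed

lemma est_cong:
  assumes "\<And>s. s \<in> {1..t} \<Longrightarrow> x s = x' s" "\<And>s. s \<in> {1..t} \<Longrightarrow> e s = e' s"
  shows "est \<theta> x e t = est \<theta> x' e' t"
proof -
  have "ridge x (\<lambda>s. x s \<bullet> \<theta> + e s) t = ridge x' (\<lambda>s. x' s \<bullet> \<theta> + e' s) t"
    using assms by (intro ridge_cong) auto
  then show ?thesis by (simp only: est_def)
qed

lemma ucb_cong:
  assumes "\<And>s. s \<in> {1..t - 1} \<Longrightarrow> x s = x' s" "h (t - 1) = h' (t - 1)"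
  shows "ucb \<beta> x h t = ucb \<beta> x' h' t"
  using gram_cong[OF assms(1)] assms(2) by (intro ext) (simp add: ucb_def)

lemma traj_eq_acts: "s \<le> n \<Longrightarrow> traj \<beta> \<theta> e n s = acts \<beta> \<theta> e s"
proof (induction n)
  case (Suc n)
  then show ?case by (cases "s = Suc n") (auto simp: acts_def)
qed (simp add: acts_def)

lemma traj_cong:
  "(\<And>s. s \<in> {1..<n} \<Longrightarrow> e s = e' s) \<Longrightarrow> traj \<beta> \<theta> e n = traj \<beta> \<theta> e' n"
proof (induction n)
  case (Suc n)
  have IH: "traj \<beta> \<theta> e n = traj \<beta> \<theta> e' n" using Suc by auto
  have "est \<theta> (traj \<beta> \<theta> e n) e n = est \<theta> (traj \<beta> \<theta> e' n) e' n"
    unfolding IH using Suc.prems by (intro est_cong) auto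
  then have "ucb \<beta> (traj \<beta> \<theta> e n) (est \<theta> (traj \<beta> \<theta> e n) e) (Suc n)
      = ucb \<beta> (traj \<beta> \<theta> e' n) (est \<theta> (traj \<beta> \<theta> e' n) e') (Suc n)"
    by (intro ucb_cong) (auto simp: IH)
  then show ?case using IH by simp
qed simp

text \<open>Predictability in deterministic form: the action of round \<open>t\<close> sees only the
  noise strictly before \<open>t\<close>.\<close>

lemma acts_cong: "(\<And>s. s \<in> {1..<t} \<Longrightarrow> e s = e' s) \<Longrightarrow> acts \<beta> \<theta> e t = acts \<beta> \<theta> e' t"
  unfolding acts_def by (rule fun_cong[OF traj_cong])

lemma ucb_argmax_exists: "\<exists>b. is_arg_max (ucb \<beta> x h t) (\<lambda>b. b \<in> cball 0 1) b"
proof -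
  have "continuous_on (cball 0 1) (ucb \<beta> x h t)"
    unfolding ucb_def by (intro continuous_intros matrix_vector_mult_linear_continuous_on)
  then obtain b where "b \<in> cball 0 1" "\<And>c. c \<in> cball 0 1 \<Longrightarrow> ucb \<beta> x h t c \<le> ucb \<beta> x h t b"
    using continuous_attains_sup[of "cball 0 1" "ucb \<beta> x h t"] by auto
  then show ?thesis by (intro exI[of _ b]) (auto simp: is_arg_max_def not_less)
qed

lemma acts_argmax:
  assumes "1 \<le> t"
  shows "is_arg_max (ucb \<beta> (acts \<beta> \<theta> e) (est \<theta> (acts \<beta> \<theta> e) e) t) (\<lambda>b. b \<in> cball 0 1) (acts \<beta> \<theta> e t)"
proof -
  obtain n where n: "t = Suc n" using assms by (cases t) auto
  let ?u = "ucb \<beta> (traj \<beta> \<theta> e n) (est \<theta> (traj \<beta> \<theta> e n) e) (Suc n)"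
  have "est \<theta> (traj \<beta> \<theta> e n) e n = est \<theta> (acts \<beta> \<theta> e) e n"
    by (intro est_cong) (auto simp: traj_eq_acts)
  then have u: "?u = ucb \<beta> (acts \<beta> \<theta> e) (est \<theta> (acts \<beta> \<theta> e) e) (Suc n)"
    by (intro ucb_cong) (auto simp: traj_eq_acts)
  have "acts \<beta> \<theta> e t = (SOME b. is_arg_max ?u (\<lambda>b. b \<in> cball 0 1) b)"
    by (simp add: acts_def n)
  then have "is_arg_max ?u (\<lambda>b. b \<in> cball 0 1) (acts \<beta> \<theta> e t)"
    using someI_ex[OF ucb_argmax_exists[of \<beta> "traj \<beta> \<theta> e n" "est \<theta> (traj \<beta> \<theta> e n) e" "Suc n"]] by simp
  then show ?thesis unfolding u n .
qed

lemma acts_ucb_path: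
  fixes \<theta> :: "real^'n"
  assumes "2 \<le> CARD('n)" "1 \<le> \<beta>" "norm \<theta> = 1"
  shows "ucb_path \<beta> T (acts \<beta> \<theta> e) (est \<theta> (acts \<beta> \<theta> e) e)"
  using assms acts_argmax[of _ \<beta> \<theta> e] norm_est by unfold_locales auto

text \<open>Independent fair signs have to live on points of a prescribed type of outcomes:
  \<open>pick\<close> encodes the set of rounds with positive noise as an outcome, and the uniform
  measure on the \<open>2 ^ T\<close> codes makes the signs independent.\<close>

locale sign_space =
  fixes pick :: "nat set \<Rightarrow> 'w" and T :: nat and \<sigma> \<beta> :: real and \<theta> :: "real^'n"
  assumes inj_pick: "inj_on pick (Pow {1..T})" and \<sigma>_pos: "0 < \<sigma>" and norm_theta: "norm \<theta> = 1"
begin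

definition \<Omega> :: "'w set" where "\<Omega> = pick ` Pow {1..T}"

definition pos :: "'w \<Rightarrow> nat set" where "pos = the_inv_into (Pow {1..T}) pick"

definition noise :: "nat \<Rightarrow> 'w \<Rightarrow> real" where "noise t \<omega> = (if t \<in> pos \<omega> then \<sigma> else - \<sigma>)"

definition action :: "nat \<Rightarrow> 'w \<Rightarrow> real^'n" where "action t \<omega> = acts \<beta> \<theta> (\<lambda>s. noise s \<omega>) t"

definition hat :: "nat \<Rightarrow> 'w \<Rightarrow> real^'n" where
  "hat t \<omega> = est \<theta> (\<lambda>s. action s \<omega>) (\<lambda>s. noise s \<omega>) t"

definition P :: "'w measure" where "P = uniform_count_measure \<Omega>"

abbreviation past :: "nat \<Rightarrow> 'w measure" where
  "past t \<equiv> history P action (reward \<theta> action noise) t"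

lemma finite_\<Omega>: "finite \<Omega>" and \<Omega>_nonempty: "\<Omega> \<noteq> {}"
  by (auto simp: \<Omega>_def)

lemma card_\<Omega>: "card \<Omega> = 2 ^ T"
  unfolding \<Omega>_def card_image[OF inj_pick] by (simp add: card_Pow)

lemma pos_pick: "A \<subseteq> {1..T} \<Longrightarrow> pos (pick A) = A"
  unfolding pos_def by (rule the_inv_into_f_f[OF inj_pick]) simp

lemma pos_subset: "\<omega> \<in> \<Omega> \<Longrightarrow> pos \<omega> \<subseteq> {1..T}"
  unfolding \<Omega>_def by (erule imageE) (simp only: pos_pick Pow_iff)

lemma pick_pos: "\<omega> \<in> \<Omega> \<Longrightarrow> pick (pos \<omega>) = \<omega>"
  unfolding \<Omega>_def by (erule imageE) (simp only: pos_pick Pow_iff)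

lemma space_P [simp]: "space P = \<Omega>"
  by (simp add: P_def space_uniform_count_measure)

lemma sets_P [simp]: "sets P = Pow \<Omega>"
  by (simp add: P_def sets_uniform_count_measure)

lemma measurable_P: "f \<in> borel_measurable P"
  by (intro measurableI) auto

lemma integrable_P: "integrable P (f :: 'w \<Rightarrow> real)"
  unfolding P_def uniform_count_measure_def by (rule integrable_point_measure_finite[OF finite_\<Omega>])

lemma measure_P: "A \<subseteq> \<Omega> \<Longrightarrow> measure P A = card A / 2 ^ T"
  unfolding P_def by (subst measure_uniform_count_measure[OF finite_\<Omega>]) (simp_all add: card_\<Omega>)

lemma prob_space_P: "prob_space P"
  unfolding P_def by (rule prob_space_uniform_count_measure[OF finite_\<Omega> \<Omega>_nonempty])

definition agree :: "nat \<Rightarrow> 'w \<Rightarrow> 'w \<Rightarrow> bool" where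
  "agree t \<omega> \<omega>' \<longleftrightarrow> pos \<omega> \<inter> {1..t} = pos \<omega>' \<inter> {1..t}"

lemma agree_noise: "agree t \<omega> \<omega>' \<Longrightarrow> s \<in> {1..t} \<Longrightarrow> noise s \<omega> = noise s \<omega>'"
proof -
  assume "agree t \<omega> \<omega>'" "s \<in> {1..t}"
  then have "s \<in> pos \<omega> \<longleftrightarrow> s \<in> pos \<omega>'" unfolding agree_def by blast
  then show "noise s \<omega> = noise s \<omega>'" by (simp add: noise_def)
qed

lemma agree_action: "agree t \<omega> \<omega>' \<Longrightarrow> s \<le> Suc t \<Longrightarrow> action s \<omega> = action s \<omega>'"
proof -
  assume a: "agree t \<omega> \<omega>'" and s: "s \<le> Suc t"
  show "action s \<omega> = action s \<omega>'"
    unfolding action_def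
  proof (rule acts_cong)
    fix i assume "i \<in> {1..<s}"
    then have "i \<in> {1..t}" using s by auto
    then show "noise i \<omega> = noise i \<omega>'" by (rule agree_noise[OF a])
  qed
qed

lemma agree_hat: "agree t \<omega> \<omega>' \<Longrightarrow> hat t \<omega> = hat t \<omega>'"
proof -
  assume a: "agree t \<omega> \<omega>'"
  show "hat t \<omega> = hat t \<omega>'"
    unfolding hat_def
    by (rule est_cong) (simp_all add: agree_noise[OF a] agree_action[OF a])
qed

text \<open>Actions and rewards up to round \<open>t\<close> are functions of the first
  \<open>t\<close> signs, so no event they generate separates outcomes that agree on these.\<close>

lemma sets_past_agree:
  assumes "A \<in> sets (past t)"
  shows "A \<subseteq> \<Omega> \<and> (\<forall>\<omega>\<in>\<Omega>. \<forall>\<omega>'\<in>\<Omega>. agree t \<omega> \<omega>' \<longrightarrow> (\<omega> \<in> A \<longleftrightarrow> \<omega>' \<in> A))"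
  using assms unfolding sets_history space_P
proof (induction rule: sigma_sets.induct)
  case (Basic A)
  then obtain s B where s: "s \<in> {1..t}" and A: "A = (\<lambda>\<omega>. (action s \<omega>, reward \<theta> action noise s \<omega>)) -` B \<inter> \<Omega>"
    by blast
  have "(action s \<omega>, reward \<theta> action noise s \<omega>) = (action s \<omega>', reward \<theta> action noise s \<omega>')"
    if "agree t \<omega> \<omega>'" for \<omega> \<omega>'
    using agree_action[OF that, of s] agree_noise[OF that s] s by (simp add: reward_def)
  then show ?case unfolding A by auto
qed auto

text \<open>Converse of \<open>sets_past_agree\<close>: reward minus its mean recovers the noise, so
  the history determines the first \<open>t\<close> signs and every function of them is
  measurable.\<close>

lemma measurable_past:
  fixes g :: "'w \<Rightarrow> 'b::topological_space"
  assumes g: "\<And>\<omega> \<omega>'. agree t \<omega> \<omega>' \<Longrightarrow> g \<omega> = g \<omega>'"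
  shows "g \<in> borel_measurable (past t)"
proof -
  let ?S = "\<lambda>\<omega>. pos \<omega> \<inter> {1..t}"
  have atom: "?S -` {A} \<inter> space (past t) \<in> sets (past t)" if "A \<in> Pow {1..t}" for A
  proof -
    have m: "{\<omega> \<in> space (past t). 0 < noise s \<omega>} \<in> sets (past t)" if "s \<in> {1..t}" for s
      using noise_measurable_history[OF that, of noise P action \<theta>] by measurable
    have "{\<omega> \<in> space (past t). s \<in> pos \<omega> \<longleftrightarrow> s \<in> A} \<in> sets (past t)" if "s \<in> {1..t}" for s
    proof -
      have m: "{\<omega> \<in> space (past t). 0 < noise s \<omega>} \<in> sets (past t)" by (rule m[OF that])
      have e: "0 < noise s \<omega> \<longleftrightarrow> s \<in> pos \<omega>" for \<omega> using \<sigma>_pos by (simp add: noise_def)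
      show ?thesis
      proof (cases "s \<in> A")
        case True
        then show ?thesis using m by (simp add: e)
      next
        case False
        have "space (past t) - {\<omega> \<in> space (past t). 0 < noise s \<omega>} \<in> sets (past t)"
          using m by (rule sets.compl_sets)
        moreover have "space (past t) - {\<omega> \<in> space (past t). 0 < noise s \<omega>}
            = {\<omega> \<in> space (past t). s \<in> pos \<omega> \<longleftrightarrow> s \<in> A}" using False by (auto simp: e)
        ultimately show ?thesis by simp
      qed
    qed
    then have "{\<omega> \<in> space (past t). \<forall>s\<in>{1..t}. s \<in> pos \<omega> \<longleftrightarrow> s \<in> A} \<in> sets (past t)"
      by (intro sets.sets_Collect_finite_All) auto
    moreover have "?S -` {A} \<inter> space (past t) = {\<omega> \<in> space (past t). \<forall>s\<in>{1..t}. s \<in> pos \<omega> \<longleftrightarrow> s \<in> A}"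
      using that by auto
    ultimately show ?thesis by simp
  qed
  have "?S \<in> measurable (past t) (count_space (Pow {1..t}))"
    using atom by (subst measurable_count_space_eq2) auto
  then have "(\<lambda>\<omega>. (\<lambda>A. g (SOME \<omega>'. ?S \<omega>' = A)) (?S \<omega>)) \<in> borel_measurable (past t)"
    by (rule measurable_compose) (simp add: measurable_count_space_eq1)
  moreover have "g (SOME \<omega>'. ?S \<omega>' = ?S \<omega>) = g \<omega>" for \<omega>
    by (rule g) (unfold agree_def, rule someI[of _ \<omega>], rule refl)
  ultimately show ?thesis by simp
qed

text \<open>Reversing the sign of round \<open>t\<close> is a measure-preserving involution of
  \<open>\<Omega>\<close> that fixes every event of the past before \<open>t\<close>; pairing each
  outcome with its image yields the conditional expectations given that past.\<close>

definition flip :: "nat \<Rightarrow> 'w \<Rightarrow> 'w" where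
  "flip t \<omega> = pick (if t \<in> pos \<omega> then pos \<omega> - {t} else insert t (pos \<omega>))"

lemma pos_flip:
  assumes "\<omega> \<in> \<Omega>" "t \<in> {1..T}"
  shows "pos (flip t \<omega>) = (if t \<in> pos \<omega> then pos \<omega> - {t} else insert t (pos \<omega>))"
  unfolding flip_def using pos_subset[OF assms(1)] assms(2) by (intro pos_pick) auto

lemma flip_in: "\<omega> \<in> \<Omega> \<Longrightarrow> t \<in> {1..T} \<Longrightarrow> flip t \<omega> \<in> \<Omega>"
  unfolding flip_def \<Omega>_def by (intro imageI) (use pos_subset[of \<omega>] in \<open>auto simp: \<Omega>_def\<close>)

lemma flip_flip: "\<omega> \<in> \<Omega> \<Longrightarrow> t \<in> {1..T} \<Longrightarrow> flip t (flip t \<omega>) = \<omega>"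
proof -
  assume \<omega>: "\<omega> \<in> \<Omega>" "t \<in> {1..T}"
  have "(if t \<in> pos (flip t \<omega>) then pos (flip t \<omega>) - {t} else insert t (pos (flip t \<omega>))) = pos \<omega>"
    unfolding pos_flip[OF \<omega>] by auto
  then show "flip t (flip t \<omega>) = \<omega>" using pick_pos[OF \<omega>(1)] unfolding flip_def[of t "flip t \<omega>"] by simp
qed

lemma noise_flip: "\<omega> \<in> \<Omega> \<Longrightarrow> t \<in> {1..T} \<Longrightarrow> noise t (flip t \<omega>) = - noise t \<omega>"
  by (simp add: noise_def pos_flip)

lemma agree_flip: "\<omega> \<in> \<Omega> \<Longrightarrow> t \<in> {1..T} \<Longrightarrow> agree (t - 1) \<omega> (flip t \<omega>)"
  unfolding agree_def by (auto simp: pos_flip)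

lemma integral_noise_past:
  assumes t: "t \<in> {1..T}" and A: "A \<in> sets (past (t - 1))"
  shows "(\<integral>\<omega>\<in>A. f (noise t \<omega>) \<partial>P) = (\<integral>\<omega>\<in>A. (f \<sigma> + f (- \<sigma>)) / (2::real) \<partial>P)"
proof -
  have A\<Omega>: "A \<subseteq> \<Omega>" and Ag: "\<And>\<omega> \<omega>'. \<omega> \<in> \<Omega> \<Longrightarrow> \<omega>' \<in> \<Omega> \<Longrightarrow> agree (t - 1) \<omega> \<omega>' \<Longrightarrow> (\<omega> \<in> A \<longleftrightarrow> \<omega>' \<in> A)"
    using sets_past_agree[OF A] by auto
  have flA: "flip t \<omega> \<in> A" if "\<omega> \<in> A" for \<omega>
    using that A\<Omega> Ag[OF _ flip_in agree_flip] t by blast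
  have int: "(\<integral>\<omega>\<in>A. g \<omega> \<partial>P) = (\<Sum>\<omega>\<in>A. g \<omega>) / 2 ^ T" for g :: "'w \<Rightarrow> real"
  proof -
    have "(\<integral>\<omega>\<in>A. g \<omega> \<partial>P) = (\<Sum>\<omega>\<in>\<Omega>. indicator A \<omega> * g \<omega>) / card \<Omega>"
      unfolding set_lebesgue_integral_def P_def by (simp add: integral_uniform_count_measure[OF finite_\<Omega>])
    also have "(\<Sum>\<omega>\<in>\<Omega>. indicator A \<omega> * g \<omega>) = (\<Sum>\<omega>\<in>A. g \<omega>)"
      using A\<Omega> finite_\<Omega> by (intro sum.mono_neutral_cong_right) auto
    finally show ?thesis by (simp add: card_\<Omega>)
  qed
  have "(\<Sum>\<omega>\<in>A. f (noise t \<omega>)) = (\<Sum>\<omega>\<in>A. f (- noise t \<omega>))"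
    using flA A\<Omega> t flip_flip noise_flip
    by (intro sum.reindex_bij_witness[of _ "flip t" "flip t"]) auto
  then have "2 * (\<Sum>\<omega>\<in>A. f (noise t \<omega>)) = (\<Sum>\<omega>\<in>A. f (noise t \<omega>) + f (- noise t \<omega>))"
    by (simp add: sum.distrib)
  also have "\<dots> = (\<Sum>\<omega>\<in>A. f \<sigma> + f (- \<sigma>))"
    by (intro sum.cong) (auto simp: noise_def)
  finally show ?thesis unfolding int by (simp add: field_simps)
qed

lemma subalgebra_past: "subalgebra P (past t)"
  using sets_past_agree by (auto simp: subalgebra_def)

lemma cond_exp_noise:
  assumes t: "t \<in> {1..T}"
  shows "AE \<omega> in P. real_cond_exp P (past (t - 1)) (\<lambda>\<omega>. f (noise t \<omega>)) \<omega> = (f \<sigma> + f (- \<sigma>)) / 2"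
proof -
  interpret prob_space P by (rule prob_space_P)
  interpret finite_measure_subalgebra P "past (t - 1)" by unfold_locales (rule subalgebra_past)
  show ?thesis by (rule real_cond_exp_charact) (auto simp: integral_noise_past[OF t] integrable_P)
qed

theorem linucb_signs: "linucb P \<sigma> \<beta> T \<theta> action noise hat"
proof -
  interpret prob_space P by (rule prob_space_P)
  have rw: "(\<lambda>s. reward \<theta> action noise s \<omega>) = (\<lambda>s. action s \<omega> \<bullet> \<theta> + noise s \<omega>)" for \<omega>
    by (simp add: reward_def)
  show ?thesis
  proof unfold_locales
    show "norm \<theta> = 1" by (rule norm_theta)
    fix t assume t: "t \<in> {1..T}"
    interpret finite_measure_subalgebra P "past (t - 1)" by unfold_locales (rule subalgebra_past)
    show "noise t \<in> borel_measurable P" by (rule measurable_P)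
    show "action t \<in> borel_measurable (past (t - 1))"
      using t by (intro measurable_past agree_action) auto
    show "integrable P (\<lambda>\<omega>. exp (l * noise t \<omega>))" for l by (rule integrable_P)
    have mean: "AE \<omega> in P. real_cond_exp P (past (t - 1)) (noise t) \<omega> = 0"
      using cond_exp_noise[OF t, of "\<lambda>x. x"] by simp
    then show "AE \<omega> in P. real_cond_exp P (past (t - 1)) (noise t) \<omega> = 0" .
    have "AE \<omega> in P. (noise t \<omega> - real_cond_exp P (past (t - 1)) (noise t) \<omega>)\<^sup>2 = (noise t \<omega>)\<^sup>2"
      using mean by eventually_elim simp
    from real_cond_exp_cong[OF this measurable_P measurable_P] cond_exp_noise[OF t, of "\<lambda>x. x\<^sup>2"]
    show "AE \<omega> in P. real_cond_exp P (past (t - 1))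
        (\<lambda>w. (noise t w - real_cond_exp P (past (t - 1)) (noise t) w)\<^sup>2) \<omega> = \<sigma>\<^sup>2"
      by eventually_elim simp
    show "AE \<omega> in P. real_cond_exp P (past (t - 1)) (\<lambda>w. exp (l * noise t w)) \<omega> \<le> exp (\<sigma>\<^sup>2 * l\<^sup>2 / 2)" for l
      using cond_exp_noise[OF t, of "\<lambda>x. exp (l * x)"]
    proof eventually_elim
      case (elim \<omega>)
      then have "real_cond_exp P (past (t - 1)) (\<lambda>w. exp (l * noise t w)) \<omega> = cosh (l * \<sigma>)"
        by (simp add: cosh_field_def)
      then show ?case using cosh_le_exp_half_square[of "l * \<sigma>"] by (simp add: power_mult_distrib mult.commute)
    qed
    fix \<omega>
    show "is_arg_max (ucb \<beta> (\<lambda>s. action s \<omega>) (\<lambda>s. hat s \<omega>) t) (\<lambda>b. b \<in> cball 0 1) (action t \<omega>)"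
      using acts_argmax[of t \<beta> \<theta> "\<lambda>s. noise s \<omega>"] t
      by (simp add: action_def hat_def)
  next
    fix t :: nat and \<omega>
    show "hat t \<in> borel_measurable (past t)" by (intro measurable_past agree_hat)
    show "norm (hat t \<omega>) = 1" unfolding hat_def by (rule norm_est[OF norm_theta])
    assume "ridge (\<lambda>s. action s \<omega>) (\<lambda>s. reward \<theta> action noise s \<omega>) t \<noteq> 0"
    then show "hat t \<omega> = ridge (\<lambda>s. action s \<omega>) (\<lambda>s. reward \<theta> action noise s \<omega>) t
        /\<^sub>R norm (ridge (\<lambda>s. action s \<omega>) (\<lambda>s. reward \<theta> action noise s \<omega>) t)"
      unfolding rw by (simp add: hat_def est_def Let_def)
  qed
qed

lemma prefix_measure_ge:
  assumes k: "k \<le> T" and A: "A \<subseteq> {1..k}"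
  shows "1 / 2 ^ k \<le> measure P {\<omega> \<in> \<Omega>. pos \<omega> \<inter> {1..k} = A}"
proof -
  let ?E = "{\<omega> \<in> \<Omega>. pos \<omega> \<inter> {1..k} = A}"
  have sub: "A \<union> B \<subseteq> {1..T}" if "B \<subseteq> {Suc k..T}" for B using that A k by auto
  have "(\<lambda>B. pick (A \<union> B)) ` Pow {Suc k..T} \<subseteq> ?E"
  proof
    fix \<omega> assume "\<omega> \<in> (\<lambda>B. pick (A \<union> B)) ` Pow {Suc k..T}"
    then obtain B where B: "B \<subseteq> {Suc k..T}" "\<omega> = pick (A \<union> B)" by auto
    have "(A \<union> B) \<inter> {1..k} = A" using A B(1) by auto
    then show "\<omega> \<in> ?E" using sub[OF B(1)] B(2) by (auto simp: \<Omega>_def pos_pick)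
  qed
  then have "card ((\<lambda>B. pick (A \<union> B)) ` Pow {Suc k..T}) \<le> card ?E"
    using finite_\<Omega> by (intro card_mono) auto
  moreover have "inj_on (\<lambda>B. pick (A \<union> B)) (Pow {Suc k..T})"
  proof (rule inj_onI)
    fix B C assume BC: "B \<in> Pow {Suc k..T}" "C \<in> Pow {Suc k..T}" "pick (A \<union> B) = pick (A \<union> C)"
    then have "A \<union> B = A \<union> C" using sub by (metis PowD pos_pick)
    moreover have "A \<inter> {Suc k..T} = {}" using A by auto
    then have "A \<inter> B = {}" "A \<inter> C = {}" using BC(1,2) by blast+
    ultimately show "B = C" by auto
  qed
  ultimately have "2 ^ (T - k) \<le> card ?E" by (simp add: card_image card_Pow)
  then have "(2 ^ (T - k) :: real) \<le> real (card ?E)" by (metis of_nat_le_iff of_nat_numeral of_nat_power)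
  then have "2 ^ (T - k) / 2 ^ T \<le> measure P ?E" by (subst measure_P) (auto intro: divide_right_mono)
  moreover have "(2 ^ T :: real) = 2 ^ k * 2 ^ (T - k)" using k by (simp add: power_add[symmetric])
  ultimately show ?thesis by simp
qed

end

section \<open>A lower bound on the exploration parameter\<close>

text \<open>The sign condition discards the cross term, and the remaining increase
  \<open>\<eta>^2 * q / (1 + q)\<close> is at most \<open>\<eta>^2 * ln (1 + q)\<close>. These
  logarithms are the ones that \<open>det_gram_window\<close> sums, so the squared norm of a
  greedily steered sum grows only logarithmically.\<close>

lemma inorm_rank_one_step:
  fixes A B :: "real^'n^'n"
  assumes pd: "posdef A" and pdB: "posdef B" and B: "\<And>x. B *v x = A *v x + (a \<bullet> x) *\<^sub>R a"
    and sgn: "\<eta> * (D \<bullet> (matrix_inv A *v a)) \<le> 0"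
  shows "(inorm B (D + \<eta> *\<^sub>R a))\<^sup>2 \<le> (inorm A D)\<^sup>2 + \<eta>\<^sup>2 * ln (1 + (inorm A a)\<^sup>2)"
proof -
  define u where "u = matrix_inv A *v a"
  define q where "q = (inorm A a)\<^sup>2"
  define v where "v = D \<bullet> u"
  have q0: "0 \<le> q" by (simp add: q_def)
  have au: "a \<bullet> u = q" by (simp add: q_def u_def inorm_square[OF pd])
  have aD: "a \<bullet> (matrix_inv A *v D) = v"
    using posdef_inv_swap[OF pd, of a D] by (simp add: v_def u_def inner_commute)
  let ?z = "D + \<eta> *\<^sub>R a"
  have zz: "?z \<bullet> (matrix_inv A *v ?z) = (inorm A D)\<^sup>2 + 2 * \<eta> * v + \<eta>\<^sup>2 * q"
    using aD au unfolding inorm_square[OF pd]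
    by (simp add: matrix_vector_right_distrib matrix_vector_mult_scaleR inner_add_left inner_add_right
        u_def[symmetric] v_def[symmetric] power2_eq_square algebra_simps)
  have uz: "u \<bullet> ?z = v + \<eta> * q"
    using au by (simp add: inner_add_right v_def inner_commute)
  have "(inorm B ?z)\<^sup>2 = ?z \<bullet> (matrix_inv A *v ?z) - (u \<bullet> ?z)\<^sup>2 / (1 + q)"
  proof -
    have "matrix_inv B *v ?z = matrix_inv A *v ?z - ((u \<bullet> ?z) / (1 + q)) *\<^sub>R u"
      using inv_rank_one_update[OF pd pdB B, of ?z] by (simp only: u_def q_def)
    then have "?z \<bullet> (matrix_inv B *v ?z) = ?z \<bullet> (matrix_inv A *v ?z) - (u \<bullet> ?z) / (1 + q) * (?z \<bullet> u)"
      by (simp only: inner_diff_right inner_scaleR_right)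
    then show ?thesis unfolding inorm_square[OF pdB] inner_commute[of ?z u] by (simp add: power2_eq_square)
  qed
  also have "\<dots> = (inorm A D)\<^sup>2 + (2 * \<eta> * v + \<eta>\<^sup>2 * q - v\<^sup>2) / (1 + q)"
    unfolding zz uz using q0 by (simp add: field_simps power2_eq_square)
  also have "\<dots> \<le> (inorm A D)\<^sup>2 + \<eta>\<^sup>2 * q / (1 + q)"
  proof -
    have "\<eta> * v \<le> 0" using sgn by (simp add: v_def u_def)
    then have "2 * \<eta> * v + \<eta>\<^sup>2 * q - v\<^sup>2 \<le> \<eta>\<^sup>2 * q" by (simp add: mult.assoc) (smt (verit) zero_le_power2)
    then show ?thesis using q0 by (intro add_left_mono divide_right_mono) auto
  qed
  also have "\<dots> \<le> (inorm A D)\<^sup>2 + \<eta>\<^sup>2 * ln (1 + q)"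
  proof -
    have "ln (1 / (1 + q)) \<le> 1 / (1 + q) - 1" using q0 by (intro ln_le_minus_one) auto
    then have "1 - 1 / (1 + q) \<le> ln (1 + q)" using q0 by (simp add: ln_div)
    moreover have "1 - 1 / (1 + q) = q / (1 + q)" using q0 by (simp add: field_simps)
    ultimately have "\<eta>\<^sup>2 * (q / (1 + q)) \<le> \<eta>\<^sup>2 * ln (1 + q)" by (intro mult_left_mono) auto
    then show ?thesis by simp
  qed
  finally show ?thesis by (simp add: q_def)
qed

text \<open>The signs are chosen greedily so that the accumulated noise tracks the drift \<open>x\<^sub>s \<bullet> \<delta>\<close>
  that a shift of the parameter by \<open>\<delta>\<close> would produce.\<close>

lemma tracking_signs_exist:
  fixes \<delta> \<theta> :: "real^'n"
  assumes \<sigma>: "0 < \<sigma>" and \<delta>: "norm \<delta> \<le> \<sigma>"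
  shows "\<exists>e. (\<forall>t. e t = \<sigma> \<or> e t = - \<sigma>) \<and>
    (inorm (gram (acts \<beta> \<theta> e) k) (\<Sum>s=1..k. (e s - acts \<beta> \<theta> e s \<bullet> \<delta>) *\<^sub>R acts \<beta> \<theta> e s))\<^sup>2
      \<le> 4 * \<sigma>\<^sup>2 * (\<Sum>s=1..k. ln (1 + (width (acts \<beta> \<theta> e) s)\<^sup>2))"
proof (induction k)
  case 0
  show ?case by (rule exI[of _ "\<lambda>_. \<sigma>"]) (simp add: inorm_def)
next
  case (Suc k)
  then obtain e where e: "\<And>t. e t = \<sigma> \<or> e t = - \<sigma>"
    and IH: "(inorm (gram (acts \<beta> \<theta> e) k) (\<Sum>s=1..k. (e s - acts \<beta> \<theta> e s \<bullet> \<delta>) *\<^sub>R acts \<beta> \<theta> e s))\<^sup>2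
      \<le> 4 * \<sigma>\<^sup>2 * (\<Sum>s=1..k. ln (1 + (width (acts \<beta> \<theta> e) s)\<^sup>2))" by blast
  define x where "x = acts \<beta> \<theta> e"
  define D where "D = (\<Sum>s=1..k. (e s - x s \<bullet> \<delta>) *\<^sub>R x s)"
  define a where "a = x (Suc k)"
  define v where "v = D \<bullet> (matrix_inv (gram x k) *v a)"
  \<comment> \<open>The sign opposes \<open>v\<close>; as the drift
    \<open>a \<bullet> \<delta>\<close> is at most \<open>\<sigma>\<close> in absolute value,
    subtracting it cannot reverse the sign of \<open>\<eta>\<close>.\<close>
  define \<epsilon> where "\<epsilon> = (if v \<le> 0 then \<sigma> else - \<sigma>)"
  define \<eta> where "\<eta> = \<epsilon> - a \<bullet> \<delta>"
  define e' where "e' = e(Suc k := \<epsilon>)"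
  define x' where "x' = acts \<beta> \<theta> e'"
  \<comment> \<open>New noise in round \<open>Suc k\<close> influences actions from the following
    round on, so the action \<open>a\<close> from which the sign was computed stays the
    same.\<close>
  have xx: "x' s = x s" if "s \<le> Suc k" for s
    unfolding x_def x'_def using that by (intro acts_cong) (auto simp: e'_def)
  have na: "norm a \<le> 1"
    using acts_argmax[of "Suc k" \<beta> \<theta> e] by (simp add: a_def x_def is_arg_max_def)
  have ad: "\<bar>a \<bullet> \<delta>\<bar> \<le> \<sigma>"
  proof -
    have "\<bar>a \<bullet> \<delta>\<bar> \<le> norm a * norm \<delta>" by (rule Cauchy_Schwarz_ineq2)
    also have "\<dots> \<le> 1 * \<sigma>" using na \<delta> by (intro mult_mono) auto
    finally show ?thesis by simp
  qed
  have \<eta>v: "\<eta> * v \<le> 0"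
    using ad by (auto simp: \<eta>_def \<epsilon>_def mult_le_0_iff)
  have "\<bar>\<eta>\<bar> \<le> 2 * \<sigma>" using ad \<sigma> by (auto simp: \<eta>_def \<epsilon>_def)
  then have "\<bar>\<eta>\<bar>\<^sup>2 \<le> (2 * \<sigma>)\<^sup>2" by (rule power_mono) simp
  then have \<eta>2: "\<eta>\<^sup>2 \<le> 4 * \<sigma>\<^sup>2" by (simp add: power_mult_distrib)
  have gS: "gram x' (Suc k) = gram x (Suc k)" by (rule gram_cong) (simp add: xx)
  have D': "(\<Sum>s=1..Suc k. (e' s - x' s \<bullet> \<delta>) *\<^sub>R x' s) = D + \<eta> *\<^sub>R a"
  proof -
    have "(\<Sum>s=1..k. (e' s - x' s \<bullet> \<delta>) *\<^sub>R x' s) = D"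
      unfolding D_def by (intro sum.cong) (auto simp: e'_def xx)
    then show ?thesis by (simp add: \<eta>_def e'_def a_def xx)
  qed
  have w': "width x' s = width x s" if s: "s \<in> {1..Suc k}" for s
  proof -
    have "gram x' (s - 1) = gram x (s - 1)" using s by (intro gram_cong) (auto simp: xx)
    then show ?thesis using s by (simp add: xx)
  qed
  have "(inorm (gram x (Suc k)) (D + \<eta> *\<^sub>R a))\<^sup>2
      \<le> (inorm (gram x k) D)\<^sup>2 + \<eta>\<^sup>2 * ln (1 + (inorm (gram x k) a)\<^sup>2)"
    using \<eta>v by (intro inorm_rank_one_step[OF gram_posdef gram_posdef]) (auto simp: gram_Suc a_def v_def)
  also have "\<dots> \<le> 4 * \<sigma>\<^sup>2 * (\<Sum>s=1..k. ln (1 + (width x s)\<^sup>2)) + 4 * \<sigma>\<^sup>2 * ln (1 + (width x (Suc k))\<^sup>2)"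
  proof (rule add_mono)
    show "(inorm (gram x k) D)\<^sup>2 \<le> 4 * \<sigma>\<^sup>2 * (\<Sum>s=1..k. ln (1 + (width x s)\<^sup>2))"
      using IH by (simp only: x_def D_def)
    have "0 \<le> ln (1 + (inorm (gram x k) a)\<^sup>2)" by simp
    then show "\<eta>\<^sup>2 * ln (1 + (inorm (gram x k) a)\<^sup>2) \<le> 4 * \<sigma>\<^sup>2 * ln (1 + (width x (Suc k))\<^sup>2)"
      using \<eta>2 unfolding a_def diff_Suc_1 by (rule_tac mult_right_mono)
  qed
  also have "\<dots> = 4 * \<sigma>\<^sup>2 * (\<Sum>s=1..Suc k. ln (1 + (width x s)\<^sup>2))" by (simp add: algebra_simps)
  also have "(\<Sum>s=1..Suc k. ln (1 + (width x s)\<^sup>2)) = (\<Sum>s=1..Suc k. ln (1 + (width x' s)\<^sup>2))"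
    by (rule sum.cong[OF refl]) (simp only: w')
  finally have "(inorm (gram x' (Suc k)) (\<Sum>s=1..Suc k. (e' s - x' s \<bullet> \<delta>) *\<^sub>R x' s))\<^sup>2
      \<le> 4 * \<sigma>\<^sup>2 * (\<Sum>s=1..Suc k. ln (1 + (width x' s)\<^sup>2))" unfolding gS D' .
  moreover have "\<forall>t. e' t = \<sigma> \<or> e' t = - \<sigma>" using e by (simp add: e'_def \<epsilon>_def)
  ultimately show ?case unfolding x'_def by blast
qed

text \<open>Optimism is tested in the direction \<open>gram x t *v (\<theta> - h t)\<close>, where
  the duality between \<open>anorm\<close> and \<open>inorm\<close> is an equality. It thus places
  \<open>\<theta>\<close> in the ellipsoid of radius \<open>\<beta>\<close> around the projected
  estimator.\<close>

lemma anorm_le_of_optimism: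
  assumes \<beta>: "0 \<le> \<beta>" and opt: "\<And>b. b \<in> cball 0 1 \<Longrightarrow> b \<bullet> \<theta> \<le> ucb \<beta> x h (Suc t) b"
  shows "anorm (gram x t) (\<theta> - h t) \<le> \<beta>"
proof -
  let ?G = "gram x t"
  define z where "z = \<theta> - h t"
  define y where "y = ?G *v z"
  show ?thesis
  proof (cases "y = 0")
    case True
    then show ?thesis using \<beta> by (simp add: anorm_def z_def[symmetric] y_def)
  next
    case False
    then have n: "0 < norm y" by simp
    have "(y /\<^sub>R norm y) \<bullet> \<theta> \<le> ucb \<beta> x h (Suc t) (y /\<^sub>R norm y)" using n by (intro opt) simp
    moreover have "ucb \<beta> x h (Suc t) b = b \<bullet> h t + \<beta> * inorm ?G b" for b
      by (simp add: ucb_def inorm_def)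
    ultimately have "(y /\<^sub>R norm y) \<bullet> z \<le> \<beta> * inorm ?G (y /\<^sub>R norm y)"
      unfolding z_def inner_diff_right by simp
    then have "y \<bullet> z / norm y \<le> \<beta> * inorm ?G y / norm y"
      by (simp add: inorm_scaleR divide_inverse mult_ac)
    then have "y \<bullet> z \<le> \<beta> * inorm ?G y" using n by (simp add: divide_le_cancel)
    then have "(anorm ?G z)\<^sup>2 \<le> \<beta> * anorm ?G z"
      unfolding anorm_square[OF gram_posdef] y_def inorm_mult[OF gram_posdef] by (simp add: inner_commute)
    then have "anorm ?G z * anorm ?G z \<le> \<beta> * anorm ?G z" by (simp add: power2_eq_square)
    then show ?thesis
      using \<beta> anorm_nonneg[OF gram_posdef, of x t z] unfolding z_def[symmetric]
      by (cases "anorm ?G z = 0") (auto simp: mult_le_cancel_right)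
  qed
qed

text \<open>At round \<open>k\<close> the least eigenvalue is at least \<open>K \<beta>\<^sup>2\<close>. The estimator is then within \<open>\<gamma> / 2\<close> of the
  imitated parameter, and the error \<open>\<gamma> / 5\<close> of its projection already exceeds the confidence radius \<open>\<beta>\<close>.\<close>

lemma optimism_breaking_signs_exist:
  fixes \<theta> :: "real^'n" and \<sigma> \<beta> K :: real
  defines "d \<equiv> real CARD('n)" and "\<gamma> \<equiv> min \<sigma> 1"
  defines "k \<equiv> nat \<lceil>1250 * K ^ 3 * d\<^sup>2 * \<beta>\<^sup>2\<rceil>"
  assumes dim2: "2 \<le> CARD('n)" and \<sigma>: "0 < \<sigma>" and \<beta>: "1 \<le> \<beta>" and \<theta>: "norm \<theta> = 1"
    and K: "1 \<le> K" "26 / \<gamma>\<^sup>2 \<le> K" "8 * \<sigma>\<^sup>2 * d * (ln (1252 * d\<^sup>2 * K ^ 3) + 1) + 8 \<le> \<gamma>\<^sup>2 * K / 4"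
  shows "\<exists>e. (\<forall>t. e t = \<sigma> \<or> e t = - \<sigma>) \<and>
    \<not> (\<forall>b\<in>cball 0 1. b \<bullet> \<theta> \<le> ucb \<beta> (acts \<beta> \<theta> e) (est \<theta> (acts \<beta> \<theta> e) e) (Suc k) b)"
proof -
  have d: "2 \<le> d" using dim2 by (simp add: d_def)
  have \<gamma>: "0 < \<gamma>" "\<gamma> \<le> 1" "\<gamma> \<le> \<sigma>" using \<sigma> by (auto simp: \<gamma>_def)
  have b2: "1 \<le> \<beta>\<^sup>2" using \<beta> by simp
  obtain u0 :: "real^'n" where u0: "u0 \<noteq> 0" "orthogonal \<theta> u0"
    using orthogonal_to_vector_exists[of \<theta>] dim2 by auto
  define u where "u = u0 /\<^sub>R norm u0"
  have u: "norm u = 1" "\<theta> \<bullet> u = 0" using u0 by (auto simp: u_def orthogonal_def)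
  \<comment> \<open>A shift orthogonal to \<open>\<theta>\<close> is not undone by projecting to the
    unit sphere. Its length is at most \<open>\<sigma>\<close>, so that signs can imitate it, and at
    most 1, so that \<open>norm \<theta>' \<le> 2\<close>.\<close>
  define \<delta> where "\<delta> = \<gamma> *\<^sub>R u"
  define \<theta>' where "\<theta>' = \<theta> + \<delta>"
  have n\<delta>: "norm \<delta> = \<gamma>" using u \<gamma> by (simp add: \<delta>_def)
  have n\<theta>': "norm \<theta>' \<le> 2" using norm_triangle_ineq[of \<theta> \<delta>] \<theta> n\<delta> \<gamma> by (simp add: \<theta>'_def)
  obtain e where e: "\<And>t. e t = \<sigma> \<or> e t = - \<sigma>"
    and tr: "(inorm (gram (acts \<beta> \<theta> e) k) (\<Sum>s=1..k. (e s - acts \<beta> \<theta> e s \<bullet> \<delta>) *\<^sub>R acts \<beta> \<theta> e s))\<^sup>2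
      \<le> 4 * \<sigma>\<^sup>2 * (\<Sum>s=1..k. ln (1 + (width (acts \<beta> \<theta> e) s)\<^sup>2))"
    using tracking_signs_exist[OF \<sigma>, of \<delta> \<beta> \<theta> k] n\<delta> \<gamma> by auto
  define x where "x = acts \<beta> \<theta> e"
  define h where "h = est \<theta> x e"
  define m where "m = lmin x k"
  define DD where "DD = (\<Sum>s=1..k. (e s - x s \<bullet> \<delta>) *\<^sub>R x s)"
  interpret ucb_path \<beta> k x h
    unfolding x_def h_def by (rule acts_ucb_path[OF dim2 \<beta> \<theta>])
  have K3: "1 \<le> K ^ 3" using K by simp
  have kr: "1250 * K ^ 3 * d\<^sup>2 * \<beta>\<^sup>2 \<le> real k" "real k \<le> 1250 * K ^ 3 * d\<^sup>2 * \<beta>\<^sup>2 + 1"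
  proof -
    have n1: "y \<le> real (nat \<lceil>y\<rceil>)" for y :: real by (rule real_nat_ceiling_ge)
    have n2: "real (nat \<lceil>y\<rceil>) \<le> y + 1" if "0 \<le> y" for y :: real
    proof -
      have "0 \<le> \<lceil>y\<rceil>" using that by simp
      then have "real (nat \<lceil>y\<rceil>) = real_of_int \<lceil>y\<rceil>" by (rule of_nat_nat)
      then show ?thesis using of_int_ceiling_le_add_one[of y] by simp
    qed
    have y0: "0 \<le> 1250 * K ^ 3 * d\<^sup>2 * \<beta>\<^sup>2" using K by simp
    show "1250 * K ^ 3 * d\<^sup>2 * \<beta>\<^sup>2 \<le> real k" "real k \<le> 1250 * K ^ 3 * d\<^sup>2 * \<beta>\<^sup>2 + 1"
      unfolding k_def by (rule n1, rule n2[OF y0])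
  qed
  have m0: "0 < m" unfolding m_def by (rule lmin_pos)
  have mK: "K * \<beta>\<^sup>2 \<le> m"
    using lmin_initial_growth[OF K(1) order_refl]
  proof
    assume "real k / (1250 * K\<^sup>2 * (real CARD('n))\<^sup>2) \<le> lmin x k"
    then have h: "real k / (1250 * K\<^sup>2 * d\<^sup>2) \<le> m" by (simp add: d_def m_def)
    \<comment> \<open>The cube in \<open>k\<close> is one \<open>K\<close> for the target
      \<open>K * \<beta>^2\<close> and \<open>K^2\<close> for the rate in
      \<open>lmin_initial_growth\<close>.\<close>
    have "K * \<beta>\<^sup>2 = 1250 * K ^ 3 * d\<^sup>2 * \<beta>\<^sup>2 / (1250 * K\<^sup>2 * d\<^sup>2)"
      using K d by (simp add: power2_eq_square power3_eq_cube)
    also have "\<dots> \<le> real k / (1250 * K\<^sup>2 * d\<^sup>2)" using kr by (intro divide_right_mono) auto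
    finally show ?thesis using h by simp
  qed (simp add: m_def)
  define \<L> where "\<L> = ln (1252 * d\<^sup>2 * K ^ 3)"
  have "1 * 1 * 1 \<le> d\<^sup>2 * K ^ 3 * \<beta>\<^sup>2" 
  proof -
    have "1 \<le> d\<^sup>2" using d by simp
    then show ?thesis using K K3 b2 by (intro mult_mono mult_nonneg_nonneg) auto
  qed
  moreover have "d * 1 * 1 \<le> d\<^sup>2 * K ^ 3 * \<beta>\<^sup>2"
  proof -
    have "d * 1 \<le> d\<^sup>2" using d by (simp add: power2_eq_square)
    then show ?thesis using d K K3 b2 by (intro mult_mono mult_nonneg_nonneg) auto
  qed
  ultimately have dk: "d + real k \<le> 1252 * d\<^sup>2 * K ^ 3 * \<beta>\<^sup>2" using kr by (simp add: mult_ac)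
  have pos: "0 < 1252 * d\<^sup>2 * K ^ 3" using d K by simp
  have "ln (d + real k) \<le> ln (1252 * d\<^sup>2 * K ^ 3 * \<beta>\<^sup>2)"
    by (subst ln_le_cancel_iff) (use dk d in linarith)+
  also have "\<dots> = \<L> + ln (\<beta>\<^sup>2)" unfolding \<L>_def using pos b2 \<beta> by (intro ln_mult_pos) auto
  \<comment> \<open>This crude bound on the logarithm suffices: the squared tracking error is
    compared with \<open>\<gamma>^2 * K / 4\<close> times \<open>\<beta>^2\<close>, where
    \<open>K\<close> is free to be large.\<close>
  also have "\<dots> \<le> \<L> + \<beta>\<^sup>2" using ln_le_minus_one[of "\<beta>\<^sup>2"] \<beta> by simp
  finally have lk: "ln (d + real k) \<le> \<L> + \<beta>\<^sup>2" .
  have "(inorm (gram x k) DD)\<^sup>2 \<le> 4 * \<sigma>\<^sup>2 * (\<Sum>s=1..k. ln (1 + (width x s)\<^sup>2))"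
    using tr by (simp add: x_def DD_def)
  also have "\<dots> \<le> 4 * \<sigma>\<^sup>2 * (d * (\<L> + \<beta>\<^sup>2))"
  proof (rule mult_left_mono)
    have "(\<Sum>s=1..k. ln (1 + (width x s)\<^sup>2)) \<le> ln (det (gram x k)) - ln (det (gram x 0))"
      using det_gram_window[of 0 k x] by simp
    also have "\<dots> = ln (det (gram x k))" by (simp add: gram_def)
    also have "\<dots> \<le> d * ln (d + real k)" using ln_det_gram_le[of k] by (simp add: d_def)
    also have "\<dots> \<le> d * (\<L> + \<beta>\<^sup>2)" using lk d by (intro mult_left_mono) auto
    finally show "(\<Sum>s=1..k. ln (1 + (width x s)\<^sup>2)) \<le> d * (\<L> + \<beta>\<^sup>2)" .
  qed simp
  finally have DD: "(inorm (gram x k) DD)\<^sup>2 \<le> 4 * \<sigma>\<^sup>2 * (d * (\<L> + \<beta>\<^sup>2))" .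
  define r where "r = ridge x (\<lambda>s. x s \<bullet> \<theta> + e s) k"
  have "r = ridge x (\<lambda>s. x s \<bullet> \<theta>' + (e s - x s \<bullet> \<delta>)) k"
    unfolding r_def by (simp add: \<theta>'_def inner_add_right)
  then have "anorm (gram x k) (r - \<theta>') \<le> inorm (gram x k) DD + norm \<theta>'"
    using ridge_error_anorm_le[of x k \<theta>' "\<lambda>s. e s - x s \<bullet> \<delta>"] by (simp add: DD_def)
  then have "sqrt m * norm (r - \<theta>') \<le> inorm (gram x k) DD + 2"
    using anorm_ge[OF gram_posdef, of x k "r - \<theta>'"] n\<theta>' by (simp add: m_def)
  then have "(sqrt m * norm (r - \<theta>'))\<^sup>2 \<le> (inorm (gram x k) DD + 2)\<^sup>2"
    using m0 by (intro power_mono) auto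
  also have "\<dots> \<le> 2 * (inorm (gram x k) DD)\<^sup>2 + 8"
  proof -
    have "0 \<le> (inorm (gram x k) DD - 2)\<^sup>2" by simp
    then show ?thesis by (simp add: power2_sum power2_diff)
  qed
  also have "\<dots> \<le> 8 * \<sigma>\<^sup>2 * d * (\<L> + \<beta>\<^sup>2) + 8" using DD by (simp add: algebra_simps)
  also have "\<dots> \<le> (8 * \<sigma>\<^sup>2 * d * (\<L> + 1) + 8) * \<beta>\<^sup>2"
  proof -
    have "0 \<le> \<L>"
    proof -
      have "1 * 1 \<le> (1252 * d\<^sup>2) * K ^ 3" 
      proof -
        have "1 \<le> d\<^sup>2" using d by simp
        then show ?thesis using K K3 by (intro mult_mono mult_nonneg_nonneg) auto
      qed
      then show ?thesis unfolding \<L>_def by simp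
    qed
    then have "\<L> * 1 \<le> \<L> * \<beta>\<^sup>2" using b2 by (intro mult_left_mono) auto
    then have "\<L> + \<beta>\<^sup>2 \<le> (\<L> + 1) * \<beta>\<^sup>2" by (simp add: distrib_right)
    then have "8 * \<sigma>\<^sup>2 * d * (\<L> + \<beta>\<^sup>2) \<le> 8 * \<sigma>\<^sup>2 * d * ((\<L> + 1) * \<beta>\<^sup>2)"
      using d by (intro mult_left_mono) auto
    then show ?thesis using b2 by (simp add: algebra_simps)
  qed
  also have "\<dots> \<le> (\<gamma>\<^sup>2 * K / 4) * \<beta>\<^sup>2" using K(3) unfolding \<L>_def by (intro mult_right_mono) auto
  also have "\<dots> \<le> \<gamma>\<^sup>2 / 4 * m" using mult_left_mono[OF mK, of "\<gamma>\<^sup>2 / 4"] by simp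
  also have "\<dots> = (sqrt m * (\<gamma> / 2))\<^sup>2" using m0 by (simp add: power_mult_distrib power_divide)
  finally have "sqrt m * norm (r - \<theta>') \<le> sqrt m * (\<gamma> / 2)"
    by (rule power2_le_imp_le) (use m0 \<gamma> in simp)
  then have rr: "norm (r - \<theta>') \<le> \<gamma> / 2" using m0 by simp
  have ru: "\<gamma> / 2 \<le> r \<bullet> u"
  proof -
    have "\<theta>' \<bullet> u = \<gamma>" using u by (simp add: \<theta>'_def \<delta>_def inner_add_left norm_eq_1)
    moreover have "\<bar>(r - \<theta>') \<bullet> u\<bar> \<le> \<gamma> / 2"
      using Cauchy_Schwarz_ineq2[of "r - \<theta>'" u] rr u by simp
    ultimately show ?thesis unfolding inner_diff_left by linarith
  qed
  then have r0: "r \<noteq> 0" using \<gamma> by auto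
  then have hk: "h k = r /\<^sub>R norm r" by (simp add: h_def est_def r_def Let_def)
  have nr: "norm r \<le> 5 / 2" using norm_triangle_ineq[of "r - \<theta>'" \<theta>'] rr n\<theta>' \<gamma> by simp
  have "\<gamma> / 5 \<le> (r \<bullet> u) / norm r"
  proof -
    have "\<gamma> / 5 = (\<gamma> / 2) / (5 / 2)" by simp
    also have "\<dots> \<le> (r \<bullet> u) / norm r" using ru nr r0 \<gamma> by (intro frac_le) auto
    finally show ?thesis .
  qed
  also have "(r \<bullet> u) / norm r = (h k - \<theta>) \<bullet> u"
    unfolding hk inner_diff_left inner_scaleR_left u(2) by (simp only: divide_inverse mult.commute diff_0_right)
  also have "\<dots> \<le> norm (\<theta> - h k)"
    using norm_cauchy_schwarz[of "h k - \<theta>" u] u by (simp add: norm_minus_commute)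
  finally have hg: "\<gamma> / 5 \<le> norm (\<theta> - h k)" .
  \<comment> \<open>The \<open>\<gamma> / 5\<close> arose as \<open>\<gamma> / 2\<close> over a norm
    of at most 5/2; its square asks for 25, and the 26 in the hypothesis makes the inequality
    strict.\<close>
  have "\<beta>\<^sup>2 < (sqrt m * (\<gamma> / 5))\<^sup>2"
  proof -
    have "26 \<le> K * \<gamma>\<^sup>2" using K(2) \<gamma> by (simp add: field_simps)
    then have "26 * \<beta>\<^sup>2 \<le> (K * \<gamma>\<^sup>2) * \<beta>\<^sup>2" by (intro mult_right_mono) auto
    also have "\<dots> = \<gamma>\<^sup>2 * (K * \<beta>\<^sup>2)" by simp
    also have "\<dots> \<le> \<gamma>\<^sup>2 * m" using mK by (intro mult_left_mono) auto
    finally have "25 * \<beta>\<^sup>2 < \<gamma>\<^sup>2 * m" using b2 by simp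
    then show ?thesis using m0 by (simp add: power_mult_distrib power_divide mult.commute)
  qed
  then have "\<beta> < sqrt m * (\<gamma> / 5)" by (rule power2_less_imp_less) (use m0 \<gamma> in simp)
  also have "\<dots> \<le> sqrt m * norm (\<theta> - h k)" using hg m0 by (intro mult_left_mono) auto
  also have "\<dots> \<le> anorm (gram x k) (\<theta> - h k)" unfolding m_def by (rule anorm_ge[OF gram_posdef])
  finally have "\<not> anorm (gram x k) (\<theta> - h k) \<le> \<beta>" by simp
  then have "\<not> (\<forall>b\<in>cball 0 1. b \<bullet> \<theta> \<le> ucb \<beta> x h (Suc k) b)"
    using anorm_le_of_optimism[of \<beta> \<theta> x h k] \<beta> by (meson order_trans zero_le_one)
  then show ?thesis using e unfolding x_def h_def by blast
qed

context sign_space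
begin

lemma event_meets_prefix:
  assumes T: "2 \<le> T" and E: "E \<in> sets P" "1 - 1 / real T \<le> measure P E"
    and k: "2 ^ k < T" and A: "A \<subseteq> {1..k}"
  shows "\<exists>\<omega>\<in>E. \<omega> \<in> \<Omega> \<and> pos \<omega> \<inter> {1..k} = A"
proof (rule ccontr)
  assume n: "\<not> ?thesis"
  interpret prob_space P by (rule prob_space_P)
  let ?B = "{\<omega> \<in> \<Omega>. pos \<omega> \<inter> {1..k} = A}"
  have kT: "k \<le> T" using k less_exp[of k] by linarith
  have "E \<inter> ?B = {}" using n by auto
  moreover have "?B \<in> sets P" by auto
  ultimately have "measure P (E \<union> ?B) = measure P E + measure P ?B"
    using E(1) by (intro finite_measure_Union)
  then have "measure P E + measure P ?B \<le> 1" using prob_le_1[of "E \<union> ?B"] by simp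
  then have "1 / 2 ^ k \<le> 1 / real T" using prefix_measure_ge[OF kT A] E(2) by linarith
  then have "real T \<le> 2 ^ k" using T by (simp add: field_simps)
  moreover have "(2 ^ k :: real) < real T" using k by (metis of_nat_less_iff of_nat_numeral of_nat_power)
  ultimately show False by simp
qed

text \<open>The score of round \<open>Suc k\<close> depends on the first \<open>k\<close> signs
  only, so a single outcome of the optimism event with these signs settles the inequality for every
  continuation.\<close>

lemma optimism_on_prefix:
  assumes T: "2 \<le> T" and opt: "holds_with_prob_ge P (1 - 1 / real T) (\<lambda>\<omega>. optimism \<beta> T \<theta> (\<lambda>s. action s \<omega>) (\<lambda>s. hat s \<omega>))"
    and k: "2 ^ k < T" and e: "\<And>t. e t = \<sigma> \<or> e t = - \<sigma>" and b: "b \<in> cball 0 1"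
  shows "b \<bullet> \<theta> \<le> ucb \<beta> (acts \<beta> \<theta> e) (est \<theta> (acts \<beta> \<theta> e) e) (Suc k) b"
proof -
  obtain E where E: "E \<in> sets P" "1 - 1 / real T \<le> measure P E"
    "\<And>\<omega>. \<omega> \<in> E \<Longrightarrow> optimism \<beta> T \<theta> (\<lambda>s. action s \<omega>) (\<lambda>s. hat s \<omega>)"
    using opt unfolding holds_with_prob_ge_def by blast
  have kT: "Suc k \<le> T" using k less_exp[of k] by linarith
  let ?A = "{t \<in> {1..k}. e t = \<sigma>}"
  have "?A \<subseteq> {1..k}" by auto
  from event_meets_prefix[OF T E(1,2) k this]
  obtain \<omega> where \<omega>: "\<omega> \<in> E" "\<omega> \<in> \<Omega>" "pos \<omega> \<inter> {1..k} = ?A" by blast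
  have ne: "noise s \<omega> = e s" if "s \<in> {1..k}" for s
  proof -
    have "s \<in> pos \<omega> \<longleftrightarrow> e s = \<sigma>" using \<omega>(3) that by blast
    then show ?thesis using e[of s] by (auto simp: noise_def)
  qed
  have ac: "action s \<omega> = acts \<beta> \<theta> e s" if "s \<le> Suc k" for s
    unfolding action_def using that ne by (intro acts_cong) auto
  have ha: "hat k \<omega> = est \<theta> (acts \<beta> \<theta> e) e k"
    unfolding hat_def using ne ac by (intro est_cong) auto
  have "ucb \<beta> (\<lambda>s. action s \<omega>) (\<lambda>s. hat s \<omega>) (Suc k) = ucb \<beta> (acts \<beta> \<theta> e) (est \<theta> (acts \<beta> \<theta> e) e) (Suc k)"
    using ac ha by (intro ucb_cong) auto
  moreover have "b \<bullet> \<theta> \<le> ucb \<beta> (\<lambda>s. action s \<omega>) (\<lambda>s. hat s \<omega>) (Suc k) b"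
    using E(3)[OF \<omega>(1)] kT b unfolding optimism_def by auto
  ultimately show ?thesis by simp
qed

lemma beta_ge_2:
  assumes T: "2 \<le> T" and \<beta>: "0 < \<beta>" and opt: "holds_with_prob_ge P (1 - 1 / real T) (\<lambda>\<omega>. optimism \<beta> T \<theta> (\<lambda>s. action s \<omega>) (\<lambda>s. hat s \<omega>))"
  shows "2 \<le> \<beta>"
proof -
  let ?x = "acts \<beta> \<theta> (\<lambda>_. \<sigma>)"
  have "\<theta> \<bullet> \<theta> \<le> ucb \<beta> ?x (est \<theta> ?x (\<lambda>_. \<sigma>)) (Suc 0) \<theta>"
    using T norm_theta by (intro optimism_on_prefix[OF T opt, of 0]) auto
  then have "1 \<le> - 1 + \<beta> * inorm (gram ?x 0) \<theta>"
    using norm_theta by (simp add: ucb_def est_0 inorm_def norm_eq_1)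
  also have "\<dots> \<le> - 1 + \<beta> * 1"
  proof -
    have "inorm (gram ?x 0) \<theta> \<le> norm \<theta> / sqrt (lmin ?x 0)" by (rule inorm_le[OF gram_posdef])
    also have "\<dots> \<le> 1 / 1" using norm_theta lmin_ge_1[of ?x 0] by (intro frac_le) auto
    finally show ?thesis using \<beta> by (intro add_left_mono mult_left_mono) auto
  qed
  finally show ?thesis by simp
qed

end

section \<open>Sign patterns within an arbitrary run\<close>

lemma square_le_exp: "x\<^sup>2 \<le> 2 * (exp x + exp (- x))" for x :: real
proof -
  have main: "y\<^sup>2 \<le> 2 * exp y" if "0 \<le> y" for y :: real
    using exp_lower_Taylor_quadratic[OF that] that by simp
  show ?thesis
  proof (cases "0 \<le> x")
    case True
    have "2 * exp x \<le> 2 * (exp x + exp (- x))" by simp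
    then show ?thesis using main[OF True] by (rule order_trans[rotated])
  next
    case False
    then have "x\<^sup>2 \<le> 2 * exp (- x)" using main[of "- x"] by simp
    also have "\<dots> \<le> 2 * (exp x + exp (- x))" by simp
    finally show ?thesis .
  qed
qed

lemma abs_le_exp: "\<bar>x\<bar> \<le> exp x + exp (- x)" for x :: real
  using exp_ge_add_one_self[of x] exp_ge_add_one_self[of "- x"] exp_gt_zero[of x] exp_gt_zero[of "- x"]
  by linarith

context linucb
begin

lemma noise_moments_integrable:
  assumes t: "t \<in> {1..T}"
  shows "integrable M (\<epsilon> t)" "integrable M (\<lambda>\<omega>. (\<epsilon> t \<omega>)\<^sup>2)"
proof -
  have [measurable]: "\<epsilon> t \<in> borel_measurable M" by (rule noise_measurable[OF t])
  have g: "integrable M (\<lambda>\<omega>. 2 * (exp (\<epsilon> t \<omega>) + exp (- \<epsilon> t \<omega>)))"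
    using noise_integrable[OF t, of 1] noise_integrable[OF t, of "-1"] by simp
  show "integrable M (\<epsilon> t)"
  proof (rule Bochner_Integration.integrable_bound[OF g])
    show "AE \<omega> in M. norm (\<epsilon> t \<omega>) \<le> norm (2 * (exp (\<epsilon> t \<omega>) + exp (- \<epsilon> t \<omega>)))"
    proof (rule AE_I2)
      fix \<omega>
      show "norm (\<epsilon> t \<omega>) \<le> norm (2 * (exp (\<epsilon> t \<omega>) + exp (- \<epsilon> t \<omega>)))"
      proof -
        define A where "A = exp (\<epsilon> t \<omega>) + exp (- \<epsilon> t \<omega>)"
        have "\<bar>\<epsilon> t \<omega>\<bar> \<le> A" unfolding A_def by (rule abs_le_exp)
        then have "\<bar>\<epsilon> t \<omega>\<bar> \<le> \<bar>2 * A\<bar>" by linarith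
        then show ?thesis by (simp only: A_def real_norm_def)
      qed
    qed
  qed simp
  show "integrable M (\<lambda>\<omega>. (\<epsilon> t \<omega>)\<^sup>2)"
  proof (rule Bochner_Integration.integrable_bound[OF g])
    show "AE \<omega> in M. norm ((\<epsilon> t \<omega>)\<^sup>2) \<le> norm (2 * (exp (\<epsilon> t \<omega>) + exp (- \<epsilon> t \<omega>)))"
      by (rule AE_I2) (use square_le_exp in \<open>simp add: order_trans[OF _ abs_ge_self]\<close>)
  qed simp
qed

text \<open>On \<open>G\<close> the noise has mean zero and variance \<open>\<sigma>\<^sup>2\<close>, so it cannot keep one sign there.\<close>

lemma noise_takes_both_signs:
  assumes \<sigma>: "0 < \<sigma>" and t: "t \<in> {1..T}" and G: "G \<in> sets (hist (t - 1))" and pG: "0 < measure M G"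
    and s: "s = 1 \<or> s = (-1 :: real)"
  shows "0 < measure M (G \<inter> {\<omega> \<in> space M. 0 < s * \<epsilon> t \<omega>})"
proof (rule ccontr)
  assume "\<not> ?thesis"
  then have m0: "measure M (G \<inter> {\<omega> \<in> space M. 0 < s * \<epsilon> t \<omega>}) = 0"
    by (simp add: zero_less_measure_iff)
  have sub: "subalgebra M (hist (t - 1))" using t by (intro subalgebra_hist) auto
  interpret finite_measure_subalgebra M "hist (t - 1)" by unfold_locales (rule sub)
  have GM[measurable]: "G \<in> sets M" using sub G by (auto simp: subalgebra_def)
  have [measurable]: "\<epsilon> t \<in> borel_measurable M" by (rule noise_measurable[OF t])
  let ?c = "real_cond_exp M (hist (t - 1)) (\<epsilon> t)"
  let ?f = "\<lambda>w. (\<epsilon> t w - ?c w)\<^sup>2"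
  have "(\<integral>\<omega>\<in>G. \<epsilon> t \<omega> \<partial>M) = (\<integral>\<omega>\<in>G. ?c \<omega> \<partial>M)"
    by (rule real_cond_exp_intA[OF noise_moments_integrable(1)[OF t] G])
  also have "\<dots> = (\<integral>\<omega>. 0 \<partial>M)"
    unfolding set_lebesgue_integral_def
  proof (rule integral_cong_AE)
    show "AE \<omega> in M. indicator G \<omega> *\<^sub>R ?c \<omega> = 0"
      using noise_mean[OF t] by eventually_elim simp
  qed measurable
  finally have mean: "(\<integral>\<omega>. indicator G \<omega> * \<epsilon> t \<omega> \<partial>M) = 0"
    by (simp add: set_lebesgue_integral_def)
  have feq: "AE \<omega> in M. ?f \<omega> = (\<epsilon> t \<omega>)\<^sup>2"
    using noise_mean[OF t] by eventually_elim simp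
  have fint: "integrable M ?f"
    by (rule integrable_cong_AE_imp[OF noise_moments_integrable(2)[OF t]])
      (use feq in \<open>auto elim: eventually_mono\<close>)
  have "(\<integral>\<omega>\<in>G. ?f \<omega> \<partial>M) = (\<integral>\<omega>\<in>G. real_cond_exp M (hist (t - 1)) ?f \<omega> \<partial>M)"
    by (rule real_cond_exp_intA[OF fint G])
  also have "\<dots> = (\<integral>\<omega>. \<sigma>\<^sup>2 * indicator G \<omega> \<partial>M)"
    unfolding set_lebesgue_integral_def
  proof (rule integral_cong_AE)
    show "AE \<omega> in M. indicator G \<omega> *\<^sub>R real_cond_exp M (hist (t - 1)) ?f \<omega> = \<sigma>\<^sup>2 * indicator G \<omega>"
      using noise_variance[OF t] by eventually_elim simp
  qed measurable
  also have "\<dots> = \<sigma>\<^sup>2 * measure M G" by simp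
  finally have var: "(\<integral>\<omega>\<in>G. ?f \<omega> \<partial>M) = \<sigma>\<^sup>2 * measure M G" .
  have "AE \<omega> in M. \<omega> \<notin> G \<inter> {\<omega> \<in> space M. 0 < s * \<epsilon> t \<omega>}"
    using m0 by (intro AE_not_in) (auto simp: null_sets_def emeasure_eq_measure)
  then have nn: "AE \<omega> in M. 0 \<le> - (indicator G \<omega> * (s * \<epsilon> t \<omega>))"
    using AE_space by eventually_elim (auto simp: indicator_def not_less)
  have int: "integrable M (\<lambda>\<omega>. - (indicator G \<omega> * (s * \<epsilon> t \<omega>)))"
  proof -
    have "integrable M (\<lambda>\<omega>. indicator G \<omega> *\<^sub>R (s * \<epsilon> t \<omega>))"
      using noise_moments_integrable(1)[OF t] by (intro integrable_mult_indicator[OF GM]) simp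
    then show ?thesis by simp
  qed
  have "(\<integral>\<omega>. - (indicator G \<omega> * (s * \<epsilon> t \<omega>)) \<partial>M) = - s * (\<integral>\<omega>. indicator G \<omega> * \<epsilon> t \<omega> \<partial>M)"
    by (simp add: mult.left_commute)
  then have "(\<integral>\<omega>. - (indicator G \<omega> * (s * \<epsilon> t \<omega>)) \<partial>M) = 0" using mean by simp
  \<comment> \<open>A nonnegative function with integral zero vanishes almost everywhere, so the
    noise would be null on \<open>G\<close>, against its variance \<open>\<sigma>^2\<close>
    there.\<close>
  then have "AE \<omega> in M. - (indicator G \<omega> * (s * \<epsilon> t \<omega>)) = 0"
    using integral_nonneg_eq_0_iff_AE[OF int nn] by simp
  then have "AE \<omega> in M. indicator G \<omega> *\<^sub>R ?f \<omega> = 0"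
    using feq by eventually_elim (use s in \<open>auto simp: indicator_def\<close>)
  then have "(\<integral>\<omega>\<in>G. ?f \<omega> \<partial>M) = (\<integral>\<omega>. 0 \<partial>M)"
    unfolding set_lebesgue_integral_def by (intro integral_cong_AE) auto
  then show False using var \<sigma> pG by simp
qed

definition sign_event :: "nat set \<Rightarrow> nat \<Rightarrow> 'w set" where
  "sign_event A t = {\<omega> \<in> space M. \<forall>s\<in>{1..t}. if s \<in> A then 0 < \<epsilon> s \<omega> else \<epsilon> s \<omega> < 0}"

lemma sign_event_hist: "sign_event A t \<in> sets (hist t)"
proof -
  have "{\<omega> \<in> space (hist t). if s \<in> A then 0 < \<epsilon> s \<omega> else \<epsilon> s \<omega> < 0} \<in> sets (hist t)"
    if "s \<in> {1..t}" for s
  proof -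
    have [measurable]: "\<epsilon> s \<in> borel_measurable (hist t)" by (rule noise_measurable_hist[OF that])
    have "{\<omega> \<in> space (hist t). 0 < \<epsilon> s \<omega>} \<in> sets (hist t)" "{\<omega> \<in> space (hist t). \<epsilon> s \<omega> < 0} \<in> sets (hist t)"
      by measurable
    then show ?thesis by (cases "s \<in> A") simp_all
  qed
  then have "{\<omega> \<in> space (hist t). \<forall>s\<in>{1..t}. if s \<in> A then 0 < \<epsilon> s \<omega> else \<epsilon> s \<omega> < 0} \<in> sets (hist t)"
    by (rule sets.sets_Collect_finite_All) auto
  then show ?thesis by (simp add: sign_event_def)
qed

text \<open>The sign event of the first \<open>t\<close> rounds belongs to the history, so within it
  the next noise still has conditional mean zero and variance \<open>\<sigma>^2\<close> and takes
  either sign.\<close>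

lemma sign_event_positive:
  assumes \<sigma>: "0 < \<sigma>"
  shows "t \<le> T \<Longrightarrow> 0 < measure M (sign_event A t)"
proof (induction t)
  case 0
  then show ?case by (simp add: sign_event_def prob_space)
next
  case (Suc t)
  define s where "s = (if Suc t \<in> A then 1 else -1 :: real)"
  have "sign_event A (Suc t) = sign_event A t \<inter> {\<omega> \<in> space M. 0 < s * \<epsilon> (Suc t) \<omega>}"
    by (auto simp: sign_event_def s_def atLeastAtMostSuc_conv)
  moreover have "0 < measure M (sign_event A t \<inter> {\<omega> \<in> space M. 0 < s * \<epsilon> (Suc t) \<omega>})"
    using Suc sign_event_hist[of A t] by (intro noise_takes_both_signs[OF \<sigma>]) (auto simp: s_def)
  ultimately show ?case by simp
qed

text \<open>Sign events of different subsets of \<open>{1..T}\<close> are disjoint, and each has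
  positive probability; hence the type of outcomes has room for all \<open>2 ^ T\<close> patterns,
  and \<open>sign_space\<close> can be built on it.\<close>

lemma sign_patterns_embed:
  assumes \<sigma>: "0 < \<sigma>"
  shows "\<exists>pick :: nat set \<Rightarrow> 'w. inj_on pick (Pow {1..T})"
proof -
  have "\<exists>\<omega>. \<omega> \<in> sign_event A T" for A
  proof (rule ccontr)
    assume "\<not> ?thesis"
    then have "sign_event A T = {}" by auto
    then show False using sign_event_positive[OF \<sigma> order_refl, of A] by simp
  qed
  then obtain pick where pick: "\<And>A. pick A \<in> sign_event A T" by metis
  have "inj_on pick (Pow {1..T})"
  proof (rule inj_onI, rule set_eqI)
    fix A B s assume A: "A \<in> Pow {1..T}" and B: "B \<in> Pow {1..T}" and eq: "pick A = pick B"
    show "s \<in> A \<longleftrightarrow> s \<in> B"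
    proof (cases "s \<in> {1..T}")
      case True
      have "if s \<in> A then 0 < \<epsilon> s (pick A) else \<epsilon> s (pick A) < 0"
        "if s \<in> B then 0 < \<epsilon> s (pick B) else \<epsilon> s (pick B) < 0"
        using pick[of A] pick[of B] True unfolding sign_event_def by blast+
      then show ?thesis using eq by (auto split: if_splits)
    next
      case False
      then show ?thesis using A B by blast
    qed
  qed
  then show ?thesis by blast
qed

end

text \<open>The premise on \<open>pick\<close> guards against vacuity: over a type of outcomes too
  small to carry a run, every \<open>\<beta>\<close> is an
  \<open>optimistic_parameter\<close>.\<close>

lemma optimistic_parameter_lower_bound:
  fixes \<sigma> :: real
  assumes dim2: "2 \<le> CARD('n::finite)" and \<sigma>: "0 < \<sigma>"
  shows "\<exists>c>0. \<forall>T \<beta>. \<forall>pick :: nat set \<Rightarrow> 'w. 2 \<le> T \<longrightarrow> 0 < \<beta> \<longrightarrow> inj_on pick (Pow {1..T}) \<longrightarrow>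
    optimistic_parameter TYPE('w) TYPE('n) \<sigma> T (1 / real T) \<beta> \<longrightarrow> 2 \<le> \<beta> \<and> sqrt (ln T) \<le> c * \<beta>"
proof -
  define d where "d = real CARD('n)"
  define \<gamma> where "\<gamma> = min \<sigma> 1"
  have d: "2 \<le> d" using dim2 by (simp add: d_def)
  have \<gamma>: "0 < \<gamma>" using \<sigma> by (simp add: \<gamma>_def)
  define u v w where "u = 8 * \<sigma>\<^sup>2 * d" and "v = 1252 * d\<^sup>2" and "w = \<gamma>\<^sup>2"
  have uvw: "0 < u" "0 < v" "0 < w" using d \<sigma> \<gamma> by (auto simp: u_def v_def w_def)
  have "eventually (\<lambda>K. u * (ln (v * K ^ 3) + 1) + 8 \<le> w * K / 4) at_top"
    using uvw by real_asymp
  then have "eventually (\<lambda>K. 1 \<le> K \<and> 26 / \<gamma>\<^sup>2 \<le> K \<and> u * (ln (v * K ^ 3) + 1) + 8 \<le> w * K / 4) at_top"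
    by (intro eventually_conj eventually_ge_at_top)
  then obtain K where K: "1 \<le> K" "26 / \<gamma>\<^sup>2 \<le> K" "8 * \<sigma>\<^sup>2 * d * (ln (1252 * d\<^sup>2 * K ^ 3) + 1) + 8 \<le> \<gamma>\<^sup>2 * K / 4"
    unfolding u_def v_def w_def by (auto simp: eventually_at_top_linorder)
  define c where "c = sqrt (1251 * K ^ 3 * d\<^sup>2)"
  have K3: "1 \<le> K ^ 3" using K(1) by simp
  have c: "0 < c" using K(1) d by (simp add: c_def)
  have "2 \<le> \<beta> \<and> sqrt (ln T) \<le> c * \<beta>"
    if T: "2 \<le> T" and \<beta>: "0 < \<beta>" and inj: "inj_on pick (Pow {1..T})"
      and opt: "optimistic_parameter TYPE('w) TYPE('n) \<sigma> T (1 / real T) \<beta>"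
    for T \<beta> and pick :: "nat set \<Rightarrow> 'w"
  proof -
    \<comment> \<open>Any unit vector serves, since the parameter must be optimistic for all of
      them.\<close>
    define \<theta> :: "real^'n" where "\<theta> = axis undefined 1"
    have \<theta>: "norm \<theta> = 1" by (simp add: \<theta>_def norm_axis_1)
    interpret sign_space pick T \<sigma> \<beta> \<theta> by unfold_locales (fact inj \<sigma> \<theta>)+
    have o: "holds_with_prob_ge P (1 - 1 / real T) (\<lambda>\<omega>. optimism \<beta> T \<theta> (\<lambda>s. action s \<omega>) (\<lambda>s. hat s \<omega>))"
      using opt linucb_signs unfolding optimistic_parameter_def by blast
    have b2: "2 \<le> \<beta>" by (rule beta_ge_2[OF T \<beta> o])
    then have b1: "1 \<le> \<beta>" by simp
    define k where "k = nat \<lceil>1250 * K ^ 3 * d\<^sup>2 * \<beta>\<^sup>2\<rceil>"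
    obtain e where e: "\<And>t. e t = \<sigma> \<or> e t = - \<sigma>"
      and ne: "\<not> (\<forall>b\<in>cball 0 1. b \<bullet> \<theta> \<le> ucb \<beta> (acts \<beta> \<theta> e) (est \<theta> (acts \<beta> \<theta> e) e) (Suc k) b)"
      using optimism_breaking_signs_exist[OF dim2 \<sigma> b1 \<theta>, of K] K
      unfolding d_def[symmetric] \<gamma>_def[symmetric] k_def by blast
    have "\<not> 2 ^ k < T"
    proof
      assume "2 ^ k < T"
      then have "\<forall>b\<in>cball 0 1. b \<bullet> \<theta> \<le> ucb \<beta> (acts \<beta> \<theta> e) (est \<theta> (acts \<beta> \<theta> e) e) (Suc k) b"
        using e by (intro ballI optimism_on_prefix[OF T o]) auto
      then show False using ne by contradiction
    qed
    then have "real T \<le> real (2 ^ k)" by (simp only: of_nat_le_iff not_less)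
    then have "ln (real T) \<le> ln (2 ^ k)" using T by simp
    also have "\<dots> = k * ln 2" by (simp add: ln_realpow)
    also have "\<dots> \<le> real k * 1" using ln_2_less_1 by (intro mult_left_mono) auto
    also have "\<dots> \<le> 1251 * K ^ 3 * d\<^sup>2 * \<beta>\<^sup>2"
    proof -
      have y0: "0 \<le> 1250 * K ^ 3 * d\<^sup>2 * \<beta>\<^sup>2" using K(1) by simp
      then have "0 \<le> \<lceil>1250 * K ^ 3 * d\<^sup>2 * \<beta>\<^sup>2\<rceil>" by linarith
      then have "real k = real_of_int \<lceil>1250 * K ^ 3 * d\<^sup>2 * \<beta>\<^sup>2\<rceil>" unfolding k_def by (rule of_nat_nat)
      then have "real k \<le> 1250 * K ^ 3 * d\<^sup>2 * \<beta>\<^sup>2 + 1"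
        using of_int_ceiling_le_add_one[of "1250 * K ^ 3 * d\<^sup>2 * \<beta>\<^sup>2"] by simp
      moreover have "1 * 1 * 1 \<le> K ^ 3 * d\<^sup>2 * \<beta>\<^sup>2"
      proof -
        have "1 \<le> d\<^sup>2" "1 \<le> \<beta>\<^sup>2" using d b1 by simp_all
        then show ?thesis using K(1) K3 by (intro mult_mono mult_nonneg_nonneg) auto
      qed
      ultimately show ?thesis by (simp add: mult.assoc)
    qed
    finally have "ln (real T) \<le> (c * \<beta>)\<^sup>2"
      using K(1) by (simp add: c_def power_mult_distrib)
    then have "sqrt (ln T) \<le> c * \<beta>" using c \<beta> by (intro real_le_lsqrt) auto
    then show ?thesis using b2 by simp
  qed
  then show ?thesis using c by blast
qed

section \<open>Assembly of the constants and the final claim\<close>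

lemma lesssim_byI: "0 \<le> f \<Longrightarrow> 0 \<le> g \<Longrightarrow> f \<le> c * g \<Longrightarrow> lesssim_by c f g"
  by (simp add: lesssim_by_def)

lemma asymp_byI:
  "0 \<le> f \<Longrightarrow> 0 \<le> g \<Longrightarrow> f \<le> c1 * g \<Longrightarrow> c2 * g \<le> f \<Longrightarrow> asymp_by c1 c2 f g"
  by (simp add: asymp_by_def lesssim_by_def gtrsim_by_def)

theorem proposition2:
  fixes \<sigma> :: real
  assumes "CARD('n::finite) \<ge> 2" and "\<sigma> > 0"
  shows "\<exists>c1>0. \<exists>c2>0. \<forall>T\<ge>2. \<forall>\<beta>>0.
    optimistic_parameter TYPE('w) TYPE('n) \<sigma> T (1 / real T) \<beta> \<longrightarrow>
    (\<forall>(M :: 'w measure) (\<theta> :: real^'n) a \<epsilon> \<theta>h. linucb M \<sigma> \<beta> T \<theta> a \<epsilon> \<theta>h \<longrightarrow>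
      (\<exists>t1 :: nat.
        asymp_by c1 c2 (real t1) (\<beta>\<^sup>2 * real CARD('n)) \<and>
        holds_with_prob_gt M (1 - 1 / real T)
          (\<lambda>\<omega>. exploration_phase_upto c1 c2 T t1 (\<lambda>s. a s \<omega>)) \<and>
        holds_with_prob_gt M (1 - 1 / real T) (\<lambda>\<omega>. \<forall>t\<in>{t1..T}.
          (let \<Lambda> = gram (\<lambda>s. a s \<omega>) t; l\<^sub>d = eigval \<Lambda> CARD('n) in
            asymp_by c1 c2 l\<^sub>d (eigval_rest_avg \<Lambda>) \<and>
            asymp_by c1 c2 (eigval_rest_avg \<Lambda>) (\<beta> * sqrt (real t / real CARD('n))) \<and>
            (\<forall>v. leading_unit_eigenvector \<Lambda> v \<and> v \<bullet> \<theta> \<ge> 0 \<longrightarrow>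
              lesssim_by c1 (norm (v - \<theta>)) (\<beta> / sqrt l\<^sub>d))))))"
proof -
  note dim2 = assms(1) and \<sigma> = assms(2)
  define d where "d = real CARD('n)"
  have d: "2 \<le> d" using dim2 by (simp add: d_def)
  obtain q where q: "exp 1 * (4 * \<sigma> * real CARD('n) + 3) ^ CARD('n) < 2 ^ q"
    using real_arch_pow[of 2 "exp 1 * (4 * \<sigma> * real CARD('n) + 3) ^ CARD('n)"] by auto
  define B where "B = \<sigma>\<^sup>2 + CARD('n) + 2 + q"
  have B: "0 < B" by (simp add: B_def add_nonneg_pos add_pos_nonneg)
  obtain c where c: "0 < c" and lower: "\<And>T \<beta> pick. 2 \<le> T \<Longrightarrow> 0 < \<beta> \<Longrightarrow>
      inj_on (pick :: nat set \<Rightarrow> 'w) (Pow {1..T}) \<Longrightarrow>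
      optimistic_parameter TYPE('w) TYPE('n) \<sigma> T (1 / real T) \<beta> \<Longrightarrow> 2 \<le> \<beta> \<and> sqrt (ln T) \<le> c * \<beta>"
    using optimistic_parameter_lower_bound[OF dim2 \<sigma>] by meson
  \<comment> \<open>\<open>B * sqrt (ln T) + 1\<close> is at most
    \<open>(B * c + 1) * \<beta>\<close> because \<open>1 \<le> \<beta>\<close>; this frees the
    confidence radius from \<open>T\<close>.\<close>
  define C where "C = B * c + 1"
  have C: "0 < C" using B c by (simp add: C_def add_pos_pos)
  obtain a\<^sub>0 l where a0: "1 \<le> a\<^sub>0" and l: "0 < l"
    and path: "\<forall>\<beta> T (x :: nat \<Rightarrow> real^'n) h \<theta> \<theta>' t.
      ucb_path \<beta> T x h \<longrightarrow> norm \<theta> = 1 \<longrightarrow>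
      (\<forall>s<T. \<theta>' s \<noteq> 0 \<longrightarrow> h s = \<theta>' s /\<^sub>R norm (\<theta>' s)) \<longrightarrow>
      (\<forall>s<T. anorm (gram x s) (\<theta>' s - \<theta>) \<le> C * \<beta>) \<longrightarrow>
      16 * a\<^sub>0\<^sup>2 * \<beta>\<^sup>2 \<le> real t \<longrightarrow> t \<le> T \<longrightarrow> settled a\<^sub>0 l \<beta> x \<theta> t"
    using confident_path_behaviour[OF dim2 C] by (elim exE conjE) (rule that, assumption+)
  define c1 where "c1 = 16 * a\<^sub>0\<^sup>2 + 2 * a\<^sub>0 + a\<^sub>0 * d + d + 2"
  \<comment> \<open>In this order the entries serve the lower bound on \<open>t1\<close>, the linear
    growth of the least eigenvalue, the exploration rounds in which it already exceeds
    \<open>\<beta>^2\<close>, the eigenvalue gap, the least eigenvalue against the average, and the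
    average against \<open>\<beta> * sqrt (t / d)\<close>.\<close>
  define c2 where "c2 = Min {16 * a\<^sub>0\<^sup>2 / d, 1 / (1250 * d), 1 / (16 * a\<^sub>0\<^sup>2 + 1), 1 / 2, l / a\<^sub>0, l}"
  have c1: "16 * a\<^sub>0\<^sup>2 + 1 \<le> c1" "d + 1 \<le> c1" "1 \<le> c1" "a\<^sub>0 * d \<le> c1" "2 * a\<^sub>0 \<le> c1"
    using a0 d mult_nonneg_nonneg[of a\<^sub>0 d] zero_le_power2[of a\<^sub>0] unfolding c1_def by linarith+
  have c2: "c2 \<le> 16 * a\<^sub>0\<^sup>2 / d" "c2 \<le> 1 / (1250 * d)" "c2 \<le> 1 / (16 * a\<^sub>0\<^sup>2 + 1)" "c2 \<le> 1 / 2"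
    "c2 \<le> l / a\<^sub>0" "c2 \<le> l"
    unfolding c2_def by (intro Min_le; simp)+
  have c2pos: "0 < c2"
    unfolding c2_def using a0 l d by (subst Min_gr_iff) (auto intro!: divide_pos_pos add_pos_nonneg)
  have c1pos: "0 < c1" using c1(3) by linarith
  show ?thesis
  proof (rule exI[of _ c1], rule conjI[OF c1pos], rule exI[of _ c2], rule conjI[OF c2pos],
      intro allI impI)
    fix T \<beta> and M :: "'w measure" and \<theta> :: "real^'n" and a \<epsilon> \<theta>h
    assume T: "2 \<le> T" and \<beta>: "0 < \<beta>"
      and opt: "optimistic_parameter TYPE('w) TYPE('n) \<sigma> T (1 / real T) \<beta>"
      and lin: "linucb M \<sigma> \<beta> T \<theta> a \<epsilon> \<theta>h"
    interpret linucb M \<sigma> \<beta> T \<theta> a \<epsilon> \<theta>h by (rule lin)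
    obtain pick :: "nat set \<Rightarrow> 'w" where "inj_on pick (Pow {1..T})"
      using sign_patterns_embed[OF \<sigma>] by blast
    from lower[OF T \<beta> this opt] have b2: "2 \<le> \<beta>" and lnT: "sqrt (ln T) \<le> c * \<beta>" by auto
    have bb: "1 \<le> \<beta>\<^sup>2" using b2 by simp
    obtain E where E: "E \<in> sets M" "1 - 1 / real T < measure M E"
      and conf: "\<And>\<omega> t. \<omega> \<in> E \<Longrightarrow> t < T \<Longrightarrow>
        anorm (gram (\<lambda>s. a s \<omega>) t) (ridge (\<lambda>s. a s \<omega>) (\<lambda>s. reward \<theta> a \<epsilon> s \<omega>) t - \<theta>) \<le> B * sqrt (ln T) + 1"
      using confidence_event[OF dim2 \<sigma> T q] unfolding B_def by blast
    \<comment> \<open>The threshold of \<open>concentration\<close>, the same for every outcome. If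
      it exceeds \<open>T\<close>, the claims about the rounds after exploration are empty.\<close>
    define t1 where "t1 = nat \<lceil>16 * a\<^sub>0\<^sup>2 * \<beta>\<^sup>2\<rceil>"
    have t1: "16 * a\<^sub>0\<^sup>2 * \<beta>\<^sup>2 \<le> real t1" "real t1 \<le> (16 * a\<^sub>0\<^sup>2 + 1) * \<beta>\<^sup>2"
    proof -
      show "16 * a\<^sub>0\<^sup>2 * \<beta>\<^sup>2 \<le> real t1" unfolding t1_def by (rule real_nat_ceiling_ge)
      have "0 \<le> 16 * a\<^sub>0\<^sup>2 * \<beta>\<^sup>2" by simp
      then have "0 \<le> \<lceil>16 * a\<^sub>0\<^sup>2 * \<beta>\<^sup>2\<rceil>" by linarith
      then have "real t1 = real_of_int \<lceil>16 * a\<^sub>0\<^sup>2 * \<beta>\<^sup>2\<rceil>" unfolding t1_def by (rule of_nat_nat)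
      then have "real t1 \<le> 16 * a\<^sub>0\<^sup>2 * \<beta>\<^sup>2 + 1"
        using of_int_ceiling_le_add_one[of "16 * a\<^sub>0\<^sup>2 * \<beta>\<^sup>2"] by simp
      then show "real t1 \<le> (16 * a\<^sub>0\<^sup>2 + 1) * \<beta>\<^sup>2" using bb by (simp add: distrib_right)
    qed
    have t1pos: "1 \<le> t1"
    proof -
      have "0 < 16 * a\<^sub>0\<^sup>2 * \<beta>\<^sup>2" using a0 \<beta> by simp
      then have "0 < real t1" using t1(1) by linarith
      then show ?thesis by simp
    qed
    have dr: "real CARD('n) = d" by (simp add: d_def)
    have up: "ucb_path \<beta> T (\<lambda>s. a s \<omega>) (\<lambda>s. \<theta>h s \<omega>)" if "\<omega> \<in> space M" for \<omega>
      using dim2 b2 estimator_unit action_argmax that by unfold_locales auto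
    have main: "settled a\<^sub>0 l \<beta> (\<lambda>s. a s \<omega>) \<theta> t"
      if \<omega>: "\<omega> \<in> E" and t: "t1 \<le> t" "t \<le> T" for \<omega> t
    proof -
      have \<omega>M: "\<omega> \<in> space M" using sets.sets_into_space[OF E(1)] \<omega> by blast
      let ?r = "\<lambda>s. ridge (\<lambda>s. a s \<omega>) (\<lambda>s. reward \<theta> a \<epsilon> s \<omega>) s"
      have 1: "\<forall>s<T. ?r s \<noteq> 0 \<longrightarrow> \<theta>h s \<omega> = ?r s /\<^sub>R norm (?r s)"
        using estimator_projection \<omega>M by blast
      have "B * sqrt (ln T) + 1 \<le> C * \<beta>"
        using mult_left_mono[OF lnT less_imp_le[OF B]] b2 by (simp add: C_def distrib_right mult.assoc)
      then have 2: "\<forall>s<T. anorm (gram (\<lambda>s. a s \<omega>) s) (?r s - \<theta>) \<le> C * \<beta>"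
        using conf[OF \<omega>] by (meson order_trans)
      have 3: "16 * a\<^sub>0\<^sup>2 * \<beta>\<^sup>2 \<le> real t" using t1(1) t(1) by (simp add: order_trans)
      show ?thesis
        using path[THEN spec[of _ \<beta>], THEN spec[of _ T], THEN spec[of _ "\<lambda>s. a s \<omega>"],
            THEN spec[of _ "\<lambda>s. \<theta>h s \<omega>"], THEN spec[of _ \<theta>], THEN spec[of _ ?r], THEN spec[of _ t]]
          up[OF \<omega>M] norm_theta 1 2 3 t(2) by iprover
    qed
    have "asymp_by c1 c2 (real t1) (\<beta>\<^sup>2 * real CARD('n))"
    proof -
      have "real t1 \<le> c1 * \<beta>\<^sup>2" using t1(2) mult_right_mono[OF c1(1), of "\<beta>\<^sup>2"] by simp
      also have "\<dots> \<le> c1 * (\<beta>\<^sup>2 * d)"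
        using c1pos d mult_left_mono[of 1 d "\<beta>\<^sup>2"] by (intro mult_left_mono) auto
      finally have 1: "real t1 \<le> c1 * (\<beta>\<^sup>2 * d)" .
      have "c2 * (\<beta>\<^sup>2 * d) \<le> 16 * a\<^sub>0\<^sup>2 / d * (\<beta>\<^sup>2 * d)"
        using c2(1) d by (intro mult_right_mono) auto
      also have "\<dots> = 16 * a\<^sub>0\<^sup>2 * \<beta>\<^sup>2" using d by simp
      finally have 2: "c2 * (\<beta>\<^sup>2 * d) \<le> real t1" using t1(1) by linarith
      show ?thesis unfolding dr using 1 2 d by (intro asymp_byI) auto
    qed
    moreover have "holds_with_prob_gt M (1 - 1 / real T)
          (\<lambda>\<omega>. exploration_phase_upto c1 c2 T t1 (\<lambda>s. a s \<omega>))"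
      unfolding holds_with_prob_gt_def
    proof (rule bexI[OF _ E(1)], rule conjI[OF E(2)], rule ballI)
      fix \<omega> assume \<omega>: "\<omega> \<in> E"
      have \<omega>M: "\<omega> \<in> space M" using sets.sets_into_space[OF E(1)] \<omega> by blast
      define x where "x = (\<lambda>s. a s \<omega>)"
      interpret ucb_path \<beta> T x "\<lambda>s. \<theta>h s \<omega>" unfolding x_def by (rule up[OF \<omega>M])
      have "asymp_by c1 c2 (lmin x t) (real t / d)" if t: "t \<in> {1..min t1 T}" for t
      proof -
        have tT: "t \<le> T" "1 \<le> real t" "real t \<le> real t1" using t by auto
        have td: "0 \<le> real t / d" using d by simp
        have "lmin x t \<le> 1 + real t / d" using lmin_le[OF tT(1)] by (simp add: d_def)
        also have "\<dots> \<le> (d + 1) * (real t / d)" using tT(2) d by (simp add: field_simps)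
        also have "\<dots> \<le> c1 * (real t / d)" using c1(2) td by (intro mult_right_mono) auto
        finally have 1: "lmin x t \<le> c1 * (real t / d)" .
        have 2: "c2 * (real t / d) \<le> lmin x t"
          using lmin_initial_growth[OF order_refl tT(1)]
        proof
          assume h: "1 * \<beta>\<^sup>2 \<le> lmin x t"
          have "c2 * (real t / d) \<le> c2 * real t"
            using c2pos d tT by (intro mult_left_mono) (auto simp: field_simps)
          also have "\<dots> \<le> 1 / (16 * a\<^sub>0\<^sup>2 + 1) * ((16 * a\<^sub>0\<^sup>2 + 1) * \<beta>\<^sup>2)"
            using c2(3) c2pos tT t1(2) by (intro mult_mono) (auto intro: order_trans)
          also have "\<dots> = \<beta>\<^sup>2"
          proof -
            have "16 * a\<^sub>0\<^sup>2 + 1 \<noteq> 0" using zero_le_power2[of a\<^sub>0] by linarith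
            then show ?thesis by simp
          qed
          finally show ?thesis using h by simp
        next
          assume h: "real t / (1250 * 1\<^sup>2 * (real CARD('n))\<^sup>2) \<le> lmin x t"
          have "c2 * (real t / d) \<le> 1 / (1250 * d) * (real t / d)"
            using c2(2) td by (intro mult_right_mono) auto
          also have "\<dots> = real t / (1250 * 1\<^sup>2 * (real CARD('n))\<^sup>2)" by (simp add: dr power2_eq_square)
          finally show ?thesis using h by simp
        qed
        show ?thesis by (rule asymp_byI[OF less_imp_le[OF lmin_pos] td 1 2])
      qed
      moreover have "gtrsim_by c2 (eigval (gram x t1) 1 - eigval (gram x t1) 2) (real t1)" if "t1 \<le> T"
      proof -
        have "real t1 / 2 \<le> eigval (gram x t1) 1 - eigval (gram x t1) 2"
          using main[OF \<omega> order_refl that] by (simp add: x_def settled_def)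
        moreover have "c2 * real t1 \<le> 1 / 2 * real t1" using c2(4) by (intro mult_right_mono) auto
        ultimately show ?thesis unfolding gtrsim_by_def by simp
      qed
      ultimately show "exploration_phase_upto c1 c2 T t1 (\<lambda>s. a s \<omega>)"
        unfolding exploration_phase_upto_def x_def[symmetric] dr by blast
    qed
    moreover have "holds_with_prob_gt M (1 - 1 / real T) (\<lambda>\<omega>. \<forall>t\<in>{t1..T}.
          (let \<Lambda> = gram (\<lambda>s. a s \<omega>) t; l\<^sub>d = eigval \<Lambda> CARD('n) in
            asymp_by c1 c2 l\<^sub>d (eigval_rest_avg \<Lambda>) \<and>
            asymp_by c1 c2 (eigval_rest_avg \<Lambda>) (\<beta> * sqrt (real t / real CARD('n))) \<and>
            (\<forall>v. leading_unit_eigenvector \<Lambda> v \<and> v \<bullet> \<theta> \<ge> 0 \<longrightarrow>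
              lesssim_by c1 (norm (v - \<theta>)) (\<beta> / sqrt l\<^sub>d))))"
      unfolding holds_with_prob_gt_def Let_def
    proof (rule bexI[OF _ E(1)], rule conjI[OF E(2)], intro ballI)
      fix \<omega> t assume \<omega>: "\<omega> \<in> E" and t: "t \<in> {t1..T}"
      define x where "x = (\<lambda>s. a s \<omega>)"
      define m where "m = lmin x t"
      define avg where "avg = eigval_rest_avg (gram x t)"
      define z where "z = \<beta> * sqrt t"
      have m0: "0 < m" unfolding m_def by (rule lmin_pos)
      have t0: "1 \<le> real t" using t t1pos by simp
      have z0: "0 < z" using \<beta> t0 by (simp add: z_def)
      have f: "l * z \<le> m" "tail_sum (gram x t) \<le> a\<^sub>0 * z"
        "\<And>v. norm v = 1 \<Longrightarrow> gram x t *v v = eigval (gram x t) 1 *\<^sub>R v \<Longrightarrow> 0 \<le> v \<bullet> \<theta> \<Longrightarrow>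
          norm (v - \<theta>) \<le> 2 * a\<^sub>0 * (\<beta> / sqrt m)"
        using main[OF \<omega>, of t] t by (auto simp: settled_def x_def m_def z_def mult.assoc)
      have avg: "avg = tail_sum (gram x t) / (d - 1)"
        by (simp add: avg_def eigval_rest_avg_def tail_sum_def d_def)
      have mavg: "m \<le> avg"
        using eigval_min_le_avg[OF gram_posdef, of x t] d by (simp add: avg m_def dr pos_le_divide_eq)
      have avgz: "avg \<le> a\<^sub>0 * z"
      proof -
        have az: "0 \<le> a\<^sub>0 * z" using a0 z0 by simp
        have "avg \<le> a\<^sub>0 * z / (d - 1)" unfolding avg using f(2) d by (intro divide_right_mono) auto
        also have "\<dots> \<le> a\<^sub>0 * z / 1" using az d by (intro divide_left_mono) auto
        finally show ?thesis by simp
      qed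
      define y where "y = \<beta> * sqrt (real t / d)"
      have y: "y \<le> z" "z \<le> d * y" "0 < y"
      proof -
        have yz: "y = z / sqrt d" by (simp add: y_def z_def real_sqrt_divide)
        have s: "1 \<le> sqrt d" using d by simp
        have sd: "sqrt d \<le> d" using d s mult_left_mono[OF s, of "sqrt d"] by simp
        have "z / sqrt d \<le> z / 1" using z0 s by (intro divide_left_mono) auto
        then show "y \<le> z" by (simp add: yz)
        show "0 < y" using z0 d by (simp add: yz)
        then have "sqrt d * y \<le> d * y" using sd by (intro mult_right_mono) auto
        moreover have "sqrt d * y = z" using d by (simp add: yz)
        ultimately show "z \<le> d * y" by simp
      qed
      have A1: "asymp_by c1 c2 m avg"
      proof -
        have "m \<le> c1 * avg" using mavg m0 c1(3) mult_right_mono[of 1 c1 avg] by linarith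
        moreover have "c2 * avg \<le> m"
        proof -
          have "c2 * avg \<le> (l / a\<^sub>0) * (a\<^sub>0 * z)"
            using c2(5) c2pos avgz m0 mavg l a0 by (intro mult_mono) auto
          also have "\<dots> = l * z" using a0 by simp
          finally show ?thesis using f(1) by simp
        qed
        ultimately show ?thesis using m0 mavg by (intro asymp_byI) auto
      qed
      have A2: "asymp_by c1 c2 avg y"
      proof -
        have "a\<^sub>0 * z \<le> a\<^sub>0 * (d * y)" using y(2) a0 by (intro mult_left_mono) auto
        with avgz have "avg \<le> a\<^sub>0 * (d * y)" by (rule order_trans)
        also have "\<dots> \<le> c1 * y" using mult_right_mono[OF c1(4), of y] y(3) by (simp add: mult.assoc)
        finally have "avg \<le> c1 * y" .
        moreover have "c2 * y \<le> avg"
        proof -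
          have "c2 * y \<le> l * z" using c2(6) c2pos y l by (intro mult_mono) auto
          then show ?thesis using f(1) mavg by simp
        qed
        ultimately show ?thesis using m0 mavg y(3) by (intro asymp_byI) auto
      qed
      have A3: "lesssim_by c1 (norm (v - \<theta>)) (\<beta> / sqrt m)"
        if v: "leading_unit_eigenvector (gram x t) v" "0 \<le> v \<bullet> \<theta>" for v
      proof -
        have bm: "0 < \<beta> / sqrt m" using \<beta> m0 by simp
        have "norm (v - \<theta>) \<le> 2 * a\<^sub>0 * (\<beta> / sqrt m)"
          using v by (intro f(3)) (auto simp: leading_unit_eigenvector_def eigenspace_def)
        also have "\<dots> \<le> c1 * (\<beta> / sqrt m)" using c1(5) bm by (intro mult_right_mono) auto
        finally show ?thesis using bm by (intro lesssim_byI) auto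
      qed
      show "asymp_by c1 c2 (eigval (gram (\<lambda>s. a s \<omega>) t) CARD('n)) (eigval_rest_avg (gram (\<lambda>s. a s \<omega>) t)) \<and>
          asymp_by c1 c2 (eigval_rest_avg (gram (\<lambda>s. a s \<omega>) t)) (\<beta> * sqrt (real t / real CARD('n))) \<and>
          (\<forall>v. leading_unit_eigenvector (gram (\<lambda>s. a s \<omega>) t) v \<and> v \<bullet> \<theta> \<ge> 0 \<longrightarrow>
            lesssim_by c1 (norm (v - \<theta>)) (\<beta> / sqrt (eigval (gram (\<lambda>s. a s \<omega>) t) CARD('n))))"
        using A1 A2 A3 unfolding avg_def m_def y_def x_def dr by blast
    qed
    ultimately show "\<exists>t1 :: nat.
        asymp_by c1 c2 (real t1) (\<beta>\<^sup>2 * real CARD('n)) \<and>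
        holds_with_prob_gt M (1 - 1 / real T)
          (\<lambda>\<omega>. exploration_phase_upto c1 c2 T t1 (\<lambda>s. a s \<omega>)) \<and>
        holds_with_prob_gt M (1 - 1 / real T) (\<lambda>\<omega>. \<forall>t\<in>{t1..T}.
          (let \<Lambda> = gram (\<lambda>s. a s \<omega>) t; l\<^sub>d = eigval \<Lambda> CARD('n) in
            asymp_by c1 c2 l\<^sub>d (eigval_rest_avg \<Lambda>) \<and>
            asymp_by c1 c2 (eigval_rest_avg \<Lambda>) (\<beta> * sqrt (real t / real CARD('n))) \<and>
            (\<forall>v. leading_unit_eigenvector \<Lambda> v \<and> v \<bullet> \<theta> \<ge> 0 \<longrightarrow>
              lesssim_by c1 (norm (v - \<theta>)) (\<beta> / sqrt l\<^sub>d))))"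
      by blast
  qed
qed

end
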